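(* Let $\Omega\subset\mathbb{R}^2$ be a bounded open convex set containing the origin in its interior, and let $\epsilon>0$. For $\vartheta\in[-\pi,\pi]$ let $A_\vartheta$ be the rotation by angle $\vartheta$ and $A_\vartheta\Omega=\{A_\vartheta x:x\in\Omega\}$. Then there is a function $\mathcal{C}_{\epsilon,\Omega}:[-\pi,\pi]\to[0,\infty]$ belonging to the weak-type space $L^{2,\infty}([-\pi,\pi])$ (in particular finite for almost every $\vartheta$) such that for all $\vartheta\in[-\pi,\pi]$, all $R\ge2$ and all $h$ with $1\le h\le R$, $$\mathcal{G}_{A_\vartheta\Omega}(R,h)\le \mathcal{C}_{\epsilon,\Omega}(\vartheta)\,R^{1/2}(\log R)^{1+\epsilon}.$$
   Context: For a bounded convex set $D$ and $t>0$ let $\mathcal{N}_D(t)=\mathrm{card}(tD\cap\mathbb{Z}^2)$, $E_D(t)=\mathcal{N}_D(t)-t^2\,\mathrm{area}(D)$, and $\mathcal{G}_D(R,h)=\big(\frac1h\int_R^{R+h}|E_D(t)|^2dt\big)^{1/2}$. A function $f$ lies in $L^{2,\infty}$ if $\sup_{s>0} s\cdot\mathrm{meas}\{|f|^2>s\}<\infty$. *)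

theory Defs
  imports "HOL-Analysis.Analysis"
begin

definition lattice_count :: "(real \<times> real) set \<Rightarrow> real \<Rightarrow> nat" where
  "lattice_count D t = card {p :: int \<times> int. (real_of_int (fst p), real_of_int (snd p)) \<in> (\<lambda>x. t *\<^sub>R x) ` D}"

definition lattice_error :: "(real \<times> real) set \<Rightarrow> real \<Rightarrow> real" where
  "lattice_error D t = real (lattice_count D t) - t\<^sup>2 * measure lborel D"

definition G_mean :: "(real \<times> real) set \<Rightarrow> real \<Rightarrow> real \<Rightarrow> real" where
  "G_mean D R h = sqrt ((1 / h) * (LBINT t=R..R+h. \<bar>lattice_error D t\<bar>\<^sup>2))"

definition rot :: "real \<Rightarrow> real \<times> real \<Rightarrow> real \<times> real" where
  "rot \<theta> p = (cos \<theta> * fst p - sin \<theta> * snd p, sin \<theta> * fst p + cos \<theta> * snd p)"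

definition weak_L2_on_circle :: "(real \<Rightarrow> ennreal) \<Rightarrow> bool" where
  "weak_L2_on_circle f \<longleftrightarrow> f \<in> borel_measurable (restrict_space lborel {-pi..pi}) \<and>
     (SUP s\<in>{0<..}. ennreal s * emeasure lborel {\<theta> \<in> {-pi..pi}. (f \<theta>)\<^sup>2 > ennreal s}) < \<infinity>"

end

theory Submission
  imports Defs
begin

text \<open>
  Integrating the indicator of \<open>t\<Omega>\<close> against a product of Fejer kernels replaces the lattice point count by a
  trigonometric sum over integer vectors \<open>k\<close> with \<open>0 < max \<bar>k\<^sub>1\<bar> \<bar>k\<^sub>2\<bar> \<le> L \<approx> R\<close>, at the cost of an error
  \<open>O(sqrt R)\<close>. The transform of \<open>\<Omega>\<close> along \<open>k\<close> is the one-dimensional transform of a concave function, the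
  length of the chords orthogonal to \<open>k\<close>; its second difference with step \<open>1/R\<close> has \<open>L\<^sup>1\<close> norm comparable to the areas of
  the two caps of depth \<open>1/(R\<bar>k\<bar>)\<close> and is concentrated near \<open>H(k)\<close> and \<open>-H(-k)\<close>, where \<open>H\<close> is the support function.
  Since the shell \<open>n \<le> H < n + 1\<close> contains \<open>O(n + 1)\<close> lattice points, the mean square over a unit interval near \<open>R\<close> is at
  most \<open>R\<close> plus \<open>R\<^sup>4\<close> times the sum of \<open>\<bar>k\<bar>\<close> times the squared cap areas. All these bounds are uniform for
  \<open>R\<close> in a dyadic block.

  Averaged over rotations, the square of the area of a cap of depth \<open>d\<close> is \<open>O(d\<^sup>3)\<close>. Hence the bound for the block
  \<open>R \<approx> 2\<^sup>m\<close> has mean \<open>O(m 2\<^sup>m)\<close>, and weighting the blocks by \<open>2\<^sup>-\<^sup>m m\<^sup>-\<^sup>2\<^sup>-\<^sup>2\<^sup>\<epsilon>\<close> gives a convergent sum \<open>\<C>\<^sup>2\<close>. So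
  the constant is even in the strong space \<open>L\<^sup>2\<close>.
\<close>

subsection \<open>Support functions, caps and rotations\<close>

text \<open>The boundary is not assumed smooth, so the transform of the body has no pointwise decay
  to exploit; areas of caps take over the role of curvature. The bound must hold for all
  \<open>R\<close> and \<open>h\<close> at once, whereas averaging over rotations controls one
  nonnegative quantity at a time. Hence everything before the averaging concerns a fixed body, with
  constants depending only on an inner and an outer radius, which rotations preserve, and a whole
  dyadic block is bounded by one cap sum free of \<open>R\<close>. The second difference serves this
  purpose: its step is measured in \<open>k \<bullet> x\<close>, so all transforms are multiplied by
  the same function of \<open>t\<close>, and that function stays away from 0 throughout the block.
  The exponent of the logarithm has two sources. After averaging, a frequency \<open>k\<close> costs
  \<open>norm k powr -2\<close>, and these sum to about \<open>log R\<close>; summing over the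
  blocks costs a further power \<open>1 + 2 * \<epsilon>\<close>. The square root of the product is
  the stated power.\<close>

definition convex_body :: "real \<Rightarrow> real \<Rightarrow> (real \<times> real) set \<Rightarrow> bool" where
  "convex_body \<rho> r S \<longleftrightarrow> open S \<and> convex S \<and> 0 < \<rho> \<and> ball 0 \<rho> \<subseteq> S \<and> S \<subseteq> ball 0 r"

definition supp :: "(real \<times> real) set \<Rightarrow> real \<times> real \<Rightarrow> real" where
  "supp S v = (SUP x\<in>S. v \<bullet> x)"

text \<open>The depth \<open>d\<close> is measured in the functional \<open>v \<bullet> x\<close>,
  so the geometric depth of the cap is \<open>d / norm v\<close>. One value of \<open>d\<close> thus
  serves all frequencies, and long vectors see thin caps.\<close>

definition cap :: "(real \<times> real) set \<Rightarrow> real \<times> real \<Rightarrow> real \<Rightarrow> (real \<times> real) set" where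
  "cap S v d = {x \<in> S. supp S v - d \<le> v \<bullet> x}"

definition vcap :: "(real \<times> real) set \<Rightarrow> real \<times> real \<Rightarrow> real \<Rightarrow> real" where
  "vcap S v d = measure lborel (cap S v d)"

lemma inner_le_supp:
  assumes "bounded S" "x \<in> S"
  shows "v \<bullet> x \<le> supp S v"
proof -
  obtain B where B: "\<And>x. x \<in> S \<Longrightarrow> norm x \<le> B" using assms(1) by (auto simp: bounded_iff)
  have "bdd_above ((\<lambda>x. v \<bullet> x) ` S)"
  proof (rule bdd_aboveI2)
    fix x assume "x \<in> S"
    have "v \<bullet> x \<le> norm v * norm x" by (rule norm_cauchy_schwarz)
    also have "\<dots> \<le> norm v * B" by (intro mult_left_mono B \<open>x \<in> S\<close>) auto
    finally show "v \<bullet> x \<le> norm v * B" .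
  qed
  with assms(2) show ?thesis unfolding supp_def by (rule cSUP_upper)
qed

lemma supp_least:
  assumes "S \<noteq> {}" "\<And>x. x \<in> S \<Longrightarrow> v \<bullet> x \<le> B"
  shows "supp S v \<le> B"
  unfolding supp_def using assms by (rule cSUP_least)

lemma convex_bodyD:
  assumes "convex_body \<rho> r S"
  shows "open S" "convex S" "0 < \<rho>" "ball 0 \<rho> \<subseteq> S" "S \<subseteq> ball 0 r" "bounded S" "S \<noteq> {}" "0 \<in> S" "\<rho> \<le> r" "0 < r"
proof -
  show 1: "open S" "convex S" "0 < \<rho>" "ball 0 \<rho> \<subseteq> S" "S \<subseteq> ball 0 r"
    using assms by (auto simp: convex_body_def)
  then show "bounded S" using bounded_subset bounded_ball by blast
  show 0: "0 \<in> S" using 1 by auto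
  then show "S \<noteq> {}" by auto
  have "ball 0 \<rho> \<subseteq> ball (0::real\<times>real) r" using 1 by auto
  then show "\<rho> \<le> r" using 1(3) by (simp add: ball_subset_ball_iff)
  then show "0 < r" using 1(3) by simp
qed

lemma supp_le_norm:
  assumes "convex_body \<rho> r S"
  shows "supp S v \<le> r * norm v"
proof (rule supp_least)
  show "S \<noteq> {}" using convex_bodyD[OF assms] by auto
  fix x assume "x \<in> S"
  then have "norm x \<le> r" using convex_bodyD(5)[OF assms] by (auto simp: dist_norm)
  have "v \<bullet> x \<le> norm v * norm x" by (rule norm_cauchy_schwarz)
  also have "\<dots> \<le> norm v * r" by (intro mult_left_mono \<open>norm x \<le> r\<close>) auto
  finally show "v \<bullet> x \<le> r * norm v" by (simp add: mult.commute)
qed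

lemma norm_le_supp:
  assumes "convex_body \<rho> r S"
  shows "\<rho> * norm v \<le> supp S v"
proof (cases "v = 0")
  case True
  then show ?thesis using inner_le_supp[of S 0 v] convex_bodyD[OF assms] by auto
next
  case False
  \<comment> \<open>The inner ball is open, so the radius \<rho> itself is reached only as a limit
    of \<open>s\<close>.\<close>
  have "s * norm v \<le> supp S v" if s: "0 < s" "s < \<rho>" for s
  proof -
    have "(s / norm v) *\<^sub>R v \<in> S"
      using convex_bodyD(4)[OF assms] s False by (auto simp: subset_eq)
    from inner_le_supp[OF convex_bodyD(6)[OF assms] this, of v]
    show ?thesis using False by (simp add: power2_norm_eq_inner[symmetric] power2_eq_square)
  qed
  then have "s \<le> supp S v / norm v" if "0 < s" "s < \<rho>" for s
    using that False by (simp add: field_simps)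
  then have "\<rho> \<le> supp S v / norm v"
    using convex_bodyD(3)[OF assms] by (intro dense_le_bounded[of 0 \<rho>]) auto
  then show ?thesis using False by (simp add: field_simps)
qed

lemma supp_add_le:
  assumes "bounded S" "S \<noteq> {}"
  shows "supp S (v + w) \<le> supp S v + supp S w"
  by (rule supp_least[OF assms(2)]) (auto simp: inner_add_left intro!: add_mono inner_le_supp[OF assms(1)])

lemma supp_scale:
  assumes "bounded S" "S \<noteq> {}" "c \<ge> 0"
  shows "supp S (c *\<^sub>R v) = c * supp S v"
proof -
  have le: "supp S (c *\<^sub>R v) \<le> c * supp S v" if "c \<ge> 0" for c v
    by (rule supp_least[OF assms(2)]) (auto intro!: mult_left_mono inner_le_supp[OF assms(1)] that)
  show ?thesis
  proof (cases "c = 0")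
    case True
    obtain x where "x \<in> S" using assms(2) by auto
    from True inner_le_supp[OF assms(1) this, of 0] le[of 0 v] show ?thesis by auto
  next
    case False
    have "supp S (inverse c *\<^sub>R c *\<^sub>R v) \<le> inverse c * supp S (c *\<^sub>R v)"
      using assms(3) by (intro le) auto
    then have "c * supp S v \<le> supp S (c *\<^sub>R v)" using False assms(3) by (simp add: field_simps)
    with le[OF assms(3), of v] show ?thesis by simp
  qed
qed

lemma supp_diff_le:
  assumes "convex_body \<rho> r S"
  shows "\<bar>supp S v - supp S w\<bar> \<le> r * norm (v - w)"
proof -
  have "supp S v \<le> supp S w + r * norm (v - w)" for v w
    using supp_add_le[of S "v - w" w] supp_le_norm[OF assms, of "v - w"] convex_bodyD[OF assms] by auto
  from this[of v w] this[of w v] show ?thesis by (simp add: norm_minus_commute abs_le_iff)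
qed

lemma continuous_supp:
  assumes "convex_body \<rho> r S"
  shows "continuous_on A (supp S)"
proof (rule continuous_on_subset)
  have r: "0 < r" using convex_bodyD[OF assms] by auto
  show "continuous_on UNIV (supp S)"
    unfolding continuous_on_iff
  proof (intro ballI allI impI)
    fix x :: "real \<times> real" and e :: real assume e: "0 < e"
    show "\<exists>d>0. \<forall>x'\<in>UNIV. dist x' x < d \<longrightarrow> dist (supp S x') (supp S x) < e"
    proof (intro exI[of _ "e / r"] conjI ballI impI)
      show "0 < e / r" using e r by simp
      fix x' assume "dist x' x < e / r"
      then have "r * norm (x' - x) < e" using r by (simp add: dist_norm field_simps)
      with supp_diff_le[OF assms, of x' x] show "dist (supp S x') (supp S x) < e"
        by (simp add: dist_real_def)
    qed
  qed
qed auto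

lemma borel_measurable_supp [measurable]:
  assumes "convex_body \<rho> r S"
  shows "supp S \<in> borel_measurable borel"
  using continuous_supp[OF assms] by (rule borel_measurable_continuous_onI)

lemma vcap_scale:
  assumes "bounded S" "S \<noteq> {}" "c > 0"
  shows "vcap S (c *\<^sub>R v) (c * d) = vcap S v d"
proof -
  have "c * supp S v - c * d \<le> c * (v \<bullet> x) \<longleftrightarrow> supp S v - d \<le> v \<bullet> x" for x
    using assms(3) by (simp flip: right_diff_distrib)
  then have "cap S (c *\<^sub>R v) (c * d) = cap S v d"
    using assms(3) by (simp add: cap_def supp_scale[OF assms(1,2)])
  then show ?thesis by (simp add: vcap_def)
qed

lemma sets_cap [measurable]: "open S \<Longrightarrow> cap S v d \<in> sets borel"
  unfolding cap_def by measurable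

lemma area_ball_le:
  assumes "S \<subseteq> ball 0 r" "S \<in> sets borel" "r > 0"
  shows "emeasure lborel (S::(real\<times>real) set) \<le> ennreal (4 * r\<^sup>2)" "measure lborel S \<le> 4 * r\<^sup>2"
proof -
  have "S \<subseteq> cbox (-r,-r) (r,r)"
  proof
    fix x assume "x \<in> S"
    then have "norm x < r" using assms by auto
    then have "\<bar>fst x\<bar> \<le> r" "\<bar>snd x\<bar> \<le> r" 
      using norm_fst_le[of "fst x" "snd x"] norm_snd_le[of "snd x" "fst x"] by auto
    then show "x \<in> cbox (-r,-r) (r,r)" by (cases x) (auto simp: cbox_Pair_eq)
  qed
  then have "emeasure lborel S \<le> emeasure lborel (cbox (-r,-r) (r,r))"
    by (intro emeasure_mono) auto
  also have "\<dots> = emeasure (lborel \<Otimes>\<^sub>M lborel) ({-r..r} \<times> {-r..r})"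
    by (simp add: cbox_Pair_eq lborel_prod)
  also have "\<dots> = ennreal (4 * r\<^sup>2)"
    using assms(3) by (subst lborel.emeasure_pair_measure_Times) (auto simp: ennreal_mult[symmetric] power2_eq_square)
  finally show "emeasure lborel S \<le> ennreal (4 * r\<^sup>2)" .
  then show "measure lborel S \<le> 4 * r\<^sup>2"
    unfolding measure_def by (metis enn2real_mono enn2real_ennreal ennreal_less_top zero_le_mult_iff zero_le_numeral zero_le_power2)
qed

section \<open>Shears, rotations and planar Lebesgue measure\<close>

definition shear1 :: "real \<Rightarrow> real \<times> real \<Rightarrow> real \<times> real" where
  "shear1 a p = (fst p + a * snd p, snd p)"
definition shear2 :: "real \<Rightarrow> real \<times> real \<Rightarrow> real \<times> real" where
  "shear2 a p = (fst p, snd p + a * fst p)"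

lemma shear_measurable [measurable]: "shear1 a \<in> borel \<rightarrow>\<^sub>M borel" "shear2 a \<in> borel \<rightarrow>\<^sub>M borel"
  unfolding shear1_def shear2_def
  by (auto intro!: borel_measurable_continuous_onI continuous_intros)

lemma emeasure_lborel_translate:
  assumes "X \<in> sets borel"
  shows "emeasure lborel ((\<lambda>x::real. c + x) -` X) = emeasure lborel X"
  by (subst (2) lborel_distr_plus[of c, symmetric]) (use assms in \<open>simp add: emeasure_distr\<close>)

lemma distr_shear: "distr lborel borel (shear1 a) = lborel" "distr lborel borel (shear2 a) = lborel"
proof -
  show "distr lborel borel (shear1 a) = lborel"
  proof (rule measure_eqI)
    fix X assume "X \<in> sets (distr lborel borel (shear1 a))"
    then have X: "X \<in> sets borel" by simp
    then have X': "X \<in> sets (lborel \<Otimes>\<^sub>M lborel)" unfolding lborel_prod by simp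
    have V: "shear1 a -` X \<in> sets (lborel \<Otimes>\<^sub>M lborel)"
      using measurable_sets[OF shear_measurable(1) X] unfolding lborel_prod by simp
    have "emeasure (distr lborel borel (shear1 a)) X = emeasure (lborel \<Otimes>\<^sub>M lborel) (shear1 a -` X)"
      using X by (simp add: emeasure_distr lborel_prod)
    also have "\<dots> = (\<integral>\<^sup>+y. emeasure lborel ((\<lambda>x. (x, y)) -` (shear1 a -` X)) \<partial>lborel)"
      by (rule lborel_pair.emeasure_pair_measure_alt2[OF V])
    also have "\<dots> = (\<integral>\<^sup>+y. emeasure lborel ((\<lambda>x. (x, y)) -` X) \<partial>lborel)"
    proof (rule nn_integral_cong)
      fix y :: real
      have "(\<lambda>x. (x, y)) -` (shear1 a -` X) = (\<lambda>x. a * y + x) -` ((\<lambda>x. (x, y)) -` X)"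
        by (auto simp: shear1_def add.commute)
      moreover have "(\<lambda>x. (x, y)) -` X \<in> sets borel" using sets_Pair2[OF X'] by simp
      ultimately show "emeasure lborel ((\<lambda>x. (x, y)) -` (shear1 a -` X)) = emeasure lborel ((\<lambda>x. (x, y)) -` X)"
        using emeasure_lborel_translate by simp
    qed
    also have "\<dots> = emeasure lborel X"
      by (subst lborel_pair.emeasure_pair_measure_alt2[OF X', symmetric]) (simp add: lborel_prod)
    finally show "emeasure (distr lborel borel (shear1 a)) X = emeasure lborel X" .
  qed simp
  show "distr lborel borel (shear2 a) = lborel"
  proof (rule measure_eqI)
    fix X assume "X \<in> sets (distr lborel borel (shear2 a))"
    then have X: "X \<in> sets borel" by simp
    then have X': "X \<in> sets (lborel \<Otimes>\<^sub>M lborel)" unfolding lborel_prod by simp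
    have V: "shear2 a -` X \<in> sets (lborel \<Otimes>\<^sub>M lborel)"
      using measurable_sets[OF shear_measurable(2) X] unfolding lborel_prod by simp
    have "emeasure (distr lborel borel (shear2 a)) X = emeasure (lborel \<Otimes>\<^sub>M lborel) (shear2 a -` X)"
      using X by (simp add: emeasure_distr lborel_prod)
    also have "\<dots> = (\<integral>\<^sup>+x. emeasure lborel (Pair x -` (shear2 a -` X)) \<partial>lborel)"
      by (rule lborel.emeasure_pair_measure_alt[OF V])
    also have "\<dots> = (\<integral>\<^sup>+x. emeasure lborel (Pair x -` X) \<partial>lborel)"
    proof (rule nn_integral_cong)
      fix x :: real
      have "Pair x -` (shear2 a -` X) = (\<lambda>y. a * x + y) -` (Pair x -` X)"
        by (auto simp: shear2_def add.commute)
      moreover have "Pair x -` X \<in> sets borel" using sets_Pair1[OF X'] by simp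
      ultimately show "emeasure lborel (Pair x -` (shear2 a -` X)) = emeasure lborel (Pair x -` X)"
        using emeasure_lborel_translate by simp
    qed
    also have "\<dots> = emeasure lborel X"
      by (subst lborel.emeasure_pair_measure_alt[OF X', symmetric]) (simp add: lborel_prod)
    finally show "emeasure (distr lborel borel (shear2 a)) X = emeasure lborel X" .
  qed simp
qed

lemma rot_measurable [measurable]: "rot \<theta> \<in> borel \<rightarrow>\<^sub>M borel"
  unfolding rot_def by (auto intro!: borel_measurable_continuous_onI continuous_intros)

lemma rot_rot: "rot a (rot b x) = rot (a + b) x"
  by (simp add: rot_def sin_add cos_add algebra_simps)

lemma rot_0 [simp]: "rot 0 x = x" by (simp add: rot_def)

lemma inner_rot: "rot \<theta> x \<bullet> rot \<theta> y = x \<bullet> y"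
proof -
  have "(c * a - s * b) * (c * a' - s * b') + (s * a + c * b) * (s * a' + c * b') = (c\<^sup>2 + s\<^sup>2) * (a * a' + b * b')"
    for c s a b a' b' :: real by algebra
  from this[of "cos \<theta>" "fst x" "sin \<theta>" "snd x" "fst y" "snd y"] show ?thesis
    by (simp add: inner_prod_def rot_def)
qed

lemma inner_rot_right: "v \<bullet> rot \<theta> x = rot (- \<theta>) v \<bullet> x"
  using inner_rot[of "-\<theta>" v "rot \<theta> x"] by (simp add: rot_rot)

lemma norm_rot [simp]: "norm (rot \<theta> x) = norm x"
  by (simp add: norm_eq_sqrt_inner inner_rot)

lemma linear_rot: "linear (rot \<theta>)"
  by (rule linearI) (auto simp: rot_def algebra_simps)

text \<open>A rotation by \<open>\<theta>\<close> with \<open>cos (\<theta>/2) \<noteq> 0\<close> is a product of three shears, and these preserve Lebesgue measure by Fubini.\<close>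

lemma distr_rot: "distr lborel borel (rot \<theta>) = lborel"
proof -
  have comp: "distr lborel borel (f \<circ> g) = lborel"
    if "distr lborel borel f = lborel" "distr lborel borel g = lborel" 
       "f \<in> borel \<rightarrow>\<^sub>M borel" "g \<in> borel \<rightarrow>\<^sub>M borel" for f g :: "real \<times> real \<Rightarrow> real \<times> real"
    using distr_distr[of f borel borel g lborel] that by simp
  have main: "distr lborel borel (rot \<theta>) = lborel" if c: "cos (\<theta> / 2) \<noteq> 0" for \<theta>
  proof -
    define s c where "s = sin (\<theta>/2)" and "c = cos (\<theta>/2)"
    have sc: "s * s = 1 - c * c" using sin_cos_squared_add[of "\<theta>/2"] by (simp add: s_def c_def power2_eq_square)
    have sin: "sin \<theta> = 2 * s * c" and cos: "cos \<theta> = 2 * c * c - 1"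
      using sin_double[of "\<theta>/2"] cos_double_cos[of "\<theta>/2"] by (simp_all add: s_def c_def power2_eq_square)
    have c0: "c \<noteq> 0" using c by (simp add: c_def)
    have e1: "1 - s / c * (2 * s * c) = 2 * c * c - 1" using c0 sc by (simp add: field_simps)
    have e2: "- (s / c) + (2 * c * c - 1) * (- (s / c)) = - (2 * s * c)" using c0 by (simp add: field_simps)
    \<comment> \<open>The shear parameters are minus tan (\<theta>/2), sin \<theta> and again minus
      tan (\<theta>/2); \<open>e1\<close> and \<open>e2\<close> identify entries of the matrix
      product with cos \<theta> and minus sin \<theta>.\<close>
    have "rot \<theta> = shear1 (- (s / c)) \<circ> (shear2 (2 * s * c) \<circ> shear1 (- (s / c)))"
    proof
      fix p :: "real \<times> real"
      obtain x y where p: "p = (x, y)" by (cases p)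
      have "x + - (s/c) * y + - (s/c) * (y + 2 * s * c * (x + - (s/c) * y))
          = (1 - s / c * (2 * s * c)) * x + (- (s / c) + (1 - s / c * (2 * s * c)) * (- (s / c))) * y"
        by (simp add: algebra_simps)
      also have "\<dots> = (2 * c * c - 1) * x + - (2 * s * c) * y" unfolding e1 e2 ..
      finally have 1: "x + - (s/c) * y + - (s/c) * (y + 2 * s * c * (x + - (s/c) * y)) = (2 * c * c - 1) * x - (2 * s * c) * y" by simp
      have "y + 2 * s * c * (x + - (s/c) * y) = 2 * s * c * x + (1 - s / c * (2 * s * c)) * y"
        by (simp add: algebra_simps)
      also have "\<dots> = 2 * s * c * x + (2 * c * c - 1) * y" unfolding e1 ..
      finally have 2: "y + 2 * s * c * (x + - (s/c) * y) = 2 * s * c * x + (2 * c * c - 1) * y" .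
      show "rot \<theta> p = (shear1 (- (s / c)) \<circ> (shear2 (2 * s * c) \<circ> shear1 (- (s / c)))) p"
        unfolding o_def shear1_def shear2_def rot_def p fst_conv snd_conv 1 sin cos unfolding 2 ..
    qed
    then show ?thesis by (auto intro!: comp distr_shear shear_measurable measurable_comp[where N=borel])
  qed
  show ?thesis
  proof (cases "cos (\<theta> / 2) = 0")
    case False then show ?thesis by (rule main)
  next
    case True
    \<comment> \<open>The exceptional angles are the odd multiples of \<open>pi\<close>; half of
      such an angle is no longer exceptional.\<close>
    have "cos (\<theta> / 2 / 2) \<noteq> 0"
    proof
      assume "cos (\<theta> / 2 / 2) = 0"
      then have "cos (\<theta> / 2) = -1" using cos_double_cos[of "\<theta>/2/2"] by simp
      with True show False by simp
    qed
    moreover have "rot \<theta> = rot (\<theta> / 2) \<circ> rot (\<theta> / 2)" by (auto simp: rot_rot fun_eq_iff)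
    ultimately show ?thesis by (auto intro!: comp main rot_measurable)
  qed
qed

lemma rot_image_eq_vimage: "rot \<theta> ` S = rot (- \<theta>) -` S"
proof (intro set_eqI iffI)
  fix x assume "x \<in> rot (-\<theta>) -` S"
  then show "x \<in> rot \<theta> ` S" by (intro image_eqI[of _ _ "rot (-\<theta>) x"]) (auto simp: rot_rot)
qed (auto simp: rot_rot)

lemma emeasure_rot:
  assumes "S \<in> sets borel"
  shows "emeasure lborel (rot \<theta> ` S) = emeasure lborel S"
  by (subst (2) distr_rot[of "-\<theta>", symmetric]) (use assms in \<open>simp add: emeasure_distr rot_image_eq_vimage\<close>)

lemma convex_body_rot:
  assumes "convex_body \<rho> r S"
  shows "convex_body \<rho> r (rot \<theta> ` S)"
proof -
  note b = convex_bodyD[OF assms]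
  have "continuous_on UNIV (rot (-\<theta>))" unfolding rot_def by (intro continuous_intros)
  then have "open (rot \<theta> ` S)" unfolding rot_image_eq_vimage using b(1) open_vimage by blast
  moreover have "convex (rot \<theta> ` S)" by (rule convex_linear_image[OF linear_rot b(2)])
  moreover have "ball 0 \<rho> \<subseteq> rot \<theta> ` S"
    unfolding rot_image_eq_vimage using b(4) by (auto simp: subset_eq)
  moreover have "rot \<theta> ` S \<subseteq> ball 0 r" using b(5) by (auto simp: subset_eq)
  ultimately show ?thesis using b(3) by (simp add: convex_body_def)
qed

lemma supp_rot: "supp (rot \<theta> ` S) v = supp S (rot (-\<theta>) v)"
  by (simp add: supp_def image_comp o_def inner_rot_right)

lemma vcap_rot:
  assumes "open S"
  shows "vcap (rot \<theta> ` S) v d = vcap S (rot (-\<theta>) v) d"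
proof -
  have "cap (rot \<theta> ` S) v d = rot \<theta> ` cap S (rot (-\<theta>) v) d"
    by (auto simp: cap_def supp_rot inner_rot_right)
  then show ?thesis using emeasure_rot[of "cap S (rot (-\<theta>) v) d" \<theta>] assms
    by (simp add: vcap_def measure_def)
qed

lemma cap_subset: "cap S v d \<subseteq> S" by (auto simp: cap_def)

lemma vcap_nonneg [simp]: "vcap S v d \<ge> 0" by (simp add: vcap_def)

lemma emeasure_cap:
  assumes "convex_body \<rho> r S"
  shows "emeasure lborel (cap S v d) = ennreal (vcap S v d)"
  unfolding vcap_def
proof (rule emeasure_eq_ennreal_measure)
  have "bounded (cap S v d)" using bounded_subset[OF convex_bodyD(6)[OF assms] cap_subset] .
  then show "emeasure lborel (cap S v d) \<noteq> top" using emeasure_bounded_finite by fastforce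
qed

lemma vcap_mono:
  assumes "convex_body \<rho> r S" "d \<le> e"
  shows "vcap S v d \<le> vcap S v e"
proof -
  have "emeasure lborel (cap S v d) \<le> emeasure lborel (cap S v e)"
    using assms(2) convex_bodyD(1)[OF assms(1)] by (intro emeasure_mono) (auto simp: cap_def)
  then show ?thesis by (simp add: emeasure_cap[OF assms(1)])
qed

text \<open>The caps are the sections of one measurable set in the product of directions and points,
  so Fubini's theorem makes their areas measurable. Measurability of all later cap sums in the
  rotation angle rests on this.\<close>

lemma vcap_measurable:
  assumes "convex_body \<rho> r S"
  shows "(\<lambda>v. vcap S v d) \<in> borel_measurable borel"
proof -
  have [measurable]: "S \<in> sets borel" using convex_bodyD(1)[OF assms] by simp
  note [measurable] = borel_measurable_supp[OF assms]
  have "{p \<in> space (borel \<Otimes>\<^sub>M lborel). snd p \<in> S \<and> supp S (fst p) - d \<le> fst p \<bullet> snd p} 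
     \<in> sets ((borel :: (real\<times>real) measure) \<Otimes>\<^sub>M (lborel :: (real\<times>real) measure))"
    by measurable
  from lborel.measurable_emeasure_Pair[OF this]
  have "(\<lambda>v. emeasure lborel (cap S v d)) \<in> borel_measurable borel"
    by (simp add: cap_def vimage_def space_pair_measure)
  then show ?thesis unfolding vcap_def measure_def by measurable
qed

lemma polar_exists:
  obtains b where "v = norm v *\<^sub>R rot b (1, 0)"
proof (cases "v = 0")
  case True then show ?thesis by (intro that[of 0]) (simp add: zero_prod_def)
next
  case False
  obtain x y where v: "v = (x, y)" by (cases v)
  have n: "norm v \<noteq> 0" "(norm v)\<^sup>2 = x\<^sup>2 + y\<^sup>2" using False by (simp, simp add: v norm_Pair)
  have "(x / norm v)\<^sup>2 + (y / norm v)\<^sup>2 = 1"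
    using n(1) by (simp add: power_divide n(2)[symmetric] flip: add_divide_distrib)
  then obtain b where "x / norm v = cos b" "y / norm v = sin b" by (rule sincos_total_2pi)
  then have "v = norm v *\<^sub>R rot b (1, 0)" using n by (simp add: rot_def v field_simps)
  then show ?thesis by (rule that)
qed

subsection \<open>Mean squares of cap areas over directions\<close>

lemma nn_integral_scale:
  fixes f :: "real \<times> real \<Rightarrow> ennreal"
  assumes [measurable]: "f \<in> borel_measurable borel" and "c \<noteq> 0"
  shows "(\<integral>\<^sup>+x. f x \<partial>lborel) = ennreal (c\<^sup>2) * (\<integral>\<^sup>+x. f (c *\<^sub>R x) \<partial>lborel)"
  by (subst lborel_affine[OF assms(2), of 0])
     (simp add: nn_integral_density nn_integral_distr nn_integral_cmult power2_eq_square)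

lemma integral_scale:
  fixes f :: "real \<times> real \<Rightarrow> real"
  assumes [measurable]: "f \<in> borel_measurable borel" and "c \<noteq> 0"
  shows "(\<integral>x. f x \<partial>lborel) = c\<^sup>2 * (\<integral>x. f (c *\<^sub>R x) \<partial>lborel)"
  by (subst lborel_affine[OF assms(2), of 0])
     (simp add: integral_density integral_distr power2_eq_square)

lemma sets_scaleR_image:
  assumes "S \<in> sets borel" "c \<noteq> 0"
  shows "(\<lambda>x. c *\<^sub>R x) ` S \<in> sets (borel :: (real \<times> real) measure)"
proof -
  have "(\<lambda>x. c *\<^sub>R x) ` S = (\<lambda>x. (1 / c) *\<^sub>R x) -` S \<inter> space borel"
    using assms(2) by (auto intro!: image_eqI[where x="(1 / c) *\<^sub>R x" for x])
  then show ?thesis using measurable_sets[of "\<lambda>x::real\<times>real. (1 / c) *\<^sub>R x" borel borel S] assms(1) by simp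
qed

lemma emeasure_scale:
  fixes S :: "(real \<times> real) set"
  assumes "S \<in> sets borel" "c \<noteq> 0"
  shows "emeasure lborel ((\<lambda>x. c *\<^sub>R x) ` S) = ennreal (c\<^sup>2) * emeasure lborel S"
proof -
  note m = sets_scaleR_image[OF assms]
  have "emeasure lborel ((\<lambda>x. c *\<^sub>R x) ` S) = (\<integral>\<^sup>+x. indicator ((\<lambda>x. c *\<^sub>R x) ` S) x \<partial>lborel)"
    using m by simp
  also have "\<dots> = ennreal (c\<^sup>2) * (\<integral>\<^sup>+x. indicator ((\<lambda>x. c *\<^sub>R x) ` S) (c *\<^sub>R x) \<partial>lborel)"
    using m assms(2) by (intro nn_integral_scale) auto
  also have "(\<integral>\<^sup>+x. indicator ((\<lambda>x. c *\<^sub>R x) ` S) (c *\<^sub>R x) \<partial>lborel) = (\<integral>\<^sup>+x. indicator S x \<partial>lborel)"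
    using assms(2) by (intro nn_integral_cong) (auto simp: indicator_def)
  finally show ?thesis using assms by simp
qed

section \<open>Shift differences of quasiconvex functions\<close>

lemma shift_diff_integral:
  fixes f :: "real \<Rightarrow> real"
  assumes [measurable]: "f \<in> borel_measurable borel" and f: "\<And>x. 0 \<le> f x" "\<And>x. f x \<le> D" and "0 \<le> \<eta>"
  shows "integrable lborel (\<lambda>x. indicator {p..q} x * (f (x + \<eta>) - f x))"
    and "\<bar>\<integral>x. indicator {p..q} x * (f (x + \<eta>) - f x) \<partial>lborel\<bar> \<le> \<eta> * D"
proof -
  have D: "0 \<le> D" using f[of 0] by linarith
  have int: "integrable lborel (\<lambda>x. indicator {p..q} x * g x)" if [measurable]: "g \<in> borel_measurable borel" 
     and g: "\<And>x. 0 \<le> g x" "\<And>x. g x \<le> D" for g :: "real \<Rightarrow> real" and p q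
  proof (rule Bochner_Integration.integrable_bound[where f="\<lambda>x. D * indicator {p..q} x"])
    show "AE x in lborel. norm (indicator {p..q} x * g x) \<le> norm (D * indicator {p..q} x)"
      using g D by (auto simp: indicator_def)
  qed (auto intro!: integrable_real_indicator simp: emeasure_lborel_Icc_eq)
  have ii: "integrable lborel (\<lambda>x. D * indicator {u..v} x)" for u v :: real
    by (auto intro!: integrable_real_indicator simp: emeasure_lborel_Icc_eq)
  have nf: "- f x \<le> D" for x using f(1)[of x] D by linarith
  have i1: "integrable lborel (\<lambda>x. indicator {p..q} x * f (x + \<eta>))" using f by (intro int) auto
  have i2: "integrable lborel (\<lambda>x. indicator {p..q} x * f x)" for p q using f by (intro int) auto
  show "integrable lborel (\<lambda>x. indicator {p..q} x * (f (x + \<eta>) - f x))"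
    using Bochner_Integration.integrable_diff[OF i1 i2] by (simp add: algebra_simps)
  \<comment> \<open>After a translation the two integrals cancel except on strips of length \<eta>
    at \<open>q\<close> and at \<open>p\<close>. As the values lie between 0 and \<open>D\<close>,
    either strip costs at most \<open>\<eta> * D\<close>.\<close>
  have "(\<integral>x. indicator {p..q} x * f (x + \<eta>) \<partial>lborel) = (\<integral>x. indicator {p+\<eta>..q+\<eta>} x * f x \<partial>lborel)"
    by (subst (2) lborel_integral_real_affine[where c=1 and t=\<eta>]) (auto intro!: Bochner_Integration.integral_cong simp: indicator_def add.commute)
  then have eq: "(\<integral>x. indicator {p..q} x * (f (x + \<eta>) - f x) \<partial>lborel) 
    = (\<integral>x. indicator {p+\<eta>..q+\<eta>} x * f x - indicator {p..q} x * f x \<partial>lborel)"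
    using i1 i2 by (simp add: algebra_simps)
  have "(\<integral>x. indicator {p+\<eta>..q+\<eta>} x * f x - indicator {p..q} x * f x \<partial>lborel) \<le> (\<integral>x. D * indicator {q..q+\<eta>} x \<partial>lborel)"
    using i2 f D nf ii assms(4) by (intro integral_mono ii Bochner_Integration.integrable_diff i2) (auto simp: indicator_def)
  also have "\<dots> = \<eta> * D" using assms(4) by simp
  finally have 1: "(\<integral>x. indicator {p..q} x * (f (x + \<eta>) - f x) \<partial>lborel) \<le> \<eta> * D" unfolding eq .
  have "(\<integral>x. indicator {p..q} x * f x - indicator {p+\<eta>..q+\<eta>} x * f x \<partial>lborel) \<le> (\<integral>x. D * indicator {p..p+\<eta>} x \<partial>lborel)"
    using i2 f D nf ii assms(4) by (intro integral_mono ii Bochner_Integration.integrable_diff i2) (auto simp: indicator_def)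
  also have "\<dots> = \<eta> * D" using assms(4) by simp
  finally have 2: "- (\<integral>x. indicator {p..q} x * (f (x + \<eta>) - f x) \<partial>lborel) \<le> \<eta> * D" unfolding eq using i2 by simp
  show "\<bar>\<integral>x. indicator {p..q} x * (f (x + \<eta>) - f x) \<partial>lborel\<bar> \<le> \<eta> * D" using 1 2 by linarith
qed

text \<open>A quasiconvex function first falls and then rises, so
  \<open>f (x + \<eta>) - f x\<close> changes sign at most once, from nonpositive to nonnegative. On
  either side of the change the absolute value is a fixed sign, and the integral telescopes.\<close>

lemma quasiconvex_shift:
  fixes f :: "real \<Rightarrow> real"
  assumes [measurable]: "f \<in> borel_measurable borel" and f: "\<And>x. 0 \<le> f x" "\<And>x. f x \<le> D" and \<eta>: "0 < \<eta>" and "a \<le> b"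
    and qc: "\<And>x y z. x < y \<Longrightarrow> y < z \<Longrightarrow> f y \<le> max (f x) (f z)"
  shows "(\<integral>\<^sup>+x. ennreal (indicator {a..b} x * \<bar>f (x + \<eta>) - f x\<bar>) \<partial>lborel) \<le> ennreal (2 * \<eta> * D)"
proof -
  \<comment> \<open>By \<open>up\<close>, a strict increase over one step forbids any later decrease
    over a step. The infimum of \<open>U\<close> is therefore the point where the sign
    changes.\<close>
  define U where "U = {x\<in>{a..b}. f x < f (x + \<eta>)}"
  have up: "f y \<le> f (y + \<eta>)" if x: "x \<in> U" and "x < y" for x y
  proof (cases "y < x + \<eta>")
    case True
    have fx: "f x < f (x + \<eta>)" using x by (simp add: U_def)
    have "f y \<le> f (x + \<eta>)" using qc[OF \<open>x < y\<close> True] fx by simp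
    moreover have "f (x + \<eta>) \<le> f (y + \<eta>)" using qc[of x "x + \<eta>" "y + \<eta>"] fx \<open>x < y\<close> \<eta> by (simp add: max_def split: if_splits)
    ultimately show ?thesis by simp
  next
    case False
    have fx: "f x < f (x + \<eta>)" using x by (simp add: U_def)
    have "f (x + \<eta>) \<le> f y"
    proof (cases "y = x + \<eta>")
      case False
      then show ?thesis using qc[of x "x + \<eta>" y] fx \<open>\<not> y < x + \<eta>\<close> \<eta> by (simp add: max_def split: if_splits)
    qed simp
    then have "f x < f y" using fx by simp
    then show ?thesis using qc[of x y "y + \<eta>"] \<open>x < y\<close> \<eta> by (simp add: max_def split: if_splits)
  qed
  obtain s where s: "a \<le> s" "s \<le> b" "\<And>x. x \<in> {a..<s} \<Longrightarrow> f (x + \<eta>) \<le> f x" "\<And>x. x \<in> {s<..b} \<Longrightarrow> f x \<le> f (x + \<eta>)"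
  proof (cases "U = {}")
    case True
    then show ?thesis using \<open>a \<le> b\<close> by (intro that[of b]) (auto simp: U_def not_less)
  next
    case False
    have bd: "bdd_below U" by (auto simp: U_def intro!: bdd_belowI[of _ a])
    obtain u where "u \<in> U" using False by auto
    show ?thesis
    proof (rule that[of "Inf U"])
      show "a \<le> Inf U" using False by (intro cInf_greatest) (auto simp: U_def)
      show "Inf U \<le> b" using cInf_lower[OF \<open>u \<in> U\<close> bd] \<open>u \<in> U\<close> by (auto simp: U_def)
      show "f (x + \<eta>) \<le> f x" if "x \<in> {a..<Inf U}" for x
      proof (rule ccontr)
        assume "\<not> f (x + \<eta>) \<le> f x"
        then have "x \<in> U" using that \<open>Inf U \<le> b\<close> by (auto simp: U_def)
        from cInf_lower[OF this bd] that show False by simp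
      qed
      show "f x \<le> f (x + \<eta>)" if "x \<in> {Inf U<..b}" for x
      proof -
        from that have "\<exists>u\<in>U. u < x" by (simp add: cInf_less_iff[OF False bd])
        then obtain u where "u \<in> U" "u < x" by blast
        then show ?thesis by (rule up)
      qed
    qed
  qed
  have A: "AE x in lborel. x \<noteq> s" by (rule AE_lborel_singleton)
  note sh = shift_diff_integral[OF assms(1) f order.strict_implies_order[OF \<eta>]]
  let ?g = "\<lambda>x. indicator {s..b} x * (f (x + \<eta>) - f x) - indicator {a..s} x * (f (x + \<eta>) - f x)"
  have "(\<integral>\<^sup>+x. ennreal (indicator {a..b} x * \<bar>f (x + \<eta>) - f x\<bar>) \<partial>lborel) = (\<integral>\<^sup>+x. ennreal (?g x) \<partial>lborel)"
  proof (rule nn_integral_cong_AE, use A in eventually_elim)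
    fix x assume "x \<noteq> s"
    then show "ennreal (indicator {a..b} x * \<bar>f (x + \<eta>) - f x\<bar>) = ennreal (?g x)"
      using s(1,2) s(3)[of x] s(4)[of x] by (auto simp: indicator_def)
  qed
  also have "\<dots> = ennreal (\<integral>x. ?g x \<partial>lborel)"
  proof (rule nn_integral_eq_integral)
    show "AE x in lborel. 0 \<le> ?g x"
    proof (use A in eventually_elim)
      fix x assume "x \<noteq> s"
      then show "0 \<le> ?g x" using s(1,2) s(3)[of x] s(4)[of x] by (auto simp: indicator_def)
    qed
  qed (intro Bochner_Integration.integrable_diff sh)
  also have "(\<integral>x. ?g x \<partial>lborel) \<le> 2 * \<eta> * D"
    using sh(2)[of s b] sh(2)[of a s] by (subst Bochner_Integration.integral_diff[OF sh(1) sh(1)]) linarith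
  finally show ?thesis by (simp add: ennreal_leI)
qed

section \<open>Cap areas and the variation of depth under tilting\<close>

lemma parallelogram_area:
  assumes "0 \<le> d" "0 \<le> \<mu>" "X \<in> sets borel"
    and X: "\<And>x. x \<in> X \<Longrightarrow> s - d \<le> fst x - \<tau> * snd x \<and> fst x - \<tau> * snd x \<le> s \<and> \<bar>snd x - c\<bar> \<le> \<mu>"
  shows "emeasure lborel X \<le> ennreal (2 * \<mu> * d)"
proof -
  have X': "X \<in> sets (lborel \<Otimes>\<^sub>M lborel)" using assms(3) unfolding lborel_prod by simp
  have "emeasure lborel X = (\<integral>\<^sup>+y. emeasure lborel ((\<lambda>x. (x, y)) -` X) \<partial>lborel)"
    by (subst lborel_pair.emeasure_pair_measure_alt2[OF X', symmetric]) (simp add: lborel_prod)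
  also have "\<dots> \<le> (\<integral>\<^sup>+y. ennreal d * indicator {c - \<mu>..c + \<mu>} y \<partial>lborel)"
  proof (rule nn_integral_mono)
    fix y :: real
    show "emeasure lborel ((\<lambda>x. (x, y)) -` X) \<le> ennreal d * indicator {c - \<mu>..c + \<mu>} y"
    proof (cases "y \<in> {c - \<mu>..c + \<mu>}")
      case True
      have "emeasure lborel ((\<lambda>x. (x, y)) -` X) \<le> emeasure lborel {s - d + \<tau> * y..s + \<tau> * y}"
        by (rule emeasure_mono) (auto dest!: X)
      then show ?thesis using True assms(1) by simp
    next
      case False
      then have "(\<lambda>x. (x, y)) -` X = {}" using X by (fastforce simp: abs_le_iff)
      then show ?thesis by simp
    qed
  qed
  also have "\<dots> = ennreal (2 * \<mu> * d)" using assms(1,2) by (simp add: nn_integral_cmult ennreal_mult[symmetric] mult_ac)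
  finally show ?thesis .
qed

text \<open>A point of the dilate of \<open>S\<close> by \<open>1 - \<kappa>\<close> keeps at least
  the fraction \<kappa> of the support value as depth in every direction, hence depth at least
  \<open>\<kappa> * \<rho>\<close> when \<open>norm v \<ge> 1\<close>. The set avoids this dilate,
  and the complement of the dilate in \<open>S\<close> has relative area
  \<open>1 - (1 - \<kappa>)^2\<close>, at most \<open>2 * \<kappa>\<close>.\<close>

lemma annulus_area:
  assumes "convex_body \<rho> r S" "\<kappa> > 0"
  shows "emeasure lborel {x \<in> S. \<exists>v. norm v \<ge> 1 \<and> supp S v - v \<bullet> x < \<kappa> * \<rho>} \<le> ennreal (8 * \<kappa> * r\<^sup>2)"
    (is "emeasure _ ?W \<le> _")
proof -
  note b = convex_bodyD[OF assms(1)]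
  have S: "S \<in> sets borel" using b by simp
  have area: "emeasure lborel S \<le> ennreal (4 * r\<^sup>2)" using area_ball_le(1)[OF b(5) S b(10)] .
  have fin: "emeasure lborel S \<noteq> top" using emeasure_bounded_finite[OF b(6)] by auto
  show ?thesis
  proof (cases "\<kappa> < 1")
    case False
    have "emeasure lborel ?W \<le> emeasure lborel S" using S by (intro emeasure_mono) auto
    also have "\<dots> \<le> ennreal (4 * r\<^sup>2)" by (rule area)
    also have "\<dots> \<le> ennreal (8 * \<kappa> * r\<^sup>2)" using False 
      by (intro ennreal_leI mult_right_mono) auto
    finally show ?thesis .
  next
    case True
    define T where "T = (\<lambda>x. (1 - \<kappa>) *\<^sub>R x) ` S"
    have T: "T \<in> sets borel" unfolding T_def using S True by (intro sets_scaleR_image) auto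
    have TS: "T \<subseteq> S"
    proof
      fix x assume "x \<in> T"
      then obtain y where "y \<in> S" "x = (1 - \<kappa>) *\<^sub>R y + \<kappa> *\<^sub>R 0" by (auto simp: T_def)
      then show "x \<in> S" using b(2,8) True assms(2) unfolding convex_alt by (metis add.commute diff_add_cancel less_eq_real_def add_diff_cancel_left')
    qed
    have "?W \<subseteq> S - T"
    proof clarsimp
      fix x1 x2 v1 v2 assume v: "1 \<le> norm (v1, v2)" "supp S (v1, v2) - (v1 * x1 + v2 * x2) < \<kappa> * \<rho>" and "(x1, x2) \<in> T"
      then obtain y where y: "y \<in> S" "(x1, x2) = (1 - \<kappa>) *\<^sub>R y" by (auto simp: T_def)
      have "(v1, v2) \<bullet> (x1, x2) = (1 - \<kappa>) * ((v1, v2) \<bullet> y)" by (simp only: y(2) inner_scaleR_right)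
      also have "\<dots> \<le> (1 - \<kappa>) * supp S (v1, v2)" using True by (intro mult_left_mono inner_le_supp b y) auto
      finally have "\<kappa> * supp S (v1, v2) < \<kappa> * \<rho>" using v(2) by (simp add: algebra_simps)
      moreover have "\<rho> \<le> \<rho> * norm (v1, v2)" using v(1) b(3) by simp
      ultimately show False using norm_le_supp[OF assms(1), of "(v1,v2)"] assms(2) by simp
    qed
    then have "emeasure lborel ?W \<le> emeasure lborel (S - T)" using S T by (intro emeasure_mono) auto
    also have "\<dots> = emeasure lborel S - emeasure lborel T"
      using S T TS fin emeasure_mono[OF TS, of lborel] by (intro emeasure_Diff) (auto simp: top_unique)
    also have "\<dots> = (1 - ennreal ((1 - \<kappa>)\<^sup>2)) * emeasure lborel S"
      unfolding T_def using True S by (subst emeasure_scale) (auto simp: ennreal_right_diff_distrib mult.commute fin)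
    also have "1 - ennreal ((1 - \<kappa>)\<^sup>2) = ennreal (1 - (1 - \<kappa>)\<^sup>2)" by (simp add: ennreal_minus flip: ennreal_1)
    also have "1 - (1 - \<kappa>)\<^sup>2 \<le> 2 * \<kappa>" by (simp add: power2_eq_square algebra_simps)
    finally have "emeasure lborel ?W \<le> ennreal (2 * \<kappa>) * emeasure lborel S" by (simp add: ennreal_leI mult_right_mono)
    also have "\<dots> \<le> ennreal (2 * \<kappa>) * ennreal (4 * r\<^sup>2)" using area by (intro mult_left_mono) auto
    also have "\<dots> = ennreal (8 * \<kappa> * r\<^sup>2)" using assms(2) by (simp add: ennreal_mult[symmetric] mult_ac)
    finally show ?thesis .
  qed
qed

lemma supp_tilt_convex:
  assumes "bounded S" "S \<noteq> {}" "x < y" "y < z"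
  shows "supp S (1, - y) \<le> (z - y) / (z - x) * supp S (1, - x) + (y - x) / (z - x) * supp S (1, - z)"
proof -
  have "(1::real, - y) = ((z - y) / (z - x)) *\<^sub>R (1, - x) + ((y - x) / (z - x)) *\<^sub>R (1, - z)"
  proof -
    have "(z - y) / (z - x) + (y - x) / (z - x) = 1" "y = (z - y) / (z - x) * x + (y - x) / (z - x) * z"
      using assms(3,4) by (auto simp flip: add_divide_distrib) (simp add: field_simps)
    then show ?thesis by simp
  qed
  then have "supp S (1, - y) \<le> supp S (((z - y) / (z - x)) *\<^sub>R (1, - x)) + supp S (((y - x) / (z - x)) *\<^sub>R (1, - z))"
    by (simp only:) (rule supp_add_le[OF assms(1,2)])
  also have "supp S (((z - y) / (z - x)) *\<^sub>R (1, - x)) = (z - y) / (z - x) * supp S (1, - x)"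
    using assms by (intro supp_scale) auto
  also have "supp S (((y - x) / (z - x)) *\<^sub>R (1, - z)) = (y - x) / (z - x) * supp S (1, - z)"
    using assms by (intro supp_scale) auto
  finally show ?thesis .
qed

text \<open>The depth of a fixed point is even convex in the tilt, as the support function is.
  Quasiconvexity is the form recorded because it survives the truncation at \<open>2 * d\<close>,
  which convexity does not.\<close>

lemma depth_quasiconvex:
  fixes p :: "real \<times> real"
  assumes "bounded S" "S \<noteq> {}" "x < y" "y < z"
  shows "supp S (1, - y) - (1, - y) \<bullet> p \<le> max (supp S (1, - x) - (1, - x) \<bullet> p) (supp S (1, - z) - (1, - z) \<bullet> p)" (is "?q y \<le> max (?q x) (?q z)")
proof -
  define u v where "u = (z - y) / (z - x)" and "v = (y - x) / (z - x)"
  have uv: "0 \<le> u" "0 \<le> v" "u + v = 1" "y = u * x + v * z"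
    using assms(3,4) by (auto simp: u_def v_def divide_simps) (simp_all add: algebra_simps)
  have "(1, - y) \<bullet> p = u * ((1, - x) \<bullet> p) + v * ((1, - z) \<bullet> p)"
  proof -
    have "u * ((1, - x) \<bullet> p) + v * ((1, - z) \<bullet> p) = (u + v) * fst p - (u * x + v * z) * snd p"
      by (cases p) (simp add: algebra_simps)
    then show ?thesis unfolding uv(3) uv(4)[symmetric] by (cases p) simp
  qed
  then have "?q y \<le> u * ?q x + v * ?q z"
    using supp_tilt_convex[OF assms] unfolding u_def[symmetric] v_def[symmetric] by (simp add: algebra_simps)
  also have "\<dots> \<le> u * max (?q x) (?q z) + v * max (?q x) (?q z)"
    using uv by (intro add_mono mult_left_mono) auto
  also have "\<dots> = (u + v) * max (?q x) (?q z)" by (simp only: distrib_right)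
  finally show ?thesis using uv by simp
qed

text \<open>On a cap, the change of depth between the directions \<open>(1, -t)\<close> and \<open>(1, -(t + \<eta>))\<close> is an affine function
  of the second coordinate alone with slope \<open>\<eta>\<close>, and the part of the cap where such a function is small has small area.
  Truncating the depth at \<open>2 * d\<close> changes nothing on the cap and makes the points far from the boundary of \<open>S\<close> irrelevant.\<close>

lemma cap_spread:
  assumes "convex_body \<rho> r S" "0 < d"
  defines "\<eta> \<equiv> d / (2 * r)" and "q \<equiv> \<lambda>t (p::real\<times>real). min (supp S (1, - t) - (1, - t) \<bullet> p) (2 * d)"
  shows "ennreal (\<eta> * (vcap S (1, - t) d)\<^sup>2 / (8 * d)) \<le> (\<integral>\<^sup>+p. ennreal (indicator S p * \<bar>q (t + \<eta>) p - q t p\<bar>) \<partial>lborel)"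
proof -
  note b = convex_bodyD[OF assms(1)]
  have \<eta>: "0 < \<eta>" using assms(2) b(10) by (simp add: \<eta>_def)
  define A where "A = vcap S (1, - t) d"
  define X where "X = cap S (1, - t) d"
  \<comment> \<open>The tilt moves the support value by \<open>c * \<eta>\<close> and the inner
    product by \<open>- \<eta> * snd p\<close>, so the depth of \<open>p\<close> changes by
    \<open>\<eta> * (snd p + c)\<close>.\<close>
  define c where "c = (supp S (1, - (t + \<eta>)) - supp S (1, - t)) / \<eta>"
  have ceta: "c * \<eta> = supp S (1, - (t + \<eta>)) - supp S (1, - t)" using \<eta> by (simp add: c_def)
  \<comment> \<open>With this half-width the band \<open>B\<close> takes at most
    \<open>2 * \<mu> * d = A / 2\<close> of the cap. The other half of the cap sees a change of
    depth of at least \<open>\<eta> * \<mu>\<close>.\<close>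
  define \<mu> where "\<mu> = A / (4 * d)"
  have A0: "0 \<le> A" by (simp add: A_def)
  have \<mu>0: "0 \<le> \<mu>" using A0 assms(2) by (simp add: \<mu>_def)
  have X[measurable]: "X \<in> sets borel" unfolding X_def using b(1) by (rule sets_cap)
  define B where "B = {p \<in> X. \<bar>snd p + c\<bar> \<le> \<mu>}"
  have "closed {p :: real \<times> real. \<bar>snd p + c\<bar> \<le> \<mu>}" by (intro closed_Collect_le continuous_intros)
  then have B[measurable]: "B \<in> sets borel" using sets.Int[OF X, of "{p. \<bar>snd p + c\<bar> \<le> \<mu>}"] by (simp add: B_def Int_def)
  have EX: "emeasure lborel X = ennreal A" unfolding X_def A_def by (rule emeasure_cap[OF assms(1)])
  have EB: "emeasure lborel B \<le> ennreal (2 * \<mu> * d)"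
  proof (rule parallelogram_area[where s="supp S (1, - t)" and \<tau>=t and c="-c"])
    fix p assume "p \<in> B"
    then have p: "p \<in> S" "supp S (1, - t) - d \<le> (1, - t) \<bullet> p" "\<bar>snd p + c\<bar> \<le> \<mu>" by (auto simp: B_def X_def cap_def)
    show "supp S (1, - t) - d \<le> fst p - t * snd p \<and> fst p - t * snd p \<le> supp S (1, - t) \<and> \<bar>snd p - - c\<bar> \<le> \<mu>"
      using p inner_le_supp[OF b(6) p(1), of "(1, - t)"] by (cases p) auto
  qed (use assms(2) \<mu>0 in auto)
  have EXB: "ennreal (A / 2) \<le> emeasure lborel (X - B)"
  proof -
    have "B \<subseteq> X" by (auto simp: B_def)
    have "ennreal A - ennreal (A / 2) \<le> emeasure lborel X - emeasure lborel B"
      using EX EB assms(2) by (intro ennreal_minus_mono) (auto simp: \<mu>_def)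
    also have "\<dots> = emeasure lborel (X - B)"
      using \<open>B \<subseteq> X\<close> EB by (intro emeasure_Diff[symmetric]) (auto simp: top_unique)
    also have "ennreal A - ennreal (A / 2) = ennreal (A / 2)" using A0 by (simp add: ennreal_minus)
    finally show ?thesis .
  qed
  have pw: "\<eta> * \<mu> \<le> \<bar>q (t + \<eta>) p - q t p\<bar>" if "p \<in> X - B" for p
  proof -
    have p: "p \<in> S" "supp S (1, - t) - d \<le> (1, - t) \<bullet> p" "\<mu> < \<bar>snd p + c\<bar>" using that by (auto simp: B_def X_def cap_def)
    define Q0 Q1 where "Q0 = supp S (1, - t) - (1, - t) \<bullet> p" and "Q1 = supp S (1, - (t + \<eta>)) - (1, - (t + \<eta>)) \<bullet> p"
    have diff: "Q1 - Q0 = \<eta> * (snd p + c)"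
      unfolding Q0_def Q1_def using ceta by (cases p) (simp add: algebra_simps)
    have "\<bar>supp S (1, - (t + \<eta>)) - supp S (1, - t)\<bar> \<le> r * \<eta>"
      using supp_diff_le[OF assms(1), of "(1, - (t + \<eta>))" "(1, - t)"] \<eta> by (simp add: norm_Pair)
    moreover have "norm p \<le> r" using b(5) p(1) by auto
    then have "\<bar>snd p\<bar> \<le> r" using norm_snd_le[of "snd p" "fst p"] by simp
    then have "\<bar>\<eta> * snd p\<bar> \<le> r * \<eta>" using \<eta> by (simp add: abs_mult)
    ultimately have "\<bar>Q1 - Q0\<bar> \<le> 2 * r * \<eta>" unfolding diff using ceta by (simp add: algebra_simps)
    \<comment> \<open>This is what fixes the tilt step: points of the cap have depth at most
      \<open>d\<close> before and at most \<open>2 * d\<close> after the tilt, so the truncation is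
      inactive on them.\<close>
    also have "2 * r * \<eta> = d" using b(10) by (simp add: \<eta>_def)
    finally have "\<bar>Q1 - Q0\<bar> \<le> d" .
    moreover have "Q0 \<le> d" using p(2) by (simp add: Q0_def)
    ultimately have "q (t + \<eta>) p - q t p = Q1 - Q0" unfolding q_def Q0_def[symmetric] Q1_def[symmetric] using assms(2) by (simp add: min_def)
    then show ?thesis unfolding diff using p(3) \<eta> by (simp add: abs_mult)
  qed
  have "ennreal (\<eta> * A\<^sup>2 / (8 * d)) = ennreal (\<eta> * \<mu>) * ennreal (A / 2)"
    using \<eta> \<mu>0 A0 assms(2) by (simp add: ennreal_mult[symmetric] \<mu>_def power2_eq_square)
  also have "\<dots> \<le> ennreal (\<eta> * \<mu>) * emeasure lborel (X - B)" by (intro mult_left_mono EXB) auto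
  also have "\<dots> = (\<integral>\<^sup>+p. ennreal (\<eta> * \<mu>) * indicator (X - B) p \<partial>lborel)"
    by (rule nn_integral_cmult_indicator[symmetric]) auto
  also have "\<dots> \<le> (\<integral>\<^sup>+p. ennreal (indicator S p * \<bar>q (t + \<eta>) p - q t p\<bar>) \<partial>lborel)"
  proof (rule nn_integral_mono)
    fix p
    show "ennreal (\<eta> * \<mu>) * indicator (X - B) p \<le> ennreal (indicator S p * \<bar>q (t + \<eta>) p - q t p\<bar>)"
    proof (cases "p \<in> X - B")
      case True
      then have "p \<in> S" by (auto simp: X_def cap_def)
      then show ?thesis using pw[OF True] True by (simp add: ennreal_leI)
    qed auto
  qed
  finally show ?thesis by (simp add: A_def)
qed

text \<open>Integrating \<open>cap_spread\<close> over the tilt and exchanging the integrals leaves,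
  for each point, the shift differences of its truncated depth, whose integral is at most
  \<open>4 * \<eta> * d\<close> by quasiconvexity. Only points of depth below \<open>2 * d\<close>
  in some direction contribute, and they fill an area of order \<open>d\<close>. Division by the
  factor \<open>\<eta> / (8 * d)\<close> from \<open>cap_spread\<close> produces
  \<open>d ^ 3\<close>.\<close>

lemma nn_integral_vcap_tilt:
  assumes "convex_body \<rho> r S" "0 < d"
  shows "(\<integral>\<^sup>+t. ennreal ((vcap S (1, - t) d)\<^sup>2) * indicator {-1..1} t \<partial>lborel) \<le> ennreal (512 * r\<^sup>2 / \<rho> * d ^ 3)"
proof -
  note b = convex_bodyD[OF assms(1)]
  define \<eta> where "\<eta> = d / (2 * r)"
  have \<eta>: "0 < \<eta>" using assms(2) b(10) by (simp add: \<eta>_def)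
  define q where "q = (\<lambda>t (p::real\<times>real). min (supp S (1, - t) - (1, - t) \<bullet> p) (2 * d))"
  note [measurable] = borel_measurable_supp[OF assms(1)]
  have [measurable]: "S \<in> sets borel" using b(1) by simp
  have tm: "(\<lambda>t::real. (1::real, - t)) \<in> borel \<rightarrow>\<^sub>M borel"
    by (intro borel_measurable_continuous_onI continuous_intros)
  have st[measurable]: "(\<lambda>t. supp S (1, - t)) \<in> borel_measurable borel"
    using measurable_compose[OF tm borel_measurable_supp[OF assms(1)]] .
  have q_alt: "q t p = min (supp S (1, - t) - (fst p - t * snd p)) (2 * d)" for t p
    by (cases p) (simp add: q_def)
  have vm[measurable]: "(\<lambda>t. vcap S (1, - t) d) \<in> borel_measurable borel"
    using measurable_compose[OF tm vcap_measurable[OF assms(1)]] .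
  define K where "K = \<eta> / (8 * d)"
  have K: "0 < K" using \<eta> assms(2) by (simp add: K_def)
  define W where "W = {x \<in> S. \<exists>v. norm v \<ge> 1 \<and> supp S v - v \<bullet> x < (2 * d / \<rho>) * \<rho>}"
  have EW: "emeasure lborel W \<le> ennreal (8 * (2 * d / \<rho>) * r\<^sup>2)"
    unfolding W_def using assms(2) b(3) by (intro annulus_area[OF assms(1)]) auto
  have Wm: "W \<in> sets borel"
  proof -
    have "open W"
    proof -
      have "W = (\<Union>v\<in>{v. norm v \<ge> 1}. S \<inter> {x. supp S v - v \<bullet> x < (2 * d / \<rho>) * \<rho>})" by (auto simp: W_def)
      also have "open \<dots>" using b(1) by (intro open_UN ballI open_Int open_Collect_less continuous_intros) auto
      finally show ?thesis .
    qed
    then show ?thesis by simp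
  qed
  have "ennreal K * (\<integral>\<^sup>+t. ennreal ((vcap S (1, - t) d)\<^sup>2) * indicator {-1..1} t \<partial>lborel)
     = (\<integral>\<^sup>+t. ennreal (\<eta> * (vcap S (1, - t) d)\<^sup>2 / (8 * d)) * indicator {-1..1} t \<partial>lborel)"
    using \<eta> assms(2) by (subst nn_integral_cmult[symmetric])
      (auto intro!: nn_integral_cong simp: K_def ennreal_mult[symmetric] indicator_def)
  also have "\<dots> \<le> (\<integral>\<^sup>+t. (\<integral>\<^sup>+p. ennreal (indicator S p * \<bar>q (t + \<eta>) p - q t p\<bar>) * indicator {-1..1} t \<partial>lborel) \<partial>lborel)"
  proof (rule nn_integral_mono)
    fix t :: real
    show "ennreal (\<eta> * (vcap S (1, - t) d)\<^sup>2 / (8 * d)) * indicator {-1..1} t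
       \<le> (\<integral>\<^sup>+p. ennreal (indicator S p * \<bar>q (t + \<eta>) p - q t p\<bar>) * indicator {-1..1} t \<partial>lborel)"
      using cap_spread[OF assms, of t] by (auto simp: indicator_def q_def \<eta>_def)
  qed
  also have "\<dots> = (\<integral>\<^sup>+p. (\<integral>\<^sup>+t. ennreal (indicator S p * \<bar>q (t + \<eta>) p - q t p\<bar>) * indicator {-1..1} t \<partial>lborel) \<partial>lborel)"
  proof (rule pair_sigma_finite.Fubini')
    have [measurable]: "(\<lambda>z. q (snd z + a) (fst z)) \<in> borel_measurable (borel \<Otimes>\<^sub>M borel)" for a
    proof -
      have [measurable]: "fst \<in> (borel :: (real \<times> real) measure) \<rightarrow>\<^sub>M borel" "snd \<in> (borel :: (real \<times> real) measure) \<rightarrow>\<^sub>M borel"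
        by (auto intro!: borel_measurable_continuous_onI continuous_intros)
      show ?thesis unfolding q_alt by measurable
    qed
    have im: "(\<lambda>z. indicator {-1..1::real} (snd z) :: ennreal) \<in> borel_measurable ((lborel :: (real \<times> real) measure) \<Otimes>\<^sub>M lborel)"
      by (rule measurable_compose[OF measurable_snd]) measurable
    from \<open>\<And>a. (\<lambda>z. q (snd z + a) (fst z)) \<in> _\<close>[of 0] \<open>\<And>a. (\<lambda>z. q (snd z + a) (fst z)) \<in> _\<close>[of \<eta>] show "(\<lambda>(p, t). ennreal (indicator S p * \<bar>q (t + \<eta>) p - q t p\<bar>) * indicator {-1..1} t) \<in> borel_measurable (lborel \<Otimes>\<^sub>M lborel)"
      unfolding split_beta by (simp only: add_0_right) (intro borel_measurable_times_ennreal im, measurable)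
  qed (auto intro!: pair_sigma_finite.intro lborel.sigma_finite_measure_axioms)
  also have "\<dots> \<le> (\<integral>\<^sup>+p. ennreal (2 * \<eta> * (2 * d)) * indicator W p \<partial>lborel)"
  proof (rule nn_integral_mono)
    fix p :: "real \<times> real"
    show "(\<integral>\<^sup>+t. ennreal (indicator S p * \<bar>q (t + \<eta>) p - q t p\<bar>) * indicator {-1..1} t \<partial>lborel)
       \<le> ennreal (2 * \<eta> * (2 * d)) * indicator W p"
    proof (cases "p \<in> W")
      case True
      then have "p \<in> S" by (simp add: W_def)
      have "(\<integral>\<^sup>+t. ennreal (indicator {-1..1} t * \<bar>q (t + \<eta>) p - q t p\<bar>) \<partial>lborel) \<le> ennreal (2 * \<eta> * (2 * d))"
      proof (rule quasiconvex_shift)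
        show "(\<lambda>t. q t p) \<in> borel_measurable borel" unfolding q_alt by measurable
        show "0 \<le> q t p" for t using inner_le_supp[OF b(6) \<open>p \<in> S\<close>, of "(1, - t)"] assms(2) by (simp add: q_def)
        show "q t p \<le> 2 * d" for t by (simp add: q_def)
        show "q y p \<le> max (q x p) (q z p)" if "x < y" "y < z" for x y z
          using depth_quasiconvex[OF b(6,7) that, of p] by (auto simp: q_def)
      qed (use \<eta> in auto)
      also have "(\<integral>\<^sup>+t. ennreal (indicator {-1..1} t * \<bar>q (t + \<eta>) p - q t p\<bar>) \<partial>lborel)
        = (\<integral>\<^sup>+t. ennreal (indicator S p * \<bar>q (t + \<eta>) p - q t p\<bar>) * indicator {-1..1} t \<partial>lborel)"
        using \<open>p \<in> S\<close> by (intro nn_integral_cong) (auto simp: indicator_def)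
      finally show ?thesis using True by simp
    next
      case False
      \<comment> \<open>Off \<open>W\<close> the depth is at least \<open>2 * d\<close> for every
        tilt, so the truncated depth is constant.\<close>
      have z: "indicator S p * \<bar>q (t + \<eta>) p - q t p\<bar> = 0" for t
      proof (cases "p \<in> S")
        case True
        have n1: "norm (1::real, - t) \<ge> 1" for t :: real using norm_fst_le[of "1::real" "-t"] by simp
        have "2 * d \<le> supp S (1, - t) - (1, - t) \<bullet> p" for t
          using True False b(3) n1[of t] by (auto simp: W_def not_less)
        then have "q t p = 2 * d" for t by (simp add: q_def)
        then show ?thesis by simp
      qed simp
      show ?thesis unfolding z by simp
    qed
  qed
  also have "\<dots> = ennreal (2 * \<eta> * (2 * d)) * emeasure lborel W"
    using Wm by (intro nn_integral_cmult_indicator) simp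
  also have "\<dots> \<le> ennreal (2 * \<eta> * (2 * d)) * ennreal (8 * (2 * d / \<rho>) * r\<^sup>2)"
    by (intro mult_left_mono EW) auto
  also have "\<dots> = ennreal (K * (512 * r\<^sup>2 / \<rho> * d ^ 3))"
    using \<eta> assms(2) b(3,10) by (subst ennreal_mult[symmetric]) (auto simp: K_def field_simps power2_eq_square power3_eq_cube)
  also have "\<dots> = ennreal K * ennreal (512 * r\<^sup>2 / \<rho> * d ^ 3)"
    using K assms(2) b(3) by (intro ennreal_mult) auto
  finally show ?thesis using K by (simp add: ennreal_mult_le_mult_iff)
qed

lemma vcap_rot_measurable:
  assumes "convex_body \<rho> r S"
  shows "(\<lambda>\<theta>. vcap (rot \<theta> ` S) v e) \<in> borel_measurable borel"
proof -
  have "(\<lambda>\<theta>. rot (- \<theta>) v) \<in> borel \<rightarrow>\<^sub>M borel"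
    unfolding rot_def by (intro borel_measurable_continuous_onI continuous_intros)
  from measurable_compose[OF this vcap_measurable[OF assms]]
  show ?thesis by (simp add: vcap_rot[OF convex_bodyD(1)[OF assms]])
qed

text \<open>On this quarter circle the turned direction is \<open>cos \<phi>\<close> times the tilt
  vector with \<open>t = tan \<phi>\<close>, and rescaling to the tilt vector at most doubles the
  depth, which accounts for a factor 8. The Jacobian \<open>1 + (tan \<phi>)^2\<close> is at least 1
  and may simply be inserted.\<close>

lemma nn_integral_vcap_arc:
  assumes "convex_body \<rho> r S" "0 < e"
  shows "(\<integral>\<^sup>+\<phi>. ennreal ((vcap (rot \<phi> ` S) (1, 0) e)\<^sup>2) * indicator {-(pi/4)..pi/4} \<phi> \<partial>lborel) \<le> ennreal (4096 * r\<^sup>2 / \<rho> * e ^ 3)"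
proof -
  note b = convex_bodyD[OF assms(1)]
  have tm: "(\<lambda>t::real. (1::real, - t)) \<in> borel \<rightarrow>\<^sub>M borel"
    by (intro borel_measurable_continuous_onI continuous_intros)
  define f where "f = (\<lambda>t. ennreal ((vcap S (1, - t) (2 * e))\<^sup>2))"
  have fm: "f \<in> borel_measurable borel" unfolding f_def
    using measurable_compose[OF tm vcap_measurable[OF assms(1)]] by measurable
  have cos: "1 / 2 \<le> cos \<phi>" if "\<phi> \<in> {-(pi/4)..pi/4}" for \<phi>
  proof -
    have "cos (pi / 3) \<le> cos \<bar>\<phi>\<bar>" using that pi_gt_zero by (intro cos_monotone_0_pi_le) auto
    then show ?thesis by (simp add: cos_60)
  qed
  have "(\<integral>\<^sup>+\<phi>. ennreal ((vcap (rot \<phi> ` S) (1, 0) e)\<^sup>2) * indicator {-(pi/4)..pi/4} \<phi> \<partial>lborel)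
     \<le> (\<integral>\<^sup>+\<phi>. f (tan \<phi>) * ennreal (1 + (tan \<phi>)\<^sup>2) * indicator {-(pi/4)..pi/4} \<phi> \<partial>lborel)"
  proof (rule nn_integral_mono)
    fix \<phi> :: real
    show "ennreal ((vcap (rot \<phi> ` S) (1, 0) e)\<^sup>2) * indicator {-(pi/4)..pi/4} \<phi>
      \<le> f (tan \<phi>) * ennreal (1 + (tan \<phi>)\<^sup>2) * indicator {-(pi/4)..pi/4} \<phi>"
    proof (cases "\<phi> \<in> {-(pi/4)..pi/4}")
      case True
      note c = cos[OF True]
      have "rot (- \<phi>) (1, 0) = cos \<phi> *\<^sub>R (1, - tan \<phi>)" using c by (simp add: rot_def tan_def)
      then have "vcap (rot \<phi> ` S) (1, 0) e = vcap S (cos \<phi> *\<^sub>R (1, - tan \<phi>)) (cos \<phi> * (e / cos \<phi>))"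
        using c by (simp add: vcap_rot[OF b(1)])
      also have "\<dots> = vcap S (1, - tan \<phi>) (e / cos \<phi>)" using c by (intro vcap_scale b) auto
      also have "\<dots> \<le> vcap S (1, - tan \<phi>) (2 * e)"
      proof (rule vcap_mono[OF assms(1)])
        have "e * 1 \<le> e * (2 * cos \<phi>)" using c assms(2) by (intro mult_left_mono) auto
        then show "e / cos \<phi> \<le> 2 * e" using c by (simp add: divide_le_eq)
      qed
      finally have "(vcap (rot \<phi> ` S) (1, 0) e)\<^sup>2 \<le> (vcap S (1, - tan \<phi>) (2 * e))\<^sup>2" by (intro power_mono) auto
      then have "ennreal ((vcap (rot \<phi> ` S) (1, 0) e)\<^sup>2) \<le> f (tan \<phi>) * 1" unfolding f_def by (simp add: ennreal_leI)
      also have "\<dots> \<le> f (tan \<phi>) * ennreal (1 + (tan \<phi>)\<^sup>2)" by (intro mult_left_mono) auto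
      finally show ?thesis using True by simp
    qed simp
  qed
  also have "\<dots> = (\<integral>\<^sup>+t. f t * indicator {tan (-(pi/4))..tan (pi/4)} t \<partial>lborel)"
  proof (rule nn_integral_substitution_aux[symmetric])
    show "f \<in> borel_measurable borel" by (rule fm)
    show "(tan has_real_derivative 1 + (tan x)\<^sup>2) (at x)" if "x \<in> {-(pi/4)..pi/4}" for x
    proof -
      have "cos x \<noteq> 0" using cos[OF that] by auto
      from DERIV_tan[OF this] show ?thesis using \<open>cos x \<noteq> 0\<close> by (simp add: tan_sec inverse_eq_divide power_divide)
    qed
    show "continuous_on {-(pi/4)..pi/4} (\<lambda>x. 1 + (tan x)\<^sup>2)"
      using cos by (intro continuous_intros) force
  qed auto
  also have "\<dots> \<le> ennreal (512 * r\<^sup>2 / \<rho> * (2 * e) ^ 3)"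
    using nn_integral_vcap_tilt[OF assms(1), of "2 * e"] assms(2) by (simp add: f_def tan_45)
  also have "512 * r\<^sup>2 / \<rho> * (2 * e) ^ 3 = 4096 * r\<^sup>2 / \<rho> * e ^ 3" by (simp add: power_mult_distrib)
  finally show ?thesis .
qed

text \<open>Four quarter circles, each turned back to the central one by rotating the body, cover
  all directions. The cubic order is attained at both extremes: with \<open>e = d / norm v\<close>,
  a disc has caps of area about \<open>e powr (3/2)\<close> in all directions, while a polygon has
  caps of area about \<open>e\<close> for a set of directions of measure about
  \<open>e\<close>.\<close>

lemma nn_integral_vcap_rot:
  assumes "convex_body \<rho> r S" "0 < d" "v \<noteq> 0"
  shows "(\<integral>\<^sup>+\<theta>. ennreal ((vcap (rot \<theta> ` S) v d)\<^sup>2) * indicator {-pi..pi} \<theta> \<partial>lborel) \<le> ennreal (16384 * r\<^sup>2 / \<rho> * (d / norm v) ^ 3)"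
proof -
  note b = convex_bodyD[OF assms(1)]
  obtain \<beta> where v: "v = norm v *\<^sub>R rot \<beta> (1, 0)" by (rule polar_exists)
  define e where "e = d / norm v"
  have e: "0 < e" "d = norm v * e" using assms by (auto simp: e_def)
  have rr: "rot a ` rot c ` S = rot (a + c) ` S" for a c by (simp add: image_comp o_def rot_rot)
  define F where "F = (\<lambda>\<gamma>. ennreal ((vcap (rot \<gamma> ` S) (1, 0) e)\<^sup>2))"
  have Fm[measurable]: "F \<in> borel_measurable borel" unfolding F_def using vcap_rot_measurable[OF assms(1)] by measurable
  have eq: "vcap (rot \<theta> ` S) v d = vcap (rot (\<theta> - \<beta>) ` S) (1, 0) e" for \<theta>
  proof -
    have "vcap (rot \<theta> ` S) v d = vcap (rot \<theta> ` S) (norm v *\<^sub>R rot \<beta> (1, 0)) (norm v * e)" using v e by simp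
    also have "\<dots> = vcap (rot \<theta> ` S) (rot \<beta> (1, 0)) e"
      using convex_bodyD[OF convex_body_rot[OF assms(1)]] assms(3) by (intro vcap_scale) auto
    also have "\<dots> = vcap (rot (- \<beta>) ` rot \<theta> ` S) (1, 0) e"
      using convex_bodyD[OF convex_body_rot[OF assms(1)]] by (subst vcap_rot) auto
    finally show ?thesis by (simp add: rr)
  qed
  \<comment> \<open>The centres of four arcs of length \<open>pi / 2\<close> that tile
    \<open>{-pi..pi}\<close>.\<close>
  define c where "c = (\<lambda>j::nat. - pi + pi / 4 + j * (pi / 2))"
  have arc: "(\<integral>\<^sup>+\<theta>. F (\<theta> - \<beta>) * indicator {c j - pi/4..c j + pi/4} \<theta> \<partial>lborel) \<le> ennreal (4096 * r\<^sup>2 / \<rho> * e ^ 3)" for j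
  proof -
    have "(\<integral>\<^sup>+\<theta>. F (\<theta> - \<beta>) * indicator {c j - pi/4..c j + pi/4} \<theta> \<partial>lborel)
       = (\<integral>\<^sup>+\<phi>. F (c j + 1 * \<phi> - \<beta>) * indicator {c j - pi/4..c j + pi/4} (c j + 1 * \<phi>) \<partial>lborel)"
      by (subst nn_integral_real_affine[where c=1 and t="c j"]) auto
    also have "\<dots> = (\<integral>\<^sup>+\<phi>. ennreal ((vcap (rot \<phi> ` rot (c j - \<beta>) ` S) (1, 0) e)\<^sup>2) * indicator {-(pi/4)..pi/4} \<phi> \<partial>lborel)"
      by (intro nn_integral_cong) (auto simp: F_def rr indicator_def algebra_simps)
    also have "\<dots> \<le> ennreal (4096 * r\<^sup>2 / \<rho> * e ^ 3)"
      by (intro nn_integral_vcap_arc convex_body_rot assms e)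
    finally show ?thesis .
  qed
  have "(\<integral>\<^sup>+\<theta>. ennreal ((vcap (rot \<theta> ` S) v d)\<^sup>2) * indicator {-pi..pi} \<theta> \<partial>lborel)
     = (\<integral>\<^sup>+\<theta>. F (\<theta> - \<beta>) * indicator {-pi..pi} \<theta> \<partial>lborel)" by (simp add: eq F_def)
  also have "\<dots> \<le> (\<integral>\<^sup>+\<theta>. (\<Sum>j<4. F (\<theta> - \<beta>) * indicator {c j - pi/4..c j + pi/4} \<theta>) \<partial>lborel)"
  proof (rule nn_integral_mono)
    fix \<theta> :: real
    have "indicator {-pi..pi} \<theta> \<le> (\<Sum>j<4::nat. indicator {c j - pi/4..c j + pi/4} \<theta> :: ennreal)"
    proof (cases "\<theta> \<in> {-pi..pi}")
      case True
      then have "\<theta> \<in> {c 0 - pi/4..c 0 + pi/4} \<or> \<theta> \<in> {c 1 - pi/4..c 1 + pi/4} \<or> \<theta> \<in> {c 2 - pi/4..c 2 + pi/4} \<or> \<theta> \<in> {c 3 - pi/4..c 3 + pi/4}"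
        by (auto simp: c_def)
      then obtain j where j: "j < 4" "\<theta> \<in> {c j - pi/4..c j + pi/4}" by (metis numeral_less_iff one_less_numeral_iff semiring_norm(76,77,78,79,81) zero_less_numeral)
      have "(1::ennreal) = indicator {c j - pi/4..c j + pi/4} \<theta>" using j by simp
      also have "\<dots> \<le> (\<Sum>j<4::nat. indicator {c j - pi/4..c j + pi/4} \<theta>)" using j by (intro member_le_sum) auto
      finally show ?thesis using True by simp
    qed simp
    then have "F (\<theta> - \<beta>) * indicator {-pi..pi} \<theta> \<le> F (\<theta> - \<beta>) * (\<Sum>j<4::nat. indicator {c j - pi/4..c j + pi/4} \<theta>)" by (intro mult_left_mono) auto
    then show "F (\<theta> - \<beta>) * indicator {-pi..pi} \<theta> \<le> (\<Sum>j<4::nat. F (\<theta> - \<beta>) * indicator {c j - pi/4..c j + pi/4} \<theta>)"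
      by (simp add: sum_distrib_left)
  qed
  also have "\<dots> = (\<Sum>j<4::nat. \<integral>\<^sup>+\<theta>. F (\<theta> - \<beta>) * indicator {c j - pi/4..c j + pi/4} \<theta> \<partial>lborel)"
    by (intro nn_integral_sum) measurable
  also have "\<dots> \<le> (\<Sum>j<4::nat. ennreal (4096 * r\<^sup>2 / \<rho> * e ^ 3))" by (intro sum_mono arc)
  also have "\<dots> = ennreal (4 * (4096 * r\<^sup>2 / \<rho> * e ^ 3))"
    using e b(3) by (subst ennreal_mult') (auto simp: ennreal_numeral[symmetric] simp del: ennreal_numeral)
  finally show ?thesis by (simp add: e_def mult_ac)
qed

subsection \<open>Concave densities and their second differences\<close>

text \<open>The model is the density of \<open>k \<bullet> x\<close> on the body. Concavity is
  demanded only inside the open support interval, because the density may jump at its ends, for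
  instance when the body has an edge orthogonal to \<open>k\<close>.\<close>

definition concave_bump :: "real \<Rightarrow> real \<Rightarrow> (real \<Rightarrow> real) \<Rightarrow> bool" where
  "concave_bump \<alpha> \<beta> G \<longleftrightarrow> (\<forall>x. 0 \<le> G x) \<and> integrable lborel G \<and> (\<forall>x. x \<notin> {\<alpha><..<\<beta>} \<longrightarrow> G x = 0) \<and>
    (\<forall>x\<in>{\<alpha><..<\<beta>}. \<forall>y\<in>{\<alpha><..<\<beta>}. \<forall>u\<in>{0..1}. (1 - u) * G x + u * G y \<le> G ((1 - u) * x + u * y))"

text \<open>For the density of a body, the tails on the two sides are the areas of opposite caps;
  see \<open>body_density\<close>.\<close>

definition right_mass :: "(real \<Rightarrow> real) \<Rightarrow> real \<Rightarrow> real" where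
  "right_mass G a = (\<integral>x. indicator {a..} x * G x \<partial>lborel)"

definition left_mass :: "(real \<Rightarrow> real) \<Rightarrow> real \<Rightarrow> real" where
  "left_mass G a = (\<integral>x. indicator {..a} x * G x \<partial>lborel)"

definition diff2 :: "real \<Rightarrow> (real \<Rightarrow> real) \<Rightarrow> real \<Rightarrow> real" where
  "diff2 \<sigma> G x = G (x + \<sigma>) - 2 * G x + G (x - \<sigma>)"

lemma concave_bumpD:
  assumes "concave_bump \<alpha> \<beta> G"
  shows "0 \<le> G x" "integrable lborel G" "x \<notin> {\<alpha><..<\<beta>} \<Longrightarrow> G x = 0" "G \<in> borel_measurable borel"
    "x \<in> {\<alpha><..<\<beta>} \<Longrightarrow> y \<in> {\<alpha><..<\<beta>} \<Longrightarrow> u \<in> {0..1} \<Longrightarrow> (1 - u) * G x + u * G y \<le> G ((1 - u) * x + u * y)"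
  using assms borel_measurable_integrable[of lborel G] unfolding concave_bump_def by auto

lemma integrable_indicator_mult:
  fixes G :: "real \<Rightarrow> real"
  assumes "integrable lborel G" "A \<in> sets borel"
  shows "integrable lborel (\<lambda>x. indicator A x * G x)"
  using integrable_mult_indicator[of A lborel G] assms by simp

lemma integrable_shift:
  fixes G :: "real \<Rightarrow> real"
  assumes "integrable lborel G"
  shows "integrable lborel (\<lambda>x. G (x + c))" "integrable lborel (\<lambda>x. G (x - c))"
  using lborel_integrable_real_affine[OF assms, of 1 c] lborel_integrable_real_affine[OF assms, of 1 "-c"]
  by (auto simp: add.commute)

lemma concave_bump_reflect:
  assumes "concave_bump \<alpha> \<beta> G"
  shows "concave_bump (-\<beta>) (-\<alpha>) (\<lambda>x. G (- x))"
  unfolding concave_bump_def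
proof (intro conjI allI impI ballI)
  show "integrable lborel (\<lambda>x. G (- x))"
    using lborel_integrable_real_affine[OF concave_bumpD(2)[OF assms], of "-1" 0] by simp
  fix x y u :: real
  assume "x \<in> {-\<beta><..<-\<alpha>}" "y \<in> {-\<beta><..<-\<alpha>}" "u \<in> {0..1}"
  then show "(1 - u) * G (- x) + u * G (- y) \<le> G (- ((1 - u) * x + u * y))"
    using concave_bumpD(5)[OF assms, of "-x" "-y" u] by (simp add: algebra_simps)
qed (auto simp: concave_bumpD(1)[OF assms] intro!: concave_bumpD(3)[OF assms])

lemma right_mass_reflect: "right_mass (\<lambda>x. G (- x)) a = left_mass G (- a)"
  unfolding right_mass_def left_mass_def
  by (subst lborel_integral_real_affine[where c="-1" and t=0]) (auto intro!: Bochner_Integration.integral_cong simp: indicator_def)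

text \<open>Slopes of a concave function decrease. The comparison is kept free of division so that
  it can be chained by plain multiplication.\<close>

lemma concave_bump_slope:
  assumes "concave_bump \<alpha> \<beta> G" "\<alpha> < x" "x < y" "y < z" "z < \<beta>"
  shows "(G z - G y) * (y - x) \<le> (G y - G x) * (z - y)"
proof -
  define u where "u = (y - x) / (z - x)"
  have u3: "u * (z - x) = y - x" using assms by (simp add: u_def)
  have "(1 - u) * x + u * z = x + u * (z - x)" "(1 - u) * (z - x) = (z - x) - u * (z - x)"
    by (simp_all add: algebra_simps)
  then have u: "(1 - u) * x + u * z = y" "u * (z - x) = y - x" "(1 - u) * (z - x) = z - y"
    unfolding u3 by simp_all
  have u01: "u \<in> {0..1}" using assms by (auto simp: u_def)
  have "(1 - u) * G x + u * G z \<le> G y"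
  proof -
    have "x \<in> {\<alpha><..<\<beta>}" "z \<in> {\<alpha><..<\<beta>}" using assms by auto
    from concave_bumpD(5)[OF assms(1) this u01] show ?thesis unfolding u(1) .
  qed
  then have "((1 - u) * G x + u * G z) * (z - x) \<le> G y * (z - x)"
    using assms by (intro mult_right_mono) auto
  also have "((1 - u) * G x + u * G z) * (z - x) = ((1 - u) * (z - x)) * G x + (u * (z - x)) * G z"
    by (simp add: algebra_simps)
  finally show ?thesis unfolding u(2,3) by (simp add: algebra_simps)
qed

lemma right_mass_mono:
  assumes "concave_bump \<alpha> \<beta> G" "a \<le> b"
  shows "right_mass G b \<le> right_mass G a"
  unfolding right_mass_def
  using assms concave_bumpD(1,2)[OF assms(1)]
  by (intro integral_mono integrable_indicator_mult) (auto simp: indicator_def)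

lemma right_mass_nonneg: "concave_bump \<alpha> \<beta> G \<Longrightarrow> 0 \<le> right_mass G a"
  unfolding right_mass_def using concave_bumpD(1) by (intro integral_nonneg_AE) auto

lemma left_mass_mono:
  assumes "concave_bump \<alpha> \<beta> G" "a \<le> b"
  shows "left_mass G a \<le> left_mass G b"
  unfolding left_mass_def
  using assms concave_bumpD(1,2)[OF assms(1)]
  by (intro integral_mono integrable_indicator_mult) (auto simp: indicator_def)

lemma left_mass_nonneg: "concave_bump \<alpha> \<beta> G \<Longrightarrow> 0 \<le> left_mass G a"
  unfolding left_mass_def using concave_bumpD(1) by (intro integral_nonneg_AE) auto

text \<open>A drop of \<open>G\<close> over a step \<open>\<sigma>\<close> persists as a linear slope up to the end of the support, so it forces mass there.\<close>

lemma drop_le_right_mass: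
  assumes G: "concave_bump \<alpha> \<beta> G" and "\<alpha> < y" "0 < \<sigma>" "y + \<sigma> < \<beta>"
  shows "G y - G (y + \<sigma>) \<le> 2 * \<sigma> / (\<beta> - (y + \<sigma>))\<^sup>2 * right_mass G (y + \<sigma>)"
proof (cases "G y - G (y + \<sigma>) \<le> 0")
  case True
  have "0 \<le> 2 * \<sigma> / (\<beta> - (y + \<sigma>))\<^sup>2 * right_mass G (y + \<sigma>)"
    using assms right_mass_nonneg[OF G] by simp
  with True show ?thesis by linarith
next
  case False
  define w where "w = y + \<sigma>"
  define E where "E = G y - G w"
  have E: "0 < E" using False by (simp add: E_def w_def)
  have low: "E * (\<beta> - z) / \<sigma> \<le> G z" if z: "w < z" "z < \<beta>" for z
  proof -
    \<comment> \<open>The comparison uses a point \<open>z'\<close> short of \<beta> and then lets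
      it approach \<beta>, since \<open>G\<close> may jump at \<beta>.\<close>
    have "z' \<le> G z * \<sigma> / E + z" if z': "z < z'" "z' < \<beta>" for z'
    proof -
      have a: "(G z - G w) * \<sigma> \<le> - E * (z - w)"
        using concave_bump_slope[OF G, of y w z] assms z by (simp add: w_def E_def algebra_simps)
      have b: "(G z' - G z) * (z - w) \<le> (G z - G w) * (z' - z)"
        using concave_bump_slope[OF G, of w z z'] assms z z' by (simp add: w_def)
      have "(G z' - G z) * (z - w) * \<sigma> \<le> (G z - G w) * (z' - z) * \<sigma>"
        using b assms(3) by (intro mult_right_mono) auto
      also have "\<dots> = (G z - G w) * \<sigma> * (z' - z)" by (simp add: mult_ac)
      also have "\<dots> \<le> - E * (z - w) * (z' - z)" using a z' by (intro mult_right_mono) auto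
      finally have "(z - w) * ((G z' - G z) * \<sigma>) \<le> (z - w) * (- E * (z' - z))" by (simp add: mult_ac)
      then have "(G z' - G z) * \<sigma> \<le> - E * (z' - z)" using z by (simp only: mult_le_cancel_left_pos diff_gt_0_iff_gt)
      moreover have "0 \<le> G z' * \<sigma>" using concave_bumpD(1)[OF G] assms(3) by simp
      ultimately have "E * (z' - z) \<le> G z * \<sigma>" by (simp add: algebra_simps)
      then show ?thesis using E by (simp add: field_simps)
    qed
    then have "\<beta> \<le> G z * \<sigma> / E + z" using z by (intro dense_le_bounded[of z \<beta>]) auto
    then show ?thesis using E assms(3) by (simp add: field_simps)
  qed
  have wb: "w \<le> \<beta>" using assms by (simp add: w_def)
  have hi: "((\<lambda>z. E * (\<beta> - z) / \<sigma>) has_integral (- E * (\<beta> - \<beta>)\<^sup>2 / (2 * \<sigma>) - (- E * (\<beta> - w)\<^sup>2 / (2 * \<sigma>)))) {w..\<beta>}"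
    using wb assms(3) by (intro fundamental_theorem_of_calculus)
      (auto intro!: derivative_eq_intros simp: has_real_derivative_iff_has_vector_derivative[symmetric] field_simps)
  have si: "set_integrable lborel {w..\<beta>} (\<lambda>z. E * (\<beta> - z) / \<sigma>)"
    by (intro borel_integrable_atLeastAtMost' continuous_intros) (use assms(3) in auto)
  have "E * (\<beta> - w)\<^sup>2 / (2 * \<sigma>) = (\<integral>z. indicator {w..\<beta>} z * (E * (\<beta> - z) / \<sigma>) \<partial>lborel)"
    using set_borel_integral_eq_integral(2)[OF si] unfolding integral_unique[OF hi] set_lebesgue_integral_def
    by (simp only: real_scaleR_def) simp
  also have "\<dots> \<le> right_mass G w"
    unfolding right_mass_def
  proof (rule integral_mono_AE)
    show "integrable lborel (\<lambda>z. indicator {w..\<beta>} z * (E * (\<beta> - z) / \<sigma>))" using si by (simp add: set_integrable_def)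
    show "integrable lborel (\<lambda>x. indicator {w..} x * G x)" by (intro integrable_indicator_mult concave_bumpD(2)[OF G]) auto
    have "AE z in lborel. z \<noteq> w" by (rule AE_lborel_singleton)
    then show "AE z in lborel. indicator {w..\<beta>} z * (E * (\<beta> - z) / \<sigma>) \<le> indicator {w..} z * G z"
    proof eventually_elim
      fix z assume "z \<noteq> w"
      then show "indicator {w..\<beta>} z * (E * (\<beta> - z) / \<sigma>) \<le> indicator {w..} z * G z"
        using low[of z] concave_bumpD(1)[OF G, of z] by (cases "z = \<beta>") (auto simp: indicator_def)
    qed
  qed
  finally have "E * (\<beta> - w)\<^sup>2 \<le> 2 * \<sigma> * right_mass G w" using assms(3) by (simp add: field_simps)
  moreover have "0 < (\<beta> - w)\<^sup>2" using assms by (simp add: w_def)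
  ultimately have "E \<le> 2 * \<sigma> / (\<beta> - w)\<^sup>2 * right_mass G w" by (simp add: field_simps)
  then show ?thesis by (simp add: E_def w_def)
qed

lemma rise_le_left_mass:
  assumes G: "concave_bump \<alpha> \<beta> G" and "\<alpha> < y" "0 < \<sigma>" "y + \<sigma> < \<beta>"
  shows "G (y + \<sigma>) - G y \<le> 2 * \<sigma> / (y - \<alpha>)\<^sup>2 * left_mass G y"
  using drop_le_right_mass[OF concave_bump_reflect[OF G], of "- (y + \<sigma>)" \<sigma>] assms
  by (simp add: right_mass_reflect add.commute)

lemma bound_sq_ratio:
  assumes "0 < \<sigma>" "2 * \<sigma> \<le> \<kappa>" "\<kappa> - \<sigma> \<le> b" "0 \<le> m" "m \<le> (M::real)"
  shows "2 * \<sigma> / b\<^sup>2 * m \<le> 8 * \<sigma> / \<kappa>\<^sup>2 * M"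
proof -
  have "(\<kappa> / 2)\<^sup>2 \<le> b\<^sup>2" using assms by (intro power_mono) auto
  moreover have "0 < (\<kappa> / 2)\<^sup>2" using assms by auto
  ultimately have "2 * \<sigma> / b\<^sup>2 \<le> 2 * \<sigma> / (\<kappa> / 2)\<^sup>2" using assms by (intro divide_left_mono mult_pos_pos) auto
  also have "\<dots> = 8 * \<sigma> / \<kappa>\<^sup>2" by (simp add: power_divide)
  finally show ?thesis using assms by (intro mult_mono) auto
qed

lemma diff2_integrable:
  assumes "concave_bump \<alpha> \<beta> G"
  shows "integrable lborel (diff2 \<sigma> G)"
  unfolding diff2_def[abs_def]
  by (intro Bochner_Integration.integrable_add Bochner_Integration.integrable_diff integrable_mult_right integrable_shift concave_bumpD(2)[OF assms])

text \<open>Away from the ends concavity makes \<open>diff2\<close> nonpositive, so the integral of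
  its absolute value telescopes through first differences and leaves two strips of length \<sigma>.
  On these the drop or rise is itself of order \<sigma> times the mass of a tail, whence the square
  of \<sigma>.\<close>

lemma diff2_interior:
  assumes G: "concave_bump \<alpha> \<beta> G" and "0 < \<sigma>" "2 * \<sigma> \<le> \<kappa>"
  shows "(\<integral>x. indicator {\<alpha> + \<kappa>..\<beta> - \<kappa>} x * \<bar>diff2 \<sigma> G x\<bar> \<partial>lborel) 
     \<le> 8 * \<sigma>\<^sup>2 / \<kappa>\<^sup>2 * (right_mass G (\<beta> - \<kappa>) + left_mass G (\<alpha> + \<kappa>))"
proof (cases "\<alpha> + \<kappa> \<le> \<beta> - \<kappa>")
  case False
  then show ?thesis using right_mass_nonneg[OF G] left_mass_nonneg[OF G] by simp
next
  case True
  define p q where "p = \<alpha> + \<kappa>" and "q = \<beta> - \<kappa>"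
  have pq: "p \<le> q" "\<alpha> < p - \<sigma>" "q + \<sigma> < \<beta>" using True assms by (auto simp: p_def q_def)
  have \<kappa>: "0 < \<kappa>" using assms by simp
  define D where "D = (\<lambda>x. G x - G (x + \<sigma>))"
  have Di: "integrable lborel D" unfolding D_def by (intro Bochner_Integration.integrable_diff integrable_shift concave_bumpD(2)[OF G])
  note ii = integrable_indicator_mult[OF Di]
  have neg: "diff2 \<sigma> G x \<le> 0" if "x \<in> {p..q}" for x
    using concave_bumpD(5)[OF G, of "x - \<sigma>" "x + \<sigma>" "1 / 2"] that pq assms(2) by (simp add: diff2_def field_simps)
  have "(\<integral>x. indicator {p..q} x * \<bar>diff2 \<sigma> G x\<bar> \<partial>lborel) = (\<integral>x. indicator {p..q} x * D x - indicator {p..q} x * D (x - \<sigma>) \<partial>lborel)"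
    using neg by (intro Bochner_Integration.integral_cong) (auto simp: indicator_def diff2_def D_def)
  also have "\<dots> = (\<integral>x. indicator {p..q} x * D x \<partial>lborel) - (\<integral>x. indicator {p..q} x * D (x - \<sigma>) \<partial>lborel)"
    by (intro Bochner_Integration.integral_diff ii integrable_indicator_mult integrable_shift Di) auto
  also have "(\<integral>x. indicator {p..q} x * D (x - \<sigma>) \<partial>lborel) = (\<integral>x. indicator {p-\<sigma>..q-\<sigma>} x * D x \<partial>lborel)"
    by (subst lborel_integral_real_affine[where c=1 and t=\<sigma>]) (auto intro!: Bochner_Integration.integral_cong simp: indicator_def)
  also have "(\<integral>x. indicator {p..q} x * D x \<partial>lborel) - (\<integral>x. indicator {p-\<sigma>..q-\<sigma>} x * D x \<partial>lborel)
     = (\<integral>x. indicator {p..q} x * D x - indicator {p-\<sigma>..q-\<sigma>} x * D x \<partial>lborel)"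
    by (intro Bochner_Integration.integral_diff[symmetric] ii) auto
  \<comment> \<open>This identity between indicators fails at two points only, and it also holds
    when the strips overlap.\<close>
  also have "\<dots> = (\<integral>x. indicator {q-\<sigma>..q} x * D x + indicator {p-\<sigma>..p} x * (- D x) \<partial>lborel)"
  proof (rule integral_cong_AE)
    have "AE x in lborel. x \<noteq> p" "AE x in lborel. x \<noteq> q - \<sigma>" by (rule AE_lborel_singleton)+
    then show "AE x in lborel. indicator {p..q} x * D x - indicator {p-\<sigma>..q-\<sigma>} x * D x = indicator {q-\<sigma>..q} x * D x + indicator {p-\<sigma>..p} x * (- D x)"
    proof eventually_elim
      fix x assume "x \<noteq> p" "x \<noteq> q - \<sigma>"
      then show "indicator {p..q} x * D x - indicator {p-\<sigma>..q-\<sigma>} x * D x = indicator {q-\<sigma>..q} x * D x + indicator {p-\<sigma>..p} x * (- D x)"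
        using pq assms(2) by (auto simp: indicator_def)
    qed
  qed (use borel_measurable_integrable[OF Di] in measurable)
  also have "\<dots> \<le> (\<integral>x. (8 * \<sigma> / \<kappa>\<^sup>2 * right_mass G q) * indicator {q-\<sigma>..q} x + (8 * \<sigma> / \<kappa>\<^sup>2 * left_mass G p) * indicator {p-\<sigma>..p} x \<partial>lborel)"
  proof (rule integral_mono)
    show "integrable lborel (\<lambda>x. indicator {q-\<sigma>..q} x * D x + indicator {p-\<sigma>..p} x * (- D x))"
      by (intro Bochner_Integration.integrable_add ii integrable_indicator_mult Bochner_Integration.integrable_minus Di) auto
    show "integrable lborel (\<lambda>x. (8 * \<sigma> / \<kappa>\<^sup>2 * right_mass G q) * indicator {q-\<sigma>..q} x + (8 * \<sigma> / \<kappa>\<^sup>2 * left_mass G p) * indicator {p-\<sigma>..p} x)"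
      by (intro Bochner_Integration.integrable_add integrable_mult_right integrable_real_indicator) (auto simp: emeasure_lborel_Icc_eq)
    fix x :: real
    have "D x \<le> 8 * \<sigma> / \<kappa>\<^sup>2 * right_mass G q" if "x \<in> {q-\<sigma>..q}"
    proof -
      have "D x \<le> 2 * \<sigma> / (\<beta> - (x + \<sigma>))\<^sup>2 * right_mass G (x + \<sigma>)"
        unfolding D_def using that pq assms(2) by (intro drop_le_right_mass[OF G]) auto
      also have "\<dots> \<le> 8 * \<sigma> / \<kappa>\<^sup>2 * right_mass G q"
        using that assms by (intro bound_sq_ratio right_mass_nonneg[OF G] right_mass_mono[OF G]) (auto simp: q_def)
      finally show ?thesis .
    qed
    moreover have "- D x \<le> 8 * \<sigma> / \<kappa>\<^sup>2 * left_mass G p" if "x \<in> {p-\<sigma>..p}"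
    proof -
      have "- D x \<le> 2 * \<sigma> / (x - \<alpha>)\<^sup>2 * left_mass G x"
        unfolding D_def using that pq assms(2) rise_le_left_mass[OF G, of x \<sigma>] by auto
      also have "\<dots> \<le> 8 * \<sigma> / \<kappa>\<^sup>2 * left_mass G p"
        using that assms by (intro bound_sq_ratio left_mass_nonneg[OF G] left_mass_mono[OF G]) (auto simp: p_def)
      finally show ?thesis .
    qed
    ultimately show "indicator {q-\<sigma>..q} x * D x + indicator {p-\<sigma>..p} x * (- D x) \<le> (8 * \<sigma> / \<kappa>\<^sup>2 * right_mass G q) * indicator {q-\<sigma>..q} x + (8 * \<sigma> / \<kappa>\<^sup>2 * left_mass G p) * indicator {p-\<sigma>..p} x"
      by (intro add_mono) (auto simp: indicator_def)
  qed
  also have "\<dots> = 8 * \<sigma>\<^sup>2 / \<kappa>\<^sup>2 * (right_mass G q + left_mass G p)"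
    using assms(2) by (subst Bochner_Integration.integral_add) 
      (auto intro!: integrable_real_indicator simp: emeasure_lborel_Icc_eq power2_eq_square algebra_simps add_divide_distrib)
  finally show ?thesis unfolding p_def q_def .
qed

text \<open>The choice \<open>\<kappa> = 2 * \<sigma>\<close> in \<open>diff2_interior\<close> gives
  the factor 2 for the middle. Near the ends the three values are added without using cancellation:
  shifts by \<sigma> stay within \<open>3 * \<sigma>\<close> of the end, and the weights
  \<open>1 + 2 + 1\<close> contribute 4.\<close>

lemma diff2_total:
  assumes G: "concave_bump \<alpha> \<beta> G" and \<sigma>: "0 < \<sigma>"
  shows "(\<integral>x. \<bar>diff2 \<sigma> G x\<bar> \<partial>lborel) \<le> 6 * (right_mass G (\<beta> - 3 * \<sigma>) + left_mass G (\<alpha> + 3 * \<sigma>))"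
proof -
  note Gi = concave_bumpD(2)[OF G]
  have sh: "(\<integral>x. indicator A x * G (x + c) \<partial>lborel) = (\<integral>x. indicator A (x - c) * G x \<partial>lborel)" for A c
    by (subst (2) lborel_integral_real_affine[where c=1 and t=c]) (auto intro!: Bochner_Integration.integral_cong simp: add.commute)
  have ends: "(\<integral>x. indicator A x * (G (x + \<sigma>) + 2 * G x + G (x - \<sigma>)) \<partial>lborel) \<le> 4 * m"
    if A: "A \<in> sets borel" and m: "\<And>c. \<bar>c\<bar> \<le> \<sigma> \<Longrightarrow> (\<integral>x. indicator A (x - c) * G x \<partial>lborel) \<le> m" for A m
  proof -
    note i = integrable_indicator_mult[OF _ A]
    have "(\<integral>x. indicator A x * (G (x + \<sigma>) + 2 * G x + G (x - \<sigma>)) \<partial>lborel)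
      = (\<integral>x. indicator A x * G (x + \<sigma>) \<partial>lborel) + 2 * (\<integral>x. indicator A x * G x \<partial>lborel) + (\<integral>x. indicator A x * G (x - \<sigma>) \<partial>lborel)"
      using i[OF integrable_shift(1)[OF Gi]] i[OF integrable_shift(2)[OF Gi]] i[OF Gi]
      unfolding distrib_left
      by (subst Bochner_Integration.integral_add, auto simp: mult.left_commute[of "indicator A _" 2])+
    then show ?thesis using sh[of A \<sigma>] sh[of A "-\<sigma>"] m[of 0] m[of \<sigma>] m[of "-\<sigma>"] \<sigma> by simp
  qed
  let ?R = "right_mass G (\<beta> - 3 * \<sigma>)" and ?L = "left_mass G (\<alpha> + 3 * \<sigma>)"
  have R: "(\<integral>x. indicator {\<beta> - 2 * \<sigma><..} x * (G (x + \<sigma>) + 2 * G x + G (x - \<sigma>)) \<partial>lborel) \<le> 4 * ?R"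
  proof (rule ends)
    fix c :: real assume "\<bar>c\<bar> \<le> \<sigma>"
    have "(\<integral>x. indicator {\<beta> - 2 * \<sigma> + c<..} x * G x \<partial>lborel) \<le> ?R"
      unfolding right_mass_def using \<open>\<bar>c\<bar> \<le> \<sigma>\<close> concave_bumpD(1)[OF G]
      by (intro integral_mono integrable_indicator_mult Gi) (auto simp: indicator_def)
    then show "(\<integral>x. indicator {\<beta> - 2 * \<sigma><..} (x - c) * G x \<partial>lborel) \<le> ?R"
      by (simp add: indicator_def algebra_simps)
  qed auto
  have L: "(\<integral>x. indicator {..<\<alpha> + 2 * \<sigma>} x * (G (x + \<sigma>) + 2 * G x + G (x - \<sigma>)) \<partial>lborel) \<le> 4 * ?L"
  proof (rule ends)
    fix c :: real assume "\<bar>c\<bar> \<le> \<sigma>"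
    have "(\<integral>x. indicator {..<\<alpha> + 2 * \<sigma> + c} x * G x \<partial>lborel) \<le> ?L"
      unfolding left_mass_def using \<open>\<bar>c\<bar> \<le> \<sigma>\<close> concave_bumpD(1)[OF G]
      by (intro integral_mono integrable_indicator_mult Gi) (auto simp: indicator_def)
    then show "(\<integral>x. indicator {..<\<alpha> + 2 * \<sigma>} (x - c) * G x \<partial>lborel) \<le> ?L"
      by (simp add: indicator_def algebra_simps)
  qed auto
  define H where "H = (\<lambda>x. G (x + \<sigma>) + 2 * G x + G (x - \<sigma>))"
  have Hi: "integrable lborel H" unfolding H_def
    by (intro Bochner_Integration.integrable_add integrable_mult_right integrable_shift Gi)
  have H: "\<bar>diff2 \<sigma> G x\<bar> \<le> H x" "0 \<le> H x" for x
    using concave_bumpD(1)[OF G, of x] concave_bumpD(1)[OF G, of "x+\<sigma>"] concave_bumpD(1)[OF G, of "x-\<sigma>"] by (auto simp: diff2_def H_def)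
  have H2: "\<bar>diff2 \<sigma> G x\<bar> \<le> 2 * H x" for x using H[of x] by linarith
  have di: "integrable lborel (\<lambda>x. \<bar>diff2 \<sigma> G x\<bar>)" using diff2_integrable[OF G] by auto
  let ?M = "\<lambda>x. indicator {\<alpha> + 2 * \<sigma>..\<beta> - 2 * \<sigma>} x * \<bar>diff2 \<sigma> G x\<bar>"
  have "(\<integral>x. \<bar>diff2 \<sigma> G x\<bar> \<partial>lborel) \<le> (\<integral>x. ?M x + indicator {\<beta> - 2 * \<sigma><..} x * H x + indicator {..<\<alpha> + 2 * \<sigma>} x * H x \<partial>lborel)"
    using H H2 by (intro integral_mono Bochner_Integration.integrable_add integrable_indicator_mult di Hi) (auto simp: indicator_def)
  also have "\<dots> = (\<integral>x. ?M x \<partial>lborel) + (\<integral>x. indicator {\<beta> - 2 * \<sigma><..} x * H x \<partial>lborel) + (\<integral>x. indicator {..<\<alpha> + 2 * \<sigma>} x * H x \<partial>lborel)"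
    by (simp add: integrable_indicator_mult di Hi Bochner_Integration.integral_add Bochner_Integration.integrable_add)
  also have "\<dots> \<le> 8 * \<sigma>\<^sup>2 / (2 * \<sigma>)\<^sup>2 * (right_mass G (\<beta> - 2 * \<sigma>) + left_mass G (\<alpha> + 2 * \<sigma>)) + 4 * ?R + 4 * ?L"
    using R L diff2_interior[OF G \<sigma>, of "2 * \<sigma>"] by (simp add: H_def)
  also have "8 * \<sigma>\<^sup>2 / (2 * \<sigma>)\<^sup>2 = 2" using \<sigma> by (simp add: power_mult_distrib)
  finally show ?thesis using right_mass_mono[OF G, of "\<beta> - 3 * \<sigma>" "\<beta> - 2 * \<sigma>"] left_mass_mono[OF G, of "\<alpha> + 2 * \<sigma>" "\<alpha> + 3 * \<sigma>"] \<sigma> by simp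
qed

section \<open>Slices of a convex body and its density along a direction\<close>

lemma measure_convex_combination:
  fixes A0 A1 A :: "real set"
  assumes "bounded A0" "bounded A1" "A0 \<noteq> {}" "A1 \<noteq> {}" "bounded A" "A \<in> sets borel" "convex A" "u \<in> {0..1}"
    and comb: "\<And>a b. a \<in> A0 \<Longrightarrow> b \<in> A1 \<Longrightarrow> (1 - u) * a + u * b \<in> A"
  shows "(1 - u) * measure lborel A0 + u * measure lborel A1 \<le> measure lborel A"
proof -
  have bd: "bdd_above A0" "bdd_below A0" "bdd_above A1" "bdd_below A1"
    using assms(1,2) by (auto simp: bounded_imp_bdd_above bounded_imp_bdd_below)
  have len: "measure lborel B \<le> Sup B - Inf B" if "bounded B" "B \<noteq> {}" for B :: "real set"
  proof -
    have b: "bdd_above B" "bdd_below B" using that by (auto simp: bounded_imp_bdd_above bounded_imp_bdd_below)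
    have sub: "B \<subseteq> {Inf B..Sup B}" using b by (auto intro: cInf_lower cSup_upper)
    have le: "Inf B \<le> Sup B" using sub that by fastforce
    have "emeasure lborel B \<le> emeasure lborel {Inf B..Sup B}" by (rule emeasure_mono[OF sub]) simp
    then have "enn2real (emeasure lborel B) \<le> enn2real (emeasure lborel {Inf B..Sup B})"
      by (rule enn2real_mono) (simp add: emeasure_lborel_Icc_eq)
    then show ?thesis using le by (simp add: measure_def)
  qed
  define i s where "i = (1 - u) * Inf A0 + u * Inf A1" and "s = (1 - u) * Sup A0 + u * Sup A1"
  \<comment> \<open>The core of Brunn-Minkowski in dimension one: the spans of \<open>A0\<close> and
    \<open>A1\<close> combine linearly to the interval from \<open>i\<close> to \<open>s\<close>,
    and near-extremal points together with convexity place that interval inside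
    \<open>A\<close>.\<close>
  have sub: "{i<..<s} \<subseteq> A"
  proof
    fix x assume x: "x \<in> {i<..<s}"
    have "Inf A0 < Inf A0 + (x - i)" "Inf A1 < Inf A1 + (x - i)" using x by auto
    then obtain a0 a1 where a: "a0 \<in> A0" "a1 \<in> A1" "a0 < Inf A0 + (x - i)" "a1 < Inf A1 + (x - i)"
      using cInf_less_iff[OF assms(3) bd(2)] cInf_less_iff[OF assms(4) bd(4)] by metis
    have "Sup A0 - (s - x) < Sup A0" "Sup A1 - (s - x) < Sup A1" using x by auto
    then obtain b0 b1 where b: "b0 \<in> A0" "b1 \<in> A1" "Sup A0 - (s - x) < b0" "Sup A1 - (s - x) < b1"
      using less_cSup_iff[OF assms(3) bd(1)] less_cSup_iff[OF assms(4) bd(3)] by metis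
    define lo hi where "lo = (1 - u) * a0 + u * a1" and "hi = (1 - u) * b0 + u * b1"
    have u: "0 \<le> 1 - u" "0 \<le> u" using assms(8) by auto
    have "lo \<le> (1 - u) * (Inf A0 + (x - i)) + u * (Inf A1 + (x - i))"
      unfolding lo_def using a u by (intro add_mono mult_left_mono) auto
    also have "\<dots> = x" by (simp add: i_def algebra_simps)
    finally have "lo \<le> x" .
    have "x = (1 - u) * (Sup A0 - (s - x)) + u * (Sup A1 - (s - x))" by (simp add: s_def algebra_simps)
    also have "\<dots> \<le> hi"
      unfolding hi_def using b u by (intro add_mono mult_left_mono) auto
    finally have "x \<le> hi" .
    have "lo \<in> A" "hi \<in> A" unfolding lo_def hi_def using a b comb by auto
    then have "closed_segment lo hi \<subseteq> A" using assms(7) by (auto simp: convex_contains_segment)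
    moreover have "x \<in> closed_segment lo hi" using \<open>lo \<le> x\<close> \<open>x \<le> hi\<close> by (simp add: closed_segment_eq_real_ivl)
    ultimately show "x \<in> A" by blast
  qed
  have "(1 - u) * measure lborel A0 + u * measure lborel A1 \<le> (1 - u) * (Sup A0 - Inf A0) + u * (Sup A1 - Inf A1)"
    using assms(8) by (intro add_mono mult_left_mono len assms) auto
  also have "\<dots> = s - i" by (simp add: s_def i_def algebra_simps)
  also have "\<dots> \<le> measure lborel A"
  proof (cases "i \<le> s")
    case True
    have "emeasure lborel {i<..<s} \<le> emeasure lborel A" using sub assms(6) by (intro emeasure_mono) auto
    then have "enn2real (emeasure lborel {i<..<s}) \<le> enn2real (emeasure lborel A)"
      using emeasure_bounded_finite[OF assms(5)] by (intro enn2real_mono) auto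
    then show ?thesis using True by (simp add: measure_def)
  next
    case False
    then show ?thesis using measure_nonneg[of lborel A] by linarith
  qed
  finally show ?thesis .
qed

text \<open>The density is the length of vertical slices, by Fubini. A convex combination of two
  slices lies in the intermediate slice, so its concavity is the one-dimensional Brunn-Minkowski
  inequality.\<close>

lemma slice_density_e1:
  assumes "convex_body \<rho> r T"
  defines "g \<equiv> \<lambda>y. measure lborel (Pair y -` T)"
  shows "concave_bump (- supp T (-1, 0)) (supp T (1, 0)) g"
    and "\<And>f B. f \<in> borel_measurable borel \<Longrightarrow> (\<And>x. \<bar>f x\<bar> \<le> B) \<Longrightarrow>
      (\<integral>x. indicator T x * f (fst x) \<partial>lborel) = (\<integral>y. g y * f y \<partial>lborel)"
proof -
  note b = convex_bodyD[OF assms(1)]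
  have T: "T \<in> sets (lborel \<Otimes>\<^sub>M lborel)" using b(1) unfolding lborel_prod by simp
  have Tm[measurable]: "T \<in> sets borel" using b(1) by simp
  have sl: "Pair y -` T \<in> sets borel" for y using sets_Pair1[OF T] by simp
  have slb: "bounded (Pair y -` T)" for y
  proof -
    have "norm z \<le> r" if "(y, z) \<in> T" for z
      using b(5) that norm_snd_le[of z y] by (auto simp: subset_eq)
    then have "Pair y -` T \<subseteq> cball 0 r" by auto
    then show ?thesis using bounded_subset bounded_cball by blast
  qed
  have slc: "convex (Pair y -` T)" for y
  proof (rule convexI)
    fix p q u v :: real assume "p \<in> Pair y -` T" "q \<in> Pair y -` T" "0 \<le> u" "0 \<le> v" "u + v = 1"
    then have "u *\<^sub>R (y, p) + v *\<^sub>R (y, q) \<in> T" by (intro convexD[OF b(2)]) auto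
    moreover have "u * y + v * y = y" using \<open>u + v = 1\<close> by (simp flip: distrib_right)
    ultimately show "u *\<^sub>R p + v *\<^sub>R q \<in> Pair y -` T" by simp
  qed
  have em: "emeasure lborel (Pair y -` T) = ennreal (g y)" for y
    unfolding g_def using emeasure_bounded_finite[OF slb, of y] by (intro emeasure_eq_ennreal_measure) (metis infinity_ennreal_def less_irrefl)
  have g0: "0 \<le> g y" for y by (simp add: g_def)
  have gm[measurable]: "g \<in> borel_measurable borel"
    using lborel.measurable_emeasure_Pair[OF T] unfolding g_def measure_def by measurable
  have gint: "integrable lborel g"
  proof (rule integrableI_bounded)
    have "(\<integral>\<^sup>+x. ennreal (norm (g x)) \<partial>lborel) = (\<integral>\<^sup>+x. emeasure lborel (Pair x -` T) \<partial>lborel)"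
      using g0 by (simp add: em)
    also have "\<dots> = emeasure lborel T"
      by (subst lborel.emeasure_pair_measure_alt[OF T, symmetric]) (simp add: lborel_prod)
    also have "\<dots> < \<infinity>" by (rule emeasure_bounded_finite[OF b(6)])
    finally show "(\<integral>\<^sup>+x. ennreal (norm (g x)) \<partial>lborel) < \<infinity>" .
  qed simp
  \<comment> \<open>On an open body a linear functional does not attain its extremes, so the density
    vanishes at both ends of its support.\<close>
  have strict: "fst x < supp T (1, 0)" "- supp T (-1, 0) < fst x" if "x \<in> T" for x
  proof -
    from b(1) that obtain e where e: "e > 0" "ball x e \<subseteq> T" by (rule openE)
    have "x + (e / 2, 0) \<in> T" "x - (e / 2, 0) \<in> T" using e(1) by (intro subsetD[OF e(2)], simp add: dist_norm norm_Pair)+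
    from inner_le_supp[OF b(6) this(1), of "(1, 0)"] inner_le_supp[OF b(6) this(2), of "(-1, 0)"] e(1)
    show "fst x < supp T (1, 0)" "- supp T (-1, 0) < fst x" by (cases x; simp)+
  qed
  have ne: "Pair y -` T \<noteq> {}" if y: "y \<in> {- supp T (-1, 0)<..<supp T (1, 0)}" for y
  proof -
    have "\<exists>x\<in>T. y < fst x"
    proof (rule ccontr)
      assume "\<not> ?thesis"
      then have "supp T (1, 0) \<le> y" by (intro supp_least b) (auto simp: not_less)
      with y show False by simp
    qed
    moreover have "\<exists>x\<in>T. fst x < y"
    proof (rule ccontr)
      assume "\<not> ?thesis"
      then have "supp T (-1, 0) \<le> - y" by (intro supp_least b) (auto simp: not_less)
      with y show False by simp
    qed
    ultimately obtain p q where pq: "p \<in> T" "q \<in> T" "fst p < y" "y < fst q" by blast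
    define u where "u = (y - fst p) / (fst q - fst p)"
    have u: "0 \<le> u" "u \<le> 1" "u * (fst q - fst p) = y - fst p" using pq by (auto simp: u_def)
    have "(1 - u) *\<^sub>R p + u *\<^sub>R q \<in> T" using b(2) pq u by (auto simp: convex_alt)
    moreover have "fst ((1 - u) *\<^sub>R p + u *\<^sub>R q) = y" using u(3) by (simp add: algebra_simps)
    ultimately have "(y, snd ((1 - u) *\<^sub>R p + u *\<^sub>R q)) \<in> T" by (metis prod.collapse)
    then show ?thesis by blast
  qed
  show "concave_bump (- supp T (-1, 0)) (supp T (1, 0)) g"
    unfolding concave_bump_def
  proof (intro conjI allI impI ballI g0 gint)
    fix y assume "y \<notin> {- supp T (-1, 0)<..<supp T (1, 0)}"
    then have "Pair y -` T = {}" using strict by fastforce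
    then show "g y = 0" by (simp add: g_def)
  next
    fix x y u assume xy: "x \<in> {- supp T (-1, 0)<..<supp T (1, 0)}" "y \<in> {- supp T (-1, 0)<..<supp T (1, 0)}" and u: "u \<in> {0..1::real}"
    show "(1 - u) * g x + u * g y \<le> g ((1 - u) * x + u * y)"
      unfolding g_def
    proof (rule measure_convex_combination[OF slb slb ne[OF xy(1)] ne[OF xy(2)] slb sl slc u])
      fix p q assume "p \<in> Pair x -` T" "q \<in> Pair y -` T"
      then have "(1 - u) *\<^sub>R (x, p) + u *\<^sub>R (y, q) \<in> T" using u by (intro convexD[OF b(2)]) auto
      then show "(1 - u) * p + u * q \<in> Pair ((1 - u) * x + u * y) -` T" by simp
    qed
  qed
  fix f :: "real \<Rightarrow> real" and B assume f[measurable]: "f \<in> borel_measurable borel" and fB: "\<And>x. \<bar>f x\<bar> \<le> B"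
  define F where "F = (\<lambda>x :: real \<times> real. indicator T x * f (fst x))"
  have fb: "fst \<in> (borel :: (real \<times> real) measure) \<rightarrow>\<^sub>M borel"
    by (intro borel_measurable_continuous_onI continuous_intros)
  have Fi: "integrable (lborel \<Otimes>\<^sub>M lborel) F"
    unfolding lborel_prod
  proof (rule Bochner_Integration.integrable_bound[where f="\<lambda>x. B * indicator T x"])
    show "integrable lborel (\<lambda>x. B * indicator T x)"
      using emeasure_bounded_finite[OF b(6)] by (intro integrable_mult_right integrable_real_indicator) auto
    have "(\<lambda>x :: real \<times> real. f (fst x)) \<in> borel_measurable borel" using measurable_compose[OF fb f] .
    then show "F \<in> borel_measurable lborel" unfolding F_def by measurable
    show "AE x in lborel. norm (F x) \<le> norm (B * indicator T x)"
    proof (rule AE_I2)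
      fix x show "norm (F x) \<le> norm (B * indicator T x)"
        using fB[of "fst x"] by (auto simp: F_def indicator_def)
    qed
  qed
  have "(\<integral>x. F x \<partial>lborel) = (\<integral>x. F x \<partial>(lborel \<Otimes>\<^sub>M lborel))" by (simp add: lborel_prod)
  also have "\<dots> = (\<integral>y. (\<integral>z. F (y, z) \<partial>lborel) \<partial>lborel)" by (rule lborel_pair.integral_fst'[OF Fi, symmetric])
  also have "\<dots> = (\<integral>y. g y * f y \<partial>lborel)"
  proof (rule Bochner_Integration.integral_cong[OF refl])
    fix y :: real
    have "(\<integral>z. F (y, z) \<partial>lborel) = (\<integral>z. indicator (Pair y -` T) z * f y \<partial>lborel)"
      by (intro Bochner_Integration.integral_cong) (auto simp: F_def indicator_def)
    also have "\<dots> = g y * f y" unfolding g_def using sl[of y] by simp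
    finally show "(\<integral>z. F (y, z) \<partial>lborel) = g y * f y" .
  qed
  finally show "(\<integral>x. indicator T x * f (fst x) \<partial>lborel) = (\<integral>y. g y * f y \<partial>lborel)" by (simp add: F_def)
qed

text \<open>Rotating \<open>k\<close> onto the first axis reduces to vertical slices, and the
  dilation by \<open>n = norm k\<close> turns \<open>g\<close> into \<open>g (y / n) / n\<close>.
  From here on, planar integrals along \<open>k\<close> are one-dimensional, with the two support
  values as ends.\<close>

lemma slice_density:
  assumes S: "convex_body \<rho> r S" and "k \<noteq> 0"
  obtains G where "concave_bump (- supp S (- k)) (supp S k) G"
    "\<And>f B. f \<in> borel_measurable borel \<Longrightarrow> (\<And>x. \<bar>f x\<bar> \<le> B) \<Longrightarrow>
      (\<integral>x. indicator S x * f (k \<bullet> x) \<partial>lborel) = (\<integral>y. G y * f y \<partial>lborel)"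
proof -
  note b = convex_bodyD[OF S]
  define n where "n = norm k"
  have n: "0 < n" using assms(2) by (simp add: n_def)
  obtain \<beta> where k: "k = n *\<^sub>R rot \<beta> (1, 0)" using polar_exists[of k] unfolding n_def by auto
  define T where "T = rot (- \<beta>) ` S"
  have T: "convex_body \<rho> r T" unfolding T_def by (rule convex_body_rot[OF S])
  define g where "g = (\<lambda>y. measure lborel (Pair y -` T))"
  define G where "G = (\<lambda>y. g (y / n) / n)"
  have geq: "measure lborel (Pair y -` T) = g y" for y by (simp add: g_def)
  note d = slice_density_e1[OF T, unfolded geq]
  have mrot: "rot \<beta> (- v) = - rot \<beta> v" for v by (simp add: rot_def)
  have s: "supp S k = n * supp T (1, 0)" "supp S (- k) = n * supp T (-1, 0)"
  proof -
    show "supp S k = n * supp T (1, 0)"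
      unfolding T_def supp_rot k using n by (subst supp_scale[OF b(6,7)]) auto
    have "- k = n *\<^sub>R rot \<beta> (-1, 0)" using k mrot[of "(1,0)"] by simp
    then show "supp S (- k) = n * supp T (-1, 0)"
      unfolding T_def supp_rot using n by (simp add: supp_scale[OF b(6,7)])
  qed
  have [measurable]: "S \<in> sets borel" using b(1) by simp
  show ?thesis
  proof (rule that)
    show "concave_bump (- supp S (- k)) (supp S k) G"
      unfolding concave_bump_def
    proof (intro conjI allI impI ballI)
      show "0 \<le> G x" for x using n concave_bumpD(1)[OF d(1)] by (simp add: G_def)
      show "integrable lborel G" unfolding G_def
        using lborel_integrable_real_affine[OF concave_bumpD(2)[OF d(1)], of "1 / n" 0] n by simp
      show "G x = 0" if "x \<notin> {- supp S (- k)<..<supp S k}" for x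
        unfolding G_def using concave_bumpD(3)[OF d(1), of "x / n"] that n by (auto simp: s field_simps)
      fix x y u :: real assume "x \<in> {- supp S (- k)<..<supp S k}" "y \<in> {- supp S (- k)<..<supp S k}" "u \<in> {0..1}"
      then have "(1 - u) * g (x / n) + u * g (y / n) \<le> g ((1 - u) * (x / n) + u * (y / n))"
        using n by (intro concave_bumpD(5)[OF d(1)]) (auto simp: s field_simps)
      then have "((1 - u) * g (x / n) + u * g (y / n)) / n \<le> g (((1 - u) * x + u * y) / n) / n"
        using n by (intro divide_right_mono) (auto simp: add_divide_distrib)
      then show "(1 - u) * G x + u * G y \<le> G ((1 - u) * x + u * y)" by (simp add: G_def add_divide_distrib)
    qed
    fix f :: "real \<Rightarrow> real" and B assume f[measurable]: "f \<in> borel_measurable borel" and fB: "\<And>x. \<bar>f x\<bar> \<le> B"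
    have "(\<integral>x. indicator S x * f (k \<bullet> x) \<partial>lborel) = (\<integral>x. indicator S (rot \<beta> x) * f (k \<bullet> rot \<beta> x) \<partial>lborel)"
      by (subst distr_rot[of \<beta>, symmetric], subst integral_distr) (auto simp: measurable_compose[OF rot_measurable])
    also have "\<dots> = (\<integral>x. indicator T x * f (n * fst x) \<partial>lborel)"
    proof (rule Bochner_Integration.integral_cong[OF refl])
      fix x
      have "k \<bullet> rot \<beta> x = n * ((1, 0) \<bullet> x)" unfolding k by (simp add: inner_rot)
      moreover have "indicator S (rot \<beta> x) = (indicator T x :: real)"
        by (simp add: indicator_def T_def rot_image_eq_vimage)
      ultimately show "indicator S (rot \<beta> x) * f (k \<bullet> rot \<beta> x) = indicator T x * f (n * fst x)" by (cases x) simp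
    qed
    also have "\<dots> = (\<integral>y. g y * f (n * y) \<partial>lborel)" using d(2)[of "\<lambda>y. f (n * y)" B] fB by simp
    also have "\<dots> = (\<integral>y. G y * f y \<partial>lborel)"
      using n by (subst (2) lborel_integral_real_affine[where c=n and t=0]) (auto simp: G_def)
    finally show "(\<integral>x. indicator S x * f (k \<bullet> x) \<partial>lborel) = (\<integral>y. G y * f y \<partial>lborel)" .
  qed
qed

subsection \<open>Lattice points in shells\<close>

definition lat :: "int \<times> int \<Rightarrow> real \<times> real" where
  "lat p = (real_of_int (fst p), real_of_int (snd p))"

text \<open>Half-open, so that the lattice translates partition the plane. Disjointness serves
  \<open>shell_count\<close>; both disjointness and covering serve
  \<open>periodization\<close>.\<close>

definition cell :: "(real \<times> real) set" where
  "cell = {-1/2..<1/2} \<times> {-1/2..<1/2}"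

lemma cell_sets [measurable]: "cell \<in> sets borel"
  unfolding cell_def by (intro borel_Times) auto

lemma emeasure_cell: "emeasure lborel cell = 1"
proof -
  have "emeasure (lborel \<Otimes>\<^sub>M lborel) ({-1/2..<1/2::real} \<times> {-1/2..<1/2::real}) = 1"
    by (subst lborel.emeasure_pair_measure_Times) auto
  then show ?thesis by (simp add: cell_def lborel_prod)
qed

lemma norm_cell:
  assumes "y \<in> cell"
  shows "norm y \<le> 1"
proof -
  have "\<bar>fst y\<bar> \<le> 1/2" "\<bar>snd y\<bar> \<le> 1/2" using assms by (auto simp: cell_def)
  then show ?thesis using norm_Pair_le[of "fst y" "snd y"] by simp
qed

lemma lat_cell_unique:
  assumes "x - lat p \<in> cell" "x - lat q \<in> cell"
  shows "p = q"
proof -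
  have "\<bar>real_of_int (fst p - fst q)\<bar> < 1" "\<bar>real_of_int (snd p - snd q)\<bar> < 1"
    using assms by (auto simp: cell_def lat_def mem_Times_iff)
  then have "fst p = fst q" "snd p = snd q" by linarith+
  then show ?thesis by (simp add: prod_eq_iff)
qed

lemma lat_cell_exists: "\<exists>p. x - lat p \<in> cell"
proof -
  have "-1/2 \<le> a - real_of_int \<lfloor>a + 1/2\<rfloor> \<and> a - real_of_int \<lfloor>a + 1/2\<rfloor> < 1/2" for a :: real by linarith
  then have "x - lat (\<lfloor>fst x + 1/2\<rfloor>, \<lfloor>snd x + 1/2\<rfloor>) \<in> cell"
    by (simp add: lat_def cell_def mem_Times_iff)
  then show ?thesis by blast
qed

lemma finite_lat_bounded:
  assumes "bounded X"
  shows "finite {p. lat p \<in> X}"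
proof -
  obtain B where B: "\<And>x. x \<in> X \<Longrightarrow> norm x \<le> B" using assms by (auto simp: bounded_iff)
  have "{p. lat p \<in> X} \<subseteq> {-\<lceil>B\<rceil>..\<lceil>B\<rceil>} \<times> {-\<lceil>B\<rceil>..\<lceil>B\<rceil>}"
  proof
    fix p assume "p \<in> {p. lat p \<in> X}"
    then have "norm (lat p) \<le> B" using B by auto
    then have "\<bar>real_of_int (fst p)\<bar> \<le> B" "\<bar>real_of_int (snd p)\<bar> \<le> B"
      using norm_fst_le[of "real_of_int (fst p)" "real_of_int (snd p)"] norm_snd_le[of "real_of_int (snd p)" "real_of_int (fst p)"] 
      by (auto simp: lat_def)
    then have "\<bar>fst p\<bar> \<le> \<lceil>B\<rceil>" "\<bar>snd p\<bar> \<le> \<lceil>B\<rceil>" by linarith+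
    then show "p \<in> {-\<lceil>B\<rceil>..\<lceil>B\<rceil>} \<times> {-\<lceil>B\<rceil>..\<lceil>B\<rceil>}" by (cases p) auto
  qed
  then show ?thesis by (rule finite_subset) auto
qed

text \<open>Convexity lets a translation be absorbed into the dilation factor. All comparisons of
  lattice counts below are instances of this.\<close>

lemma scaled_body_add:
  assumes "convex S" "x \<in> (\<lambda>x. a *\<^sub>R x) ` S" "y \<in> (\<lambda>x. b *\<^sub>R x) ` S" "0 \<le> a" "0 \<le> b" "0 < a + b"
  shows "x + y \<in> (\<lambda>x. (a + b) *\<^sub>R x) ` (S :: (real \<times> real) set)"
proof -
  obtain u v where uv: "u \<in> S" "v \<in> S" "x = a *\<^sub>R u" "y = b *\<^sub>R v" using assms by auto
  have "(a / (a + b)) *\<^sub>R u + (b / (a + b)) *\<^sub>R v \<in> S"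
    using assms uv by (intro convexD) (auto simp flip: add_divide_distrib)
  moreover have "x + y = (a + b) *\<^sub>R ((a / (a + b)) *\<^sub>R u + (b / (a + b)) *\<^sub>R v)"
    using assms(6) by (simp add: uv scaleR_add_right)
  ultimately show ?thesis by blast
qed

lemma scaled_ball_subset:
  assumes "convex_body \<rho> r S" "norm y < c * \<rho>" "0 < c"
  shows "y \<in> (\<lambda>x. c *\<^sub>R x) ` S"
proof -
  have "(1 / c) *\<^sub>R y \<in> S" using assms convex_bodyD(4)[OF assms(1)] by (auto simp: subset_eq field_simps)
  then show ?thesis using assms(3) by (intro image_eqI[of _ _ "(1 / c) *\<^sub>R y"]) auto
qed

lemma scaled_mono:
  assumes "convex_body \<rho> r S" "0 \<le> a" "a \<le> b"
  shows "(\<lambda>x. a *\<^sub>R x) ` S \<subseteq> (\<lambda>x. b *\<^sub>R x) ` S"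
proof (cases "a = b")
  case False
  show ?thesis
  proof
    fix x assume "x \<in> (\<lambda>x. a *\<^sub>R x) ` S"
    moreover have "0 \<in> (\<lambda>x. (b - a) *\<^sub>R x) ` S" using convex_bodyD(8)[OF assms(1)] by auto
    ultimately have "x + 0 \<in> (\<lambda>x. (a + (b - a)) *\<^sub>R x) ` S"
      using assms False by (intro scaled_body_add convex_bodyD[OF assms(1)]) auto
    then show "x \<in> (\<lambda>x. b *\<^sub>R x) ` S" by simp
  qed
qed auto

lemma bounded_scaled: "bounded S \<Longrightarrow> bounded ((\<lambda>x. c *\<^sub>R x) ` (S :: (real \<times> real) set))"
  by (rule bounded_scaling)

text \<open>The unit cells around the counted points are disjoint and lie between the dilates by
  \<open>a - c\<close> and \<open>b + c\<close>, since the dilate by \<open>c\<close> contains a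
  cell and its reflection. The area in between is of order \<open>(b - a + 1) * (b + 1)\<close>. The
  case \<open>a = 0\<close> is exempted because the dilate by 0 is the single point 0, and the
  origin is then counted as well.\<close>

lemma shell_count:
  assumes S: "convex_body \<rho> r S" and ab: "0 \<le> a" "a \<le> b"
  shows "real (card {p. lat p \<in> (\<lambda>x. b *\<^sub>R x) ` S \<and> (a = 0 \<or> lat p \<notin> (\<lambda>x. a *\<^sub>R x) ` S)})
     \<le> 4 * r\<^sup>2 * (2 + 4 / \<rho>)\<^sup>2 * (b - a + 1) * (b + 1)"
proof -
  note bd = convex_bodyD[OF S]
  define P where "P = {p. lat p \<in> (\<lambda>x. b *\<^sub>R x) ` S \<and> (a = 0 \<or> lat p \<notin> (\<lambda>x. a *\<^sub>R x) ` S)}"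
  define c where "c = 2 / \<rho>"
  have c: "0 < c" "1 < c * \<rho>" using bd(3) by (auto simp: c_def)
  have fin: "finite P"
    using finite_lat_bounded[OF bounded_scaled[OF bd(6), of b]] by (rule rev_finite_subset) (auto simp: P_def)
  define U where "U = (\<Union>p\<in>P. (\<lambda>y. lat p + y) ` cell)"
  have cs: "(\<lambda>y. v + y) ` cell \<in> sets borel" "emeasure lborel ((\<lambda>y. v + y) ` cell) = 1" for v
  proof -
    have e: "(\<lambda>y. v + y) ` cell = (\<lambda>y. - v + y) -` cell"
      by (auto simp: image_iff intro!: bexI[where x="-v + z" for z])
    then show m: "(\<lambda>y. v + y) ` cell \<in> sets borel"
      using measurable_sets[of "(+) (- v)" borel borel cell] unfolding e by simp
    show "emeasure lborel ((\<lambda>y. v + y) ` cell) = 1"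
      using emeasure_cell unfolding e
      by (subst (asm) lborel_distr_plus[of "-v", symmetric]) (simp add: emeasure_distr)
  qed
  have dj: "disjoint_family_on (\<lambda>p. (\<lambda>y. lat p + y) ` cell) P"
    unfolding disjoint_family_on_def
  proof (intro ballI impI)
    fix p q :: "int \<times> int" assume "p \<noteq> q"
    show "(\<lambda>y. lat p + y) ` cell \<inter> (\<lambda>y. lat q + y) ` cell = {}"
    proof (rule ccontr)
      assume "\<not> ?thesis"
      then obtain y z where yz: "y \<in> cell" "z \<in> cell" "lat p + y = lat q + z" by blast
      have "lat p + y - lat p \<in> cell" using yz(1) by simp
      moreover have "lat p + y - lat q \<in> cell" unfolding yz(3) using yz(2) by simp
      ultimately have "p = q" by (rule lat_cell_unique)
      with \<open>p \<noteq> q\<close> show False by simp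
    qed
  qed
  have "ennreal (real (card P)) = (\<Sum>p\<in>P. emeasure lborel ((\<lambda>y. lat p + y) ` cell))"
    by (simp add: cs ennreal_of_nat_eq_real_of_nat)
  also have "\<dots> = emeasure lborel U"
    unfolding U_def
  proof (rule sum_emeasure[OF _ dj fin])
    show "(\<lambda>p. (\<lambda>y. lat p + y) ` cell) ` P \<subseteq> sets lborel" using cs(1) by (simp add: image_subset_iff)
  qed
  finally have EU: "ennreal (real (card P)) = emeasure lborel U" .
  \<comment> \<open>For \<open>a \<le> c\<close> there is no inner body to remove: \<open>Y\<close>
    is then empty, and its area formula remains right with \<open>m = 0\<close>.\<close>
  define m where "m = max (a - c) 0"
  define X Y where "X = (\<lambda>x. (b + c) *\<^sub>R x) ` S" and "Y = (if m = 0 then {} else (\<lambda>x. m *\<^sub>R x) ` S)"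
  have sm: "S \<in> sets borel" using bd(1) by simp
  have Xm: "X \<in> sets borel" unfolding X_def using ab c sm by (intro sets_scaleR_image) auto
  have Ym: "Y \<in> sets borel" unfolding Y_def using sm by (auto intro!: sets_scaleR_image)
  have near: "z \<in> (\<lambda>x. c *\<^sub>R x) ` S" "- z \<in> (\<lambda>x. c *\<^sub>R x) ` S" if "z \<in> cell" for z
    using norm_cell[OF that] c by (auto intro!: scaled_ball_subset[OF S])
  have "U \<subseteq> X - Y"
  proof
    fix x assume "x \<in> U"
    then obtain p z where pz: "p \<in> P" "z \<in> cell" "x = lat p + z" by (auto simp: U_def)
    have "x \<in> X" unfolding X_def pz(3)
      using pz ab c near by (intro scaled_body_add bd) (auto simp: P_def)
    moreover have "x \<notin> Y"
    proof
      assume xY: "x \<in> Y"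
      then have m: "m = a - c" "a - c > 0" by (auto simp: Y_def m_def max_def split: if_splits)
      have "x + - z \<in> (\<lambda>x. ((a - c) + c) *\<^sub>R x) ` S"
        using xY m near[OF pz(2)] c by (intro scaled_body_add bd) (auto simp: Y_def)
      then have "lat p \<in> (\<lambda>x. a *\<^sub>R x) ` S" using pz by simp
      then show False using pz(1) m c by (auto simp: P_def)
    qed
    ultimately show "x \<in> X - Y" by simp
  qed
  have YX: "Y \<subseteq> X"
  proof (cases "m = 0")
    case False
    have "(\<lambda>x. m *\<^sub>R x) ` S \<subseteq> (\<lambda>x. (b + c) *\<^sub>R x) ` S"
      using ab c by (intro scaled_mono[OF S]) (auto simp: m_def)
    then show ?thesis unfolding X_def Y_def if_not_P[OF False] .
  qed (simp add: Y_def)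
  have EX: "emeasure lborel X = ennreal ((b + c)\<^sup>2 * measure lborel S)"
    unfolding X_def using ab c sm emeasure_bounded_finite[OF bd(6)]
    by (subst emeasure_scale) (auto simp: ennreal_mult emeasure_eq_ennreal_measure)
  have EY: "emeasure lborel Y = ennreal (m\<^sup>2 * measure lborel S)"
  proof (cases "m = 0")
    case False
    then show ?thesis unfolding Y_def using sm emeasure_bounded_finite[OF bd(6)]
      by (simp add: emeasure_scale ennreal_mult emeasure_eq_ennreal_measure)
  qed (simp add: Y_def)
  have "emeasure lborel U \<le> emeasure lborel (X - Y)" using Xm Ym \<open>U \<subseteq> X - Y\<close> by (intro emeasure_mono) auto
  also have "\<dots> = ennreal ((b + c)\<^sup>2 * measure lborel S) - ennreal (m\<^sup>2 * measure lborel S)"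
    using Xm Ym YX EX EY by (subst emeasure_Diff) auto
  also have "\<dots> = ennreal (((b + c)\<^sup>2 - m\<^sup>2) * measure lborel S)"
    by (simp add: ennreal_minus left_diff_distrib)
  finally have "ennreal (real (card P)) \<le> ennreal (((b + c)\<^sup>2 - m\<^sup>2) * measure lborel S)" unfolding EU .
  moreover have m2: "m\<^sup>2 \<le> (b + c)\<^sup>2" using ab c by (intro power_mono) (auto simp: m_def)
  ultimately have "real (card P) \<le> ((b + c)\<^sup>2 - m\<^sup>2) * measure lborel S"
    by (subst (asm) ennreal_le_iff) auto
  also have "\<dots> \<le> ((b + c)\<^sup>2 - m\<^sup>2) * (4 * r\<^sup>2)"
    using m2 by (intro mult_left_mono area_ball_le(2) bd) (auto simp: sm)
  also have "(b + c)\<^sup>2 - m\<^sup>2 \<le> (2 + 2 * c)\<^sup>2 * ((b - a + 1) * (b + 1))"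
  proof -
    have "(b + c)\<^sup>2 - m\<^sup>2 = (b + c - m) * (b + c + m)" by (simp add: power2_eq_square algebra_simps)
    also have "\<dots> \<le> ((2 + 2 * c) * (b - a + 1)) * ((2 + 2 * c) * (b + 1))"
    proof (intro mult_mono)
      have "b + c - m \<le> b - a + 2 * c" by (simp add: m_def)
      also have "\<dots> \<le> (2 + 2 * c) * (b - a + 1)"
      proof -
        have "0 \<le> c * (b - a)" using ab c by simp
        then have "b - a + 2 * c \<le> 2 * (b - a) + 2 + 2 * (c * (b - a)) + 2 * c" using ab by simp
        also have "\<dots> = (2 + 2 * c) * (b - a + 1)" by (simp add: algebra_simps)
        finally show ?thesis .
      qed
      finally show "b + c - m \<le> (2 + 2 * c) * (b - a + 1)" .
      have "b + c + m \<le> 2 * b + 2 * c" using ab c by (simp add: m_def)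
      also have "\<dots> \<le> (2 + 2 * c) * (b + 1)" using ab c by (simp add: algebra_simps)
      finally show "b + c + m \<le> (2 + 2 * c) * (b + 1)" .
    qed (use ab c in \<open>auto simp: m_def\<close>)
    finally show ?thesis by (simp add: power2_eq_square mult_ac)
  qed
  finally have "real (card P) \<le> (2 + 2 * c)\<^sup>2 * ((b - a + 1) * (b + 1)) * (4 * r\<^sup>2)"
    using bd(10) by (simp add: mult_right_mono)
  then show ?thesis unfolding P_def c_def by (simp add: mult_ac)
qed


section \<open>Reciprocal sums over lattice vectors and the polar body\<close>

lemma sum_inverse_square_int:
  assumes "finite I"
  shows "(\<Sum>i\<in>I. 1 / (1 + (real_of_int i)\<^sup>2)) \<le> 5"
proof -
  \<comment> \<open>The subtracted term makes the induction close: the two new summands are at most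
    \<open>4 / (N + 1) - 4 / (N + 2)\<close>. At \<open>N = 0\<close> both sides equal 1.\<close>
  have A: "(\<Sum>i\<in>{-int N..int N}. 1 / (1 + (real_of_int i)\<^sup>2)) \<le> 5 - 4 / (real N + 1)" for N
  proof (induction N)
    case (Suc N)
    have "{-int (Suc N)..int (Suc N)} = insert (int (Suc N)) (insert (- int (Suc N)) {-int N..int N})" by auto
    then have "(\<Sum>i\<in>{-int (Suc N)..int (Suc N)}. 1 / (1 + (real_of_int i)\<^sup>2))
       = 2 / (1 + (real N + 1)\<^sup>2) + (\<Sum>i\<in>{-int N..int N}. 1 / (1 + (real_of_int i)\<^sup>2))"
      by (simp add: power2_eq_square algebra_simps)
    moreover have "2 / (1 + (real N + 1)\<^sup>2) \<le> 4 / (real N + 1) - 4 / (real N + 2)"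
    proof -
      have "4 / (real N + 1) - 4 / (real N + 2) = 4 / ((real N + 1) * (real N + 2))"
        by (simp add: field_simps)
      moreover have "2 / a = 4 / (2 * a)" for a :: real by simp
      then have "2 / (1 + (real N + 1)\<^sup>2) = 4 / (2 * (1 + (real N + 1)\<^sup>2))" .
      moreover have "4 / (2 * (1 + (real N + 1)\<^sup>2)) \<le> 4 / ((real N + 1) * (real N + 2))"
        by (intro divide_left_mono mult_pos_pos) (auto simp: power2_eq_square algebra_simps intro: add_pos_nonneg)
      ultimately show ?thesis by simp
    qed
    ultimately show ?case using Suc.IH by (simp add: add.commute)
  qed simp
  obtain N where N: "I \<subseteq> {-int N..int N}"
  proof
    have "\<bar>i\<bar> \<le> int (nat (\<Sum>i\<in>I. \<bar>i\<bar>))" if "i \<in> I" for i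
      using member_le_sum[of i I "\<lambda>i. \<bar>i\<bar>"] that assms by simp
    then show "I \<subseteq> {-int (nat (\<Sum>i\<in>I. \<bar>i\<bar>))..int (nat (\<Sum>i\<in>I. \<bar>i\<bar>))}" by fastforce
  qed
  have "(\<Sum>i\<in>I. 1 / (1 + (real_of_int i)\<^sup>2)) \<le> (\<Sum>i\<in>{-int N..int N}. 1 / (1 + (real_of_int i)\<^sup>2))"
    using N by (intro sum_mono2) (auto intro: add_nonneg_nonneg)
  also have "\<dots> \<le> 5" using A[of N] by (rule order_trans) simp
  finally show ?thesis .
qed

text \<open>Shells of the support function are shells between dilates of this open polar set, so
  \<open>shell_count\<close> applies to frequencies too. The two radii are inverted and trade
  places.\<close>

lemma polar_body:
  assumes S: "convex_body \<rho> r S"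
  shows "convex_body (1 / r) (1 / \<rho>) {v. supp S v < 1}"
proof -
  note b = convex_bodyD[OF S]
  have "open {v. supp S v < 1}" using continuous_supp[OF S] by (intro open_Collect_less continuous_on_const) auto
  moreover have "convex {v. supp S v < 1}"
  proof (rule convexI)
    fix x y :: "real \<times> real" and u v :: real
    assume *: "x \<in> {v. supp S v < 1}" "y \<in> {v. supp S v < 1}" "0 \<le> u" "0 \<le> v" "u + v = 1"
    have "supp S (u *\<^sub>R x + v *\<^sub>R y) \<le> u * supp S x + v * supp S y"
      using supp_add_le[OF b(6,7), of "u *\<^sub>R x" "v *\<^sub>R y"] * by (simp add: supp_scale[OF b(6,7)])
    also have "\<dots> < 1" using * by (intro convex_bound_lt) auto
    finally show "u *\<^sub>R x + v *\<^sub>R y \<in> {v. supp S v < 1}" by simp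
  qed
  moreover have "ball 0 (1 / r) \<subseteq> {v. supp S v < 1}"
  proof
    fix v :: "real \<times> real" assume "v \<in> ball 0 (1 / r)"
    then have "r * norm v < 1" using b(10) by (simp add: field_simps)
    then show "v \<in> {v. supp S v < 1}" using supp_le_norm[OF S, of v] by simp
  qed
  moreover have "{v. supp S v < 1} \<subseteq> ball 0 (1 / \<rho>)"
  proof
    fix v assume "v \<in> {v. supp S v < 1}"
    then have "\<rho> * norm v < 1" using norm_le_supp[OF S, of v] by simp
    then show "v \<in> ball 0 (1 / \<rho>)" using b(3) by (simp add: field_simps)
  qed
  ultimately show ?thesis using b(10) by (simp add: convex_body_def)
qed

lemma norm_lat_ge_1:
  assumes "l \<noteq> 0"
  shows "1 \<le> norm (lat l)"
proof -
  have "1 \<le> \<bar>real_of_int (fst l)\<bar> \<or> 1 \<le> \<bar>real_of_int (snd l)\<bar>"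
    using assms by (cases l) (auto simp: zero_prod_def)
  moreover have "\<bar>real_of_int (fst l)\<bar> \<le> norm (lat l)" "\<bar>real_of_int (snd l)\<bar> \<le> norm (lat l)"
    using norm_fst_le[of "real_of_int (fst l)" "real_of_int (snd l)"] norm_snd_le[of "real_of_int (snd l)" "real_of_int (fst l)"] 
    by (auto simp: lat_def)
  ultimately show ?thesis by linarith
qed

text \<open>Up to the leading 2, which is the width \<open>b - a + 1\<close> of a unit shell, the
  first factor is the shell constant of the polar body. The factor \<open>2 + 3 * r\<close> compares
  \<open>n + 2\<close> with the norm, and 15 is 3 for rounding times 5 from
  \<open>sum_inverse_square_int\<close>.\<close>

definition supp_sum_const :: "real \<Rightarrow> real \<Rightarrow> real" where
  "supp_sum_const \<rho> r = 2 * (4 / \<rho>\<^sup>2 * (2 + 4 * r)\<^sup>2) * (2 + 3 * r) * 15"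

text \<open>Group the vectors by \<open>n = \<lfloor>H l\<rfloor>\<close>. A group has
  \<open>O(n + 2)\<close> members, each with weight \<open>O(1 / (n + 2))\<close> from its norm, so
  the shell sizes cancel. What remains is the sum over integers \<open>n\<close> of
  \<open>1 / (1 + (p - n)^2)\<close>, bounded uniformly in \<open>p\<close>.\<close>

lemma supp_sum_le:
  assumes S: "convex_body \<rho> r S" and L: "finite L" "0 \<notin> L"
  shows "(\<Sum>l\<in>L. 1 / (norm (lat l) * (1 + (p - supp S (lat l))\<^sup>2))) \<le> supp_sum_const \<rho> r"
proof -
  note b = convex_bodyD[OF S]
  define H where "H = (\<lambda>l. supp S (lat l))"
  define T where "T = {v. supp S v < 1}"
  have T: "convex_body (1 / r) (1 / \<rho>) T" unfolding T_def by (rule polar_body[OF S])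
  define K where "K = 4 / \<rho>\<^sup>2 * (2 + 4 * r)\<^sup>2"
  have K: "0 \<le> K" by (simp add: K_def)
  define j where "j = \<lfloor>p\<rfloor>"
  have n1: "1 \<le> norm (lat l)" if "l \<in> L" for l using norm_lat_ge_1[of l] that L by auto
  have H0: "0 < H l" if "l \<in> L" for l
    using norm_le_supp[OF S, of "lat l"] n1[OF that] b(3) by (smt (verit) H_def mult_pos_pos)
  define A where "A = (\<lambda>n. {l \<in> L. nat \<lfloor>H l\<rfloor> = n})"
  have inT: "lat l \<in> (\<lambda>x. c *\<^sub>R x) ` T \<longleftrightarrow> H l < c" if "0 < c" for c l
  proof -
    have "lat l \<in> (\<lambda>x. c *\<^sub>R x) ` T \<longleftrightarrow> (1 / c) *\<^sub>R lat l \<in> T"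
      using that by (auto intro!: image_eqI[where x="(1 / c) *\<^sub>R lat l"])
    also have "\<dots> \<longleftrightarrow> H l < c" using that by (simp add: T_def H_def supp_scale[OF b(6,7)])
    finally show ?thesis .
  qed
  have cA: "real (card (A n)) \<le> K * 2 * (real n + 2)" for n
  proof -
    have "finite {p. lat p \<in> (\<lambda>x. (real n + 1) *\<^sub>R x) ` T \<and> (real n = 0 \<or> lat p \<notin> (\<lambda>x. real n *\<^sub>R x) ` T)}"
      using finite_lat_bounded[OF bounded_scaled[OF convex_bodyD(6)[OF T], of "real n + 1"]] by (rule rev_finite_subset) auto
    moreover have "A n \<subseteq> {p. lat p \<in> (\<lambda>x. (real n + 1) *\<^sub>R x) ` T \<and> (real n = 0 \<or> lat p \<notin> (\<lambda>x. real n *\<^sub>R x) ` T)}"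
    proof
      fix l assume l: "l \<in> A n"
      then have "0 < H l" using H0 by (auto simp: A_def)
      then have "real n \<le> H l" "H l < real n + 1" using l by (auto simp: A_def)
      then show "l \<in> {p. lat p \<in> (\<lambda>x. (real n + 1) *\<^sub>R x) ` T \<and> (real n = 0 \<or> lat p \<notin> (\<lambda>x. real n *\<^sub>R x) ` T)}"
        using inT[of "real n + 1" l] inT[of "real n" l] by (cases "n = 0") auto
    qed
    ultimately have "card (A n) \<le> card {p. lat p \<in> (\<lambda>x. (real n + 1) *\<^sub>R x) ` T \<and> (real n = 0 \<or> lat p \<notin> (\<lambda>x. real n *\<^sub>R x) ` T)}"
      by (intro card_mono)
    then have "real (card (A n)) \<le> 4 * (1 / \<rho>)\<^sup>2 * (2 + 4 / (1 / r))\<^sup>2 * (real n + 1 - real n + 1) * (real n + 1 + 1)"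
      using shell_count[OF T, of "real n" "real n + 1"] by simp
    then show ?thesis by (simp add: K_def power_divide add.commute)
  qed
  have tb: "1 / (norm (lat l) * (1 + (p - H l)\<^sup>2)) \<le> (2 + 3 * r) / (real n + 2) * (3 / (1 + (real_of_int (j - int n))\<^sup>2))" if "l \<in> A n" for l n
  proof -
    have l: "l \<in> L" using that by (auto simp: A_def)
    have nH: "real n \<le> H l" "H l < real n + 1" using that H0[OF l] by (auto simp: A_def)
    have Hr: "H l \<le> r * norm (lat l)" unfolding H_def by (rule supp_le_norm[OF S])
    have "real n + 2 \<le> (2 + 3 * r) * norm (lat l)"
    proof -
      have "(2 + 3 * r) * norm (lat l) = 2 * norm (lat l) + 3 * (r * norm (lat l))" by (simp add: algebra_simps)
      then show ?thesis using n1[OF l] nH(1) Hr by linarith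
    qed
    then have "(real n + 2) * 1 \<le> (2 + 3 * r) * norm (lat l)" by simp
    then have 1: "1 / norm (lat l) \<le> (2 + 3 * r) / (real n + 2)" using n1[OF l] by (subst frac_le_eq) (auto simp: divide_le_0_iff mult.commute)
    define d where "d = \<bar>p - H l\<bar>"
    \<comment> \<open>Rounding down both \<open>p\<close> and \<open>H l\<close> changes their
      distance by at most 1, which costs the factor 3 below.\<close>
    have "\<bar>real_of_int (j - int n)\<bar> \<le> d + 1" unfolding j_def d_def using nH by linarith
    then have "(real_of_int (j - int n))\<^sup>2 \<le> (d + 1)\<^sup>2" by (metis abs_le_square_iff abs_of_nonneg abs_ge_zero d_def add_nonneg_nonneg zero_le_one)
    also have "\<dots> \<le> 2 * d\<^sup>2 + 2" using zero_le_power2[of "d - 1"] by (simp add: power2_eq_square algebra_simps)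
    finally have "1 + (real_of_int (j - int n))\<^sup>2 \<le> 3 * (1 + (p - H l)\<^sup>2)"
      by (simp add: d_def) (smt (verit) zero_le_power2)
    then have 2: "1 / (1 + (p - H l)\<^sup>2) \<le> 3 / (1 + (real_of_int (j - int n))\<^sup>2)"
      by (simp add: divide_simps add_pos_nonneg mult.commute)
    have "1 / (norm (lat l) * (1 + (p - H l)\<^sup>2)) = 1 / norm (lat l) * (1 / (1 + (p - H l)\<^sup>2))" by simp
    also have "\<dots> \<le> (2 + 3 * r) / (real n + 2) * (3 / (1 + (real_of_int (j - int n))\<^sup>2))"
      using b(10) by (intro mult_mono 1 2) auto
    finally show ?thesis .
  qed
  define N where "N = (\<lambda>l. nat \<lfloor>H l\<rfloor>) ` L"
  have "(\<Sum>l\<in>L. 1 / (norm (lat l) * (1 + (p - H l)\<^sup>2))) = (\<Sum>n\<in>N. \<Sum>l\<in>A n. 1 / (norm (lat l) * (1 + (p - H l)\<^sup>2)))"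
    unfolding A_def using L by (intro sum.group[symmetric]) (auto simp: N_def)
  also have "\<dots> \<le> (\<Sum>n\<in>N. 2 * K * (2 + 3 * r) * 3 * (1 / (1 + (real_of_int (j - int n))\<^sup>2)))"
  proof (rule sum_mono)
    fix n
    define z where "z = 3 / (1 + (real_of_int (j - int n))\<^sup>2)"
    have z: "0 \<le> z" by (simp add: z_def)
    have "(\<Sum>l\<in>A n. 1 / (norm (lat l) * (1 + (p - H l)\<^sup>2))) \<le> (\<Sum>l\<in>A n. (2 + 3 * r) / (real n + 2) * z)"
      unfolding z_def by (intro sum_mono tb)
    also have "\<dots> = real (card (A n)) * ((2 + 3 * r) / (real n + 2) * z)" by simp
    also have "\<dots> \<le> (K * 2 * (real n + 2)) * ((2 + 3 * r) / (real n + 2) * z)"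
      using b(10) z by (intro mult_right_mono cA) auto
    also have "\<dots> = 2 * K * (2 + 3 * r) * z" by (simp add: field_simps)
    finally show "(\<Sum>l\<in>A n. 1 / (norm (lat l) * (1 + (p - H l)\<^sup>2))) \<le> 2 * K * (2 + 3 * r) * 3 * (1 / (1 + (real_of_int (j - int n))\<^sup>2))"
      by (simp add: z_def)
  qed
  also have "\<dots> = 2 * K * (2 + 3 * r) * 3 * (\<Sum>n\<in>N. 1 / (1 + (real_of_int (j - int n))\<^sup>2))" by (simp only: sum_distrib_left)
  also have "(\<Sum>n\<in>N. 1 / (1 + (real_of_int (j - int n))\<^sup>2)) = (\<Sum>i\<in>(\<lambda>n. j - int n) ` N. 1 / (1 + (real_of_int i)\<^sup>2))"
    by (subst sum.reindex) (auto simp: inj_on_def)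
  also have "2 * K * (2 + 3 * r) * 3 * \<dots> \<le> 2 * K * (2 + 3 * r) * 3 * 5"
    using L K b(10) by (intro mult_left_mono sum_inverse_square_int) (auto simp: N_def)
  finally show ?thesis by (simp add: H_def K_def supp_sum_const_def)
qed

subsection \<open>A quadratic form estimate\<close>

text \<open>A quartic bump vanishing to second order at both ends of its support, so that two
  integrations by parts leave no boundary terms. It is at least 1 on a central interval of length 3,
  which holds a unit interval displaced by up to 1 to either side.\<close>

definition window :: "real \<Rightarrow> real \<Rightarrow> real" where
  "window T t = indicator {T - 2..T + 2} t * (4 - (t - T)\<^sup>2)\<^sup>2"

lemma window_bounds: "0 \<le> window T t" "window T t \<le> 16 * indicator {T - 2..T + 2} t"
proof -
  show "0 \<le> window T t" by (simp add: window_def)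
  show "window T t \<le> 16 * indicator {T - 2..T + 2} t"
  proof (cases "t \<in> {T - 2..T + 2}")
    case True
    then have "(t - T)\<^sup>2 \<le> 2\<^sup>2" by (intro power2_le_iff_abs_le[THEN iffD2]) auto
    then have "\<bar>4 - (t - T)\<^sup>2\<bar> \<le> 4" by simp
    then have "(4 - (t - T)\<^sup>2)\<^sup>2 \<le> 4\<^sup>2" by (intro power2_le_iff_abs_le[THEN iffD2]) auto
    then show ?thesis using True by (simp add: window_def)
  qed (simp add: window_def)
qed

lemma window_ge_1:
  assumes "\<bar>t - T\<bar> \<le> 3 / 2"
  shows "1 \<le> window T t"
proof -
  have "(t - T)\<^sup>2 \<le> (3 / 2)\<^sup>2" using assms by (intro power2_le_iff_abs_le[THEN iffD2]) auto
  then have "1 \<le> 4 - (t - T)\<^sup>2" by (simp add: power2_eq_square)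
  then have "1\<^sup>2 \<le> (4 - (t - T)\<^sup>2)\<^sup>2" by (intro power_mono) auto
  moreover have "t \<in> {T - 2..T + 2}" using assms unfolding atLeastAtMost_iff by linarith
  ultimately show ?thesis by (simp add: window_def)
qed

lemma window_measurable [measurable]: "window T \<in> borel_measurable borel"
  unfolding window_def[abs_def] by measurable

lemma window_integrable: "integrable lborel (window T)"
proof (rule Bochner_Integration.integrable_bound[where f="\<lambda>t. 16 * indicator {T - 2..T + 2} t :: real"])
  show "AE t in lborel. norm (window T t) \<le> norm (16 * indicator {T - 2..T + 2} t :: real)"
    using window_bounds by (intro AE_I2) simp
qed (auto intro!: integrable_mult_right integrable_real_indicator simp: emeasure_lborel_Icc_eq)

lemma window_fourier: "\<bar>\<integral>t. window T t * cos (t * u) \<partial>lborel\<bar> \<le> 256 / (1 + u\<^sup>2)"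
proof (cases "\<bar>u\<bar> < 1")
  case True
  have "\<bar>\<integral>t. window T t * cos (t * u) \<partial>lborel\<bar> \<le> (\<integral>t. 16 * indicator {T - 2..T + 2} t \<partial>lborel)"
  proof (rule order_trans[OF integral_abs_bound], rule integral_mono')
    show "integrable lborel (\<lambda>t. 16 * indicator {T - 2..T + 2} t :: real)"
      by (auto intro!: integrable_mult_right integrable_real_indicator simp: emeasure_lborel_Icc_eq)
    fix t
    have "\<bar>window T t * cos (t * u)\<bar> \<le> window T t * 1"
      using window_bounds(1) by (simp add: abs_mult mult_left_le abs_cos_le_one)
    also have "\<dots> \<le> 16 * indicator {T - 2..T + 2} t" using window_bounds(2) by simp
    finally show "\<bar>window T t * cos (t * u)\<bar> \<le> 16 * indicator {T - 2..T + 2} t" .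
  qed auto
  also have "\<dots> = 64" by simp
  also have "64 \<le> 256 / (1 + u\<^sup>2)"
  proof -
    have "u\<^sup>2 < 1" using True by (simp add: abs_square_less_1)
    then show ?thesis by (simp add: divide_simps add_pos_nonneg)
  qed
  finally show ?thesis .
next
  case False
  then have u: "u \<noteq> 0" "1 \<le> u\<^sup>2" by (auto simp: abs_square_le_1 not_less power2_eq_square) (metis False abs_square_less_1 linorder_not_less power2_eq_square)
  define f where "f = (\<lambda>t. (4 - (t - T)\<^sup>2)\<^sup>2 * cos (t * u))"
  define g where "g = (\<lambda>t. (12 * (t - T)\<^sup>2 - 16) * cos (t * u) / u\<^sup>2)"
  define c1 c2 where "c1 = 1 / u" and "c2 = 1 / u\<^sup>2"
  have c: "u * c1 = 1" "u * c2 = c1" "c2 = inverse (u\<^sup>2)" using u(1) by (auto simp: c1_def c2_def power2_eq_square inverse_eq_divide)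
  \<comment> \<open>With \<open>w\<close> the quartic bump, \<open>F\<close> is
    \<open>w * sin / u + w' * cos / u^2\<close>, a primitive of \<open>f + g\<close> where
    \<open>g = w'' * cos / u^2\<close>. Both \<open>w\<close> and \<open>w'\<close> vanish at the
    ends, so the integrals of \<open>f\<close> and \<open>- g\<close> agree; this is integration by
    parts done twice.\<close>
  define F where "F = (\<lambda>t. (4 - (t - T)\<^sup>2)\<^sup>2 * sin (t * u) * c1 + (4 * (t - T) ^ 3 - 16 * (t - T)) * cos (t * u) * c2)"
  have alg: "2 * (4 - y\<^sup>2) * (- (2 * y)) * S * c1 + (4 - y\<^sup>2)\<^sup>2 * (C * u) * c1 + (12 * y\<^sup>2 - 16) * C * c2 + (4 * y ^ 3 - 16 * y) * (- S * u) * c2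
     = (4 - y\<^sup>2)\<^sup>2 * C + (12 * y\<^sup>2 - 16) * C * c2" for y S C
    using c(1,2) by algebra
  have "((\<lambda>t. f t + g t) has_integral (F (T + 2) - F (T - 2))) {T - 2..T + 2}"
  proof (rule fundamental_theorem_of_calculus)
    fix t :: real
    show "(F has_vector_derivative f t + g t) (at t within {T - 2..T + 2})"
    proof -
      have "(F has_real_derivative 2 * (4 - (t - T)\<^sup>2) * (- (2 * (t - T))) * sin (t * u) * c1 + (4 - (t - T)\<^sup>2)\<^sup>2 * (cos (t * u) * u) * c1
         + (12 * (t - T)\<^sup>2 - 16) * cos (t * u) * c2 + (4 * (t - T) ^ 3 - 16 * (t - T)) * (- sin (t * u) * u) * c2) (at t within {T - 2..T + 2})"
        unfolding F_def by (auto intro!: derivative_eq_intros simp: algebra_simps)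
      then show ?thesis
        unfolding alg has_real_derivative_iff_has_vector_derivative[symmetric] f_def g_def by (simp add: c2_def)
    qed
  qed simp
  moreover have "F (T + 2) = 0" "F (T - 2) = 0" by (simp_all add: F_def)
  ultimately have fg: "((\<lambda>t. f t + g t) has_integral 0) {T - 2..T + 2}" by simp
  have sf: "set_integrable lborel {T - 2..T + 2} f" and sg: "set_integrable lborel {T - 2..T + 2} g"
    unfolding f_def g_def by (intro borel_integrable_atLeastAtMost' continuous_intros; use u in simp)+
  have "(LINT t:{T - 2..T + 2}|lborel. f t) + (LINT t:{T - 2..T + 2}|lborel. g t) = (LINT t:{T - 2..T + 2}|lborel. f t + g t)"
    using sf sg by simp
  also have "\<dots> = 0" using set_borel_integral_eq_integral(2)[of "{T - 2..T + 2}" "\<lambda>t. f t + g t"] sf sg integral_unique[OF fg] by simp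
  finally have eq: "(LINT t:{T - 2..T + 2}|lborel. f t) = - (LINT t:{T - 2..T + 2}|lborel. g t)" by simp
  have "(\<integral>t. window T t * cos (t * u) \<partial>lborel) = (LINT t:{T - 2..T + 2}|lborel. f t)"
    unfolding set_lebesgue_integral_def by (intro Bochner_Integration.integral_cong) (auto simp: window_def f_def)
  then have "\<bar>\<integral>t. window T t * cos (t * u) \<partial>lborel\<bar> = \<bar>\<integral>t. indicator {T - 2..T + 2} t * g t \<partial>lborel\<bar>"
    unfolding eq by (simp add: set_lebesgue_integral_def)
  also have "\<dots> \<le> (\<integral>t. (32 / u\<^sup>2) * indicator {T - 2..T + 2} t \<partial>lborel)"
  proof (rule order_trans[OF integral_abs_bound], rule integral_mono')
    show "integrable lborel (\<lambda>t. (32 / u\<^sup>2) * indicator {T - 2..T + 2} t :: real)"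
      by (auto intro!: integrable_mult_right integrable_real_indicator simp: emeasure_lborel_Icc_eq)
    fix t
    show "\<bar>indicator {T - 2..T + 2} t * g t\<bar> \<le> 32 / u\<^sup>2 * indicator {T - 2..T + 2} t"
    proof (cases "t \<in> {T - 2..T + 2}")
      case True
      then have "(t - T)\<^sup>2 \<le> 2\<^sup>2" by (intro power2_le_iff_abs_le[THEN iffD2]) auto
      moreover have "\<bar>12 * a - 16\<bar> \<le> 32" if "0 \<le> a" "a \<le> 2\<^sup>2" for a :: real using that by simp
      ultimately have "\<bar>12 * (t - T)\<^sup>2 - 16\<bar> \<le> 32" using zero_le_power2 by blast
      then have "\<bar>12 * (t - T)\<^sup>2 - 16\<bar> * \<bar>cos (t * u)\<bar> \<le> 32 * 1" by (intro mult_mono) auto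
      then have "\<bar>g t\<bar> \<le> 32 / u\<^sup>2" unfolding g_def by (simp add: abs_mult divide_right_mono)
      then show ?thesis using True by simp
    qed simp
  qed (use u in auto)
  also have "\<dots> = 128 / u\<^sup>2" by simp
  also have "\<dots> \<le> 256 / (1 + u\<^sup>2)" using u by (simp add: divide_simps add_pos_nonneg)
  finally show ?thesis .
qed

lemma integrable_pair_bounded:
  fixes f g :: "real \<Rightarrow> real" and h :: "real \<times> real \<Rightarrow> real"
  assumes f: "integrable lborel f" and g: "integrable lborel g" and h: "h \<in> borel_measurable (lborel \<Otimes>\<^sub>M lborel)" "\<And>x y. \<bar>h (x, y)\<bar> \<le> B"
  shows "integrable (lborel \<Otimes>\<^sub>M lborel) (\<lambda>(x, y). f x * g y * h (x, y))"
proof (rule integrableI_bounded)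
  have [measurable]: "f \<in> borel_measurable borel" "g \<in> borel_measurable borel" using f g by (auto dest: borel_measurable_integrable)
  note h(1)[measurable]
  have B: "0 \<le> B" using h(2)[of 0 0] by linarith
  show "(\<lambda>(x, y). f x * g y * h (x, y)) \<in> borel_measurable (lborel \<Otimes>\<^sub>M lborel)" by measurable
  have "(\<integral>\<^sup>+p. ennreal (norm (case p of (x, y) \<Rightarrow> f x * g y * h (x, y))) \<partial>(lborel \<Otimes>\<^sub>M lborel))
     \<le> (\<integral>\<^sup>+p. ennreal \<bar>f (fst p)\<bar> * (ennreal \<bar>g (snd p)\<bar> * ennreal B) \<partial>(lborel \<Otimes>\<^sub>M lborel))"
  proof (rule nn_integral_mono)
    fix p :: "real \<times> real"
    obtain x y where p: "p = (x, y)" by (cases p)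
    have "\<bar>f x * g y * h (x, y)\<bar> \<le> \<bar>f x\<bar> * (\<bar>g y\<bar> * B)" using h(2)[of x y] by (simp add: abs_mult mult_left_mono mult.assoc)
    then have "ennreal \<bar>f x * g y * h (x, y)\<bar> \<le> ennreal (\<bar>f x\<bar> * (\<bar>g y\<bar> * B))" by (rule ennreal_leI)
    then show "ennreal (norm (case p of (x, y) \<Rightarrow> f x * g y * h (x, y))) \<le> ennreal \<bar>f (fst p)\<bar> * (ennreal \<bar>g (snd p)\<bar> * ennreal B)"
      using B by (simp add: p ennreal_mult)
  qed
  also have "\<dots> = (\<integral>\<^sup>+x. \<integral>\<^sup>+y. ennreal \<bar>f x\<bar> * (ennreal \<bar>g y\<bar> * ennreal B) \<partial>lborel \<partial>lborel)"
    by (subst lborel.nn_integral_fst[symmetric]) auto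
  also have "\<dots> = (\<integral>\<^sup>+x. ennreal \<bar>f x\<bar> \<partial>lborel) * ((\<integral>\<^sup>+y. ennreal \<bar>g y\<bar> \<partial>lborel) * ennreal B)"
    by (simp add: nn_integral_cmult nn_integral_multc)
  also have "\<dots> < \<infinity>"
    using f g unfolding integrable_iff_bounded by (simp add: ennreal_mult_less_top)
  finally show "(\<integral>\<^sup>+p. ennreal (norm (case p of (x, y) \<Rightarrow> f x * g y * h (x, y))) \<partial>(lborel \<Otimes>\<^sub>M lborel)) < \<infinity>" .
qed

lemma integral_swap_bounded:
  fixes f g :: "real \<Rightarrow> real" and h :: "real \<times> real \<Rightarrow> real"
  assumes f: "integrable lborel f" and g: "integrable lborel g" and h: "h \<in> borel_measurable (lborel \<Otimes>\<^sub>M lborel)" "\<And>x y. \<bar>h (x, y)\<bar> \<le> B"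
  shows "(\<integral>x. f x * (\<integral>y. g y * h (x, y) \<partial>lborel) \<partial>lborel) = (\<integral>y. g y * (\<integral>x. f x * h (x, y) \<partial>lborel) \<partial>lborel)"
    and "integrable lborel (\<lambda>x. f x * (\<integral>y. g y * h (x, y) \<partial>lborel))"
proof -
  note i = integrable_pair_bounded[OF assms]
  have "(\<integral>x. (\<integral>y. f x * g y * h (x, y) \<partial>lborel) \<partial>lborel) = (\<integral>y. (\<integral>x. f x * g y * h (x, y) \<partial>lborel) \<partial>lborel)"
    using lborel_pair.Fubini_integral[OF i] by simp
  moreover have "(\<integral>y. f x * g y * h (x, y) \<partial>lborel) = f x * (\<integral>y. g y * h (x, y) \<partial>lborel)" for x
    by (subst integral_mult_right_zero[symmetric]) (simp add: mult_ac)
  moreover have "(\<integral>x. f x * g y * h (x, y) \<partial>lborel) = g y * (\<integral>x. f x * h (x, y) \<partial>lborel)" for y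
    by (subst integral_mult_right_zero[symmetric]) (simp add: mult_ac)
  ultimately show "(\<integral>x. f x * (\<integral>y. g y * h (x, y) \<partial>lborel) \<partial>lborel) = (\<integral>y. g y * (\<integral>x. f x * h (x, y) \<partial>lborel) \<partial>lborel)" by simp
  have "integrable lborel (\<lambda>x. \<integral>y. f x * g y * h (x, y) \<partial>lborel)" using lborel_pair.integrable_fst'[OF i] by simp
  then show "integrable lborel (\<lambda>x. f x * (\<integral>y. g y * h (x, y) \<partial>lborel))" 
    using \<open>\<And>x. (\<integral>y. f x * g y * h (x, y) \<partial>lborel) = f x * (\<integral>y. g y * h (x, y) \<partial>lborel)\<close> by simp
qed


section \<open>Real Fourier transforms and their correlations under the window\<close>

definition ctrans :: "(real \<Rightarrow> real) \<Rightarrow> real \<Rightarrow> real" where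
  "ctrans f t = (\<integral>x. f x * cos (2 * pi * t * x) \<partial>lborel)"

definition strans :: "(real \<Rightarrow> real) \<Rightarrow> real \<Rightarrow> real" where
  "strans f t = (\<integral>x. f x * sin (2 * pi * t * x) \<partial>lborel)"

lemma trans_integrable:
  fixes f :: "real \<Rightarrow> real"
  assumes "integrable lborel f"
  shows "integrable lborel (\<lambda>x. f x * cos (c * x))" "integrable lborel (\<lambda>x. f x * sin (c * x))"
    "integrable lborel (\<lambda>x. f x * cos (a - c * x))"
proof -
  have [measurable]: "f \<in> borel_measurable borel" using assms by (auto dest: borel_measurable_integrable)
  show "integrable lborel (\<lambda>x. f x * cos (c * x))" "integrable lborel (\<lambda>x. f x * sin (c * x))"
    "integrable lborel (\<lambda>x. f x * cos (a - c * x))"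
    by (rule Bochner_Integration.integrable_bound[OF assms]; simp add: abs_mult mult_left_le)+
qed

text \<open>The left side is the real part of one Fourier transform times the conjugate of the
  other. Including the sine terms makes the kernel depend on \<open>x - y\<close> alone.\<close>

lemma trans_pair:
  assumes f: "integrable lborel f" and g: "integrable lborel g"
  shows "ctrans f t * ctrans g t + strans f t * strans g t = (\<integral>x. f x * (\<integral>y. g y * cos (2 * pi * t * (x - y)) \<partial>lborel) \<partial>lborel)"
proof -
  have "(\<integral>y. g y * cos (2 * pi * t * (x - y)) \<partial>lborel) = cos (2 * pi * t * x) * ctrans g t + sin (2 * pi * t * x) * strans g t" for x
  proof -
    have "(\<integral>y. g y * cos (2 * pi * t * (x - y)) \<partial>lborel) 
      = (\<integral>y. cos (2 * pi * t * x) * (g y * cos (2 * pi * t * y)) + sin (2 * pi * t * x) * (g y * sin (2 * pi * t * y)) \<partial>lborel)"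
      by (intro Bochner_Integration.integral_cong refl) (simp add: right_diff_distrib cos_diff distrib_left mult_ac)
    also have "\<dots> = cos (2 * pi * t * x) * ctrans g t + sin (2 * pi * t * x) * strans g t"
      unfolding ctrans_def strans_def using trans_integrable[OF g] by simp
    finally show ?thesis .
  qed
  then have "(\<integral>x. f x * (\<integral>y. g y * cos (2 * pi * t * (x - y)) \<partial>lborel) \<partial>lborel)
    = (\<integral>x. ctrans g t * (f x * cos (2 * pi * t * x)) + strans g t * (f x * sin (2 * pi * t * x)) \<partial>lborel)"
    by (simp add: distrib_left mult_ac)
  also have "\<dots> = ctrans g t * ctrans f t + strans g t * strans f t"
    unfolding ctrans_def strans_def using trans_integrable[OF f] by simp
  finally show ?thesis by (simp add: mult.commute)
qed

lemma trans_bound: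
  fixes f h :: "real \<Rightarrow> real"
  assumes f: "integrable lborel f" and h: "\<And>x. \<bar>h x\<bar> \<le> B"
  shows "\<bar>\<integral>x. f x * h x \<partial>lborel\<bar> \<le> (\<integral>x. \<bar>f x\<bar> \<partial>lborel) * B"
proof -
  have B: "0 \<le> B" using h[of 0] by linarith
  have "\<bar>\<integral>x. f x * h x \<partial>lborel\<bar> \<le> (\<integral>x. \<bar>f x\<bar> * B \<partial>lborel)"
    by (rule order_trans[OF integral_abs_bound], rule integral_mono') (use f h B in \<open>auto simp: abs_mult intro!: mult_left_mono\<close>)
  then show ?thesis by simp
qed

text \<open>Integrating over \<open>t\<close> first replaces the kernel by the transform of the
  window at \<open>x - y\<close>, which decays quadratically. As \<open>f\<close> and
  \<open>g\<close> live within distance 1 of \<open>p\<close> and \<open>q\<close>, the argument can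
  be exchanged for \<open>p - q\<close>; this costs the 9 in \<open>2304 = 9 * 256\<close>.\<close>

lemma window_pair_bound:
  assumes f: "integrable lborel f" and g: "integrable lborel g"
    and fp: "\<And>x. f x \<noteq> 0 \<Longrightarrow> \<bar>x - p\<bar> \<le> 1" and gq: "\<And>x. g x \<noteq> 0 \<Longrightarrow> \<bar>x - q\<bar> \<le> 1"
  shows "integrable lborel (\<lambda>t. window T t * (ctrans f t * ctrans g t + strans f t * strans g t))"
    and "\<bar>\<integral>t. window T t * (ctrans f t * ctrans g t + strans f t * strans g t) \<partial>lborel\<bar>
      \<le> 2304 * ((\<integral>x. \<bar>f x\<bar> \<partial>lborel) * (\<integral>x. \<bar>g x\<bar> \<partial>lborel) / (1 + (p - q)\<^sup>2))"
proof -
  have fm[measurable]: "f \<in> borel_measurable borel" and gm[measurable]: "g \<in> borel_measurable borel" using f g by (auto dest: borel_measurable_integrable)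
  define h where "h = (\<lambda>p. \<integral>y. g y * cos (2 * pi * fst p * (snd p - y)) \<partial>lborel)"
  have hm: "h \<in> borel_measurable (lborel \<Otimes>\<^sub>M lborel)" unfolding h_def by measurable
  have hb: "\<bar>h (t, x)\<bar> \<le> (\<integral>x. \<bar>g x\<bar> \<partial>lborel)" for t x
    unfolding h_def using trans_bound[OF g, of "\<lambda>y. cos (2 * pi * t * (x - y))" 1] by simp
  note s = integral_swap_bounded[OF window_integrable[of T] f hm hb]
  have e: "window T t * (ctrans f t * ctrans g t + strans f t * strans g t) = window T t * (\<integral>x. f x * h (t, x) \<partial>lborel)" for t
    by (simp add: trans_pair[OF f g] h_def)
  show "integrable lborel (\<lambda>t. window T t * (ctrans f t * ctrans g t + strans f t * strans g t))"
    unfolding e by (rule s(2))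
  define K where "K = (\<lambda>v. \<integral>t. window T t * cos (t * (2 * pi * v)) \<partial>lborel)"
  have sw: "(\<integral>t. window T t * h (t, x) \<partial>lborel) = (\<integral>y. g y * K (x - y) \<partial>lborel)" for x
  proof -
    have "(\<integral>t. window T t * (\<integral>y. g y * (\<lambda>p. cos (2 * pi * fst p * (x - snd p))) (t, y) \<partial>lborel) \<partial>lborel)
      = (\<integral>y. g y * (\<integral>t. window T t * (\<lambda>p. cos (2 * pi * fst p * (x - snd p))) (t, y) \<partial>lborel) \<partial>lborel)"
      by (rule integral_swap_bounded(1)[OF window_integrable g, where B=1]) auto
    then show ?thesis by (simp add: h_def K_def mult_ac)
  qed
  have Kb: "\<bar>K (x - y)\<bar> \<le> 2304 / (1 + (p - q)\<^sup>2)" if "\<bar>x - p\<bar> \<le> 1" "\<bar>y - q\<bar> \<le> 1" for x y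
  proof -
    define v where "v = \<bar>x - y\<bar>"
    have "\<bar>p - q\<bar> \<le> v + 2" using that by (simp add: v_def)
    then have "(p - q)\<^sup>2 \<le> (v + 2)\<^sup>2" by (metis abs_ge_zero power2_abs power_mono)
    also have "\<dots> \<le> 2 * v\<^sup>2 + 8" using zero_le_power2[of "v - 2"] by (simp add: power2_eq_square algebra_simps)
    finally have pq: "(p - q)\<^sup>2 \<le> 2 * v\<^sup>2 + 8" .
    have "1 + a \<le> 9 * (1 + b)" if "a \<le> 2 * b + 8" "0 \<le> b" for a b :: real using that by simp
    from this[OF pq zero_le_power2] have 1: "1 + (p - q)\<^sup>2 \<le> 9 * (1 + v\<^sup>2)" .
    have "v * 1 \<le> v * (2 * pi)" using pi_gt3 by (intro mult_left_mono) (auto simp: v_def)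
    then have "v\<^sup>2 \<le> (v * (2 * pi))\<^sup>2" by (intro power_mono) (auto simp: v_def)
    also have "(v * (2 * pi))\<^sup>2 = (2 * pi * (x - y))\<^sup>2" by (simp add: v_def power_mult_distrib mult.commute)
    finally have 2: "1 + (p - q)\<^sup>2 \<le> 9 * (1 + (2 * pi * (x - y))\<^sup>2)"
      by (intro order_trans[OF 1] mult_left_mono add_left_mono) auto
    have "256 / a = 2304 / (9 * a)" for a :: real by simp
    note this[of "1 + (2 * pi * (x - y))\<^sup>2"]
    moreover have "\<bar>K (x - y)\<bar> \<le> 256 / (1 + (2 * pi * (x - y))\<^sup>2)" unfolding K_def by (rule window_fourier)
    ultimately have "\<bar>K (x - y)\<bar> \<le> 2304 / (9 * (1 + (2 * pi * (x - y))\<^sup>2))" by (simp only:)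
    also have "\<dots> \<le> 2304 / (1 + (p - q)\<^sup>2)" using 2 by (intro divide_left_mono) (auto intro!: mult_pos_pos add_pos_nonneg)
    finally show ?thesis .
  qed
  have gb: "\<bar>\<integral>y. g y * K (x - y) \<partial>lborel\<bar> \<le> (\<integral>x. \<bar>g x\<bar> \<partial>lborel) * (2304 / (1 + (p - q)\<^sup>2))" if "\<bar>x - p\<bar> \<le> 1" for x
  proof -
    \<comment> \<open>Setting the kernel to 0 where \<open>g\<close> vanishes anyway provides the
      bound at all points that \<open>trans_bound\<close> asks for.\<close>
    have "(\<integral>y. g y * K (x - y) \<partial>lborel) = (\<integral>y. g y * (if \<bar>y - q\<bar> \<le> 1 then K (x - y) else 0) \<partial>lborel)"
      using gq by (intro Bochner_Integration.integral_cong) auto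
    also have "\<bar>\<dots>\<bar> \<le> (\<integral>x. \<bar>g x\<bar> \<partial>lborel) * (2304 / (1 + (p - q)\<^sup>2))"
      using Kb[OF that] by (intro trans_bound[OF g]) (auto simp: add_nonneg_nonneg)
    finally show ?thesis .
  qed
  have "(\<integral>t. window T t * (ctrans f t * ctrans g t + strans f t * strans g t) \<partial>lborel) = (\<integral>x. f x * (\<integral>y. g y * K (x - y) \<partial>lborel) \<partial>lborel)"
    unfolding e s(1) sw ..
  also have "\<dots> = (\<integral>x. f x * (if \<bar>x - p\<bar> \<le> 1 then (\<integral>y. g y * K (x - y) \<partial>lborel) else 0) \<partial>lborel)"
    using fp by (intro Bochner_Integration.integral_cong) auto
  also have "\<bar>\<dots>\<bar> \<le> (\<integral>x. \<bar>f x\<bar> \<partial>lborel) * ((\<integral>x. \<bar>g x\<bar> \<partial>lborel) * (2304 / (1 + (p - q)\<^sup>2)))"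
    using gb by (intro trans_bound[OF f]) (auto intro!: mult_nonneg_nonneg divide_nonneg_nonneg)
  finally show "\<bar>\<integral>t. window T t * (ctrans f t * ctrans g t + strans f t * strans g t) \<partial>lborel\<bar>
      \<le> 2304 * ((\<integral>x. \<bar>f x\<bar> \<partial>lborel) * (\<integral>x. \<bar>g x\<bar> \<partial>lborel) / (1 + (p - q)\<^sup>2))" by (simp add: mult_ac)
qed

lemma weighted_am_gm:
  fixes a b m n :: real
  assumes "0 < m" "0 < n"
  shows "2 * (a * b) \<le> m * a\<^sup>2 / n + n * b\<^sup>2 / m"
proof -
  have "m * a\<^sup>2 / n + n * b\<^sup>2 / m - 2 * (a * b) = (m * a - n * b)\<^sup>2 / (m * n)"
    using assms by (simp add: field_simps power2_eq_square)
  moreover have "0 \<le> (m * a - n * b)\<^sup>2 / (m * n)" using assms by simp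
  ultimately show ?thesis by linarith
qed

text \<open>The weights \<open>norm k / norm l\<close> in the arithmetic-geometric mean inequality make the far away frequencies summable:
  without them the sum over \<open>l\<close> would diverge logarithmically.\<close>

lemma quadratic_form_bound:
  assumes S: "convex_body \<rho> r S" and L: "finite L" "0 \<notin> L"
    and \<phi>: "\<And>k. k \<in> L \<Longrightarrow> integrable lborel (\<phi> k)"
    and loc: "\<And>k x. k \<in> L \<Longrightarrow> \<phi> k x \<noteq> 0 \<Longrightarrow> \<bar>x - supp S (lat k)\<bar> \<le> 1"
  shows "(\<integral>\<^sup>+t. ennreal (indicator {T - 3/2..T + 3/2} t * (\<Sum>k\<in>L. ctrans (\<phi> k) t)\<^sup>2) \<partial>lborel)
    \<le> ennreal (2304 * supp_sum_const \<rho> r * (\<Sum>k\<in>L. norm (lat k) * (\<integral>x. \<bar>\<phi> k x\<bar> \<partial>lborel)\<^sup>2))"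
proof -
  define b where "b = (\<lambda>k. \<integral>x. \<bar>\<phi> k x\<bar> \<partial>lborel)"
  define H where "H = (\<lambda>k. supp S (lat k))"
  define w where "w = (\<lambda>k l. 1 / (1 + (H k - H l)\<^sup>2))"
  define n where "n = (\<lambda>k. norm (lat k))"
  have n: "0 < n k" if "k \<in> L" for k
  proof -
    have "k \<noteq> 0" using that L(2) by metis
    from norm_lat_ge_1[OF this] show ?thesis unfolding n_def by (rule less_le_trans[OF zero_less_one])
  qed
  have w0: "0 \<le> w k l" for k l by (simp add: w_def)
  let ?P = "\<lambda>k l t. window T t * (ctrans (\<phi> k) t * ctrans (\<phi> l) t + strans (\<phi> k) t * strans (\<phi> l) t)"
  have Pi: "integrable lborel (?P k l)" if "k \<in> L" "l \<in> L" for k l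
    by (rule window_pair_bound(1)[OF \<phi>[OF that(1)] \<phi>[OF that(2)] loc loc]) (use that in auto)
  have Pb: "\<bar>\<integral>t. ?P k l t \<partial>lborel\<bar> \<le> 2304 * (b k * b l * w k l)" if "k \<in> L" "l \<in> L" for k l
    using window_pair_bound(2)[OF \<phi>[OF that(1)] \<phi>[OF that(2)] loc[OF that(1)] loc[OF that(2)], of T] by (simp add: b_def w_def H_def)
  \<comment> \<open>The sine sums are carried along so that the double sum is the window times a sum
    of two squares: nonnegative everywhere, and at least the square of the cosine sum where the
    window is at least 1.\<close>
  have sq: "(\<Sum>k\<in>L. \<Sum>l\<in>L. ?P k l t) = window T t * ((\<Sum>k\<in>L. ctrans (\<phi> k) t)\<^sup>2 + (\<Sum>k\<in>L. strans (\<phi> k) t)\<^sup>2)" for t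
  proof -
    have "(\<Sum>k\<in>L. ctrans (\<phi> k) t)\<^sup>2 + (\<Sum>k\<in>L. strans (\<phi> k) t)\<^sup>2
      = (\<Sum>k\<in>L. \<Sum>l\<in>L. ctrans (\<phi> k) t * ctrans (\<phi> l) t + strans (\<phi> k) t * strans (\<phi> l) t)"
      unfolding power2_eq_square sum_product sum.distrib ..
    then show ?thesis by (simp only: sum_distrib_left)
  qed
  have int: "integrable lborel (\<lambda>t. \<Sum>k\<in>L. \<Sum>l\<in>L. ?P k l t)" using Pi by (intro Bochner_Integration.integrable_sum) auto
  have "(\<integral>\<^sup>+t. ennreal (indicator {T - 3/2..T + 3/2} t * (\<Sum>k\<in>L. ctrans (\<phi> k) t)\<^sup>2) \<partial>lborel)
     \<le> (\<integral>\<^sup>+t. ennreal (\<Sum>k\<in>L. \<Sum>l\<in>L. ?P k l t) \<partial>lborel)"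
  proof (intro nn_integral_mono ennreal_leI)
    fix t
    show "indicator {T - 3/2..T + 3/2} t * (\<Sum>k\<in>L. ctrans (\<phi> k) t)\<^sup>2 \<le> (\<Sum>k\<in>L. \<Sum>l\<in>L. ?P k l t)"
    proof (cases "t \<in> {T - 3/2..T + 3/2}")
      case True
      then have "\<bar>t - T\<bar> \<le> 3 / 2" unfolding atLeastAtMost_iff by linarith
      then have "1 \<le> window T t" by (rule window_ge_1)
      then have "1 * ((\<Sum>k\<in>L. ctrans (\<phi> k) t)\<^sup>2 + 0) \<le> window T t * ((\<Sum>k\<in>L. ctrans (\<phi> k) t)\<^sup>2 + (\<Sum>k\<in>L. strans (\<phi> k) t)\<^sup>2)"
        by (intro mult_mono add_mono) auto
      then show ?thesis unfolding sq using True by simp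
    next
      case False
      then show ?thesis unfolding sq using window_bounds(1) by simp
    qed
  qed
  also have "\<dots> = ennreal (\<integral>t. (\<Sum>k\<in>L. \<Sum>l\<in>L. ?P k l t) \<partial>lborel)"
    by (intro nn_integral_eq_integral int AE_I2) (simp add: sq window_bounds(1))
  also have "\<dots> \<le> ennreal (2304 * supp_sum_const \<rho> r * (\<Sum>k\<in>L. n k * (b k)\<^sup>2))"
  proof (rule ennreal_leI)
    have "(\<integral>t. (\<Sum>k\<in>L. \<Sum>l\<in>L. ?P k l t) \<partial>lborel) = (\<Sum>k\<in>L. \<Sum>l\<in>L. \<integral>t. ?P k l t \<partial>lborel)"
      using Pi by (subst Bochner_Integration.integral_sum) (auto intro!: sum.cong Bochner_Integration.integral_sum Bochner_Integration.integrable_sum)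
    also have "\<dots> \<le> (\<Sum>k\<in>L. \<Sum>l\<in>L. 2304 * (b k * b l * w k l))"
      by (intro sum_mono order_trans[OF abs_ge_self Pb])
    also have "\<dots> \<le> (\<Sum>k\<in>L. \<Sum>l\<in>L. 1152 * (n k * (b k)\<^sup>2 * (w k l / n l)) + 1152 * (n l * (b l)\<^sup>2 * (w k l / n k)))"
    proof (intro sum_mono)
      fix k l assume kl: "k \<in> L" "l \<in> L"
      have nn: "0 < n k" "0 < n l" using n kl by auto
      have "2 * (b k * b l) \<le> n k * (b k)\<^sup>2 / n l + n l * (b l)\<^sup>2 / n k" by (rule weighted_am_gm[OF nn])
      then have "1152 * (2 * (b k * b l)) * w k l \<le> 1152 * (n k * (b k)\<^sup>2 / n l + n l * (b l)\<^sup>2 / n k) * w k l"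
        using w0 by (intro mult_right_mono) auto
      then show "2304 * (b k * b l * w k l) \<le> 1152 * (n k * (b k)\<^sup>2 * (w k l / n l)) + 1152 * (n l * (b l)\<^sup>2 * (w k l / n k))"
        by (simp add: algebra_simps)
    qed
    also have "\<dots> = (\<Sum>k\<in>L. \<Sum>l\<in>L. 1152 * (n k * (b k)\<^sup>2 * (w k l / n l))) + (\<Sum>l\<in>L. \<Sum>k\<in>L. 1152 * (n l * (b l)\<^sup>2 * (w k l / n k)))"
      by (simp only: sum.distrib) (rule arg_cong2[where f="(+)", OF refl sum.swap])
    also have "(\<Sum>l\<in>L. \<Sum>k\<in>L. 1152 * (n l * (b l)\<^sup>2 * (w k l / n k))) = (\<Sum>k\<in>L. \<Sum>l\<in>L. 1152 * (n k * (b k)\<^sup>2 * (w k l / n l)))"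
      by (intro sum.cong refl) (simp add: w_def power2_commute)
    also have "(\<Sum>k\<in>L. \<Sum>l\<in>L. 1152 * (n k * (b k)\<^sup>2 * (w k l / n l))) + (\<Sum>k\<in>L. \<Sum>l\<in>L. 1152 * (n k * (b k)\<^sup>2 * (w k l / n l)))
       = 2304 * (\<Sum>k\<in>L. n k * (b k)\<^sup>2 * (\<Sum>l\<in>L. w k l / n l))"
      by (simp add: sum_distrib_left mult_ac)
    also have "\<dots> \<le> 2304 * (\<Sum>k\<in>L. n k * (b k)\<^sup>2 * supp_sum_const \<rho> r)"
    proof (intro mult_left_mono sum_mono)
      fix k assume k: "k \<in> L"
      have "(\<Sum>l\<in>L. w k l / n l) = (\<Sum>l\<in>L. 1 / (norm (lat l) * (1 + (H k - supp S (lat l))\<^sup>2)))"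
        by (intro sum.cong refl) (simp add: w_def n_def H_def mult.commute)
      also have "\<dots> \<le> supp_sum_const \<rho> r" by (rule supp_sum_le[OF S L])
      finally show "(\<Sum>l\<in>L. w k l / n l) \<le> supp_sum_const \<rho> r" .
    qed (use n in \<open>auto simp: n_def\<close>)
    also have "\<dots> = 2304 * supp_sum_const \<rho> r * (\<Sum>k\<in>L. n k * (b k)\<^sup>2)"
      by (simp only: sum_distrib_left) (intro sum.cong refl, simp add: mult_ac)
    finally show "(\<integral>t. (\<Sum>k\<in>L. \<Sum>l\<in>L. ?P k l t) \<partial>lborel) \<le> 2304 * supp_sum_const \<rho> r * (\<Sum>k\<in>L. n k * (b k)\<^sup>2)" .
  qed
  finally show ?thesis by (simp add: b_def n_def)
qed

subsection \<open>Smoothing by the Fejer kernel\<close>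

definition dirichlet :: "nat \<Rightarrow> real \<Rightarrow> complex" where
  "dirichlet L x = (\<Sum>j<L. cis (2 * pi * real j * x))"

text \<open>The Fejer kernel of period 1. It supplies nonnegativity, mass 1 per period, tails of
  order \<open>1 / (L * s)\<close> beyond distance \<open>s\<close>, and frequencies below
  \<open>L\<close> only.\<close>

definition fejer :: "nat \<Rightarrow> real \<Rightarrow> real" where
  "fejer L x = (cmod (dirichlet L x))\<^sup>2 / real L"

lemma fejer_nonneg: "0 \<le> fejer L x" by (simp add: fejer_def)

lemma dirichlet_norm_sq: "(cmod (dirichlet L x))\<^sup>2 = (\<Sum>i<L. \<Sum>j<L. cos (2 * pi * (real i - real j) * x))"
proof -
  have "complex_of_real ((cmod (dirichlet L x))\<^sup>2) = dirichlet L x * cnj (dirichlet L x)"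
    by (simp only: complex_norm_square)
  also have "\<dots> = (\<Sum>i<L. \<Sum>j<L. cis (2 * pi * real i * x) * cis (- (2 * pi * real j * x)))"
    by (simp add: dirichlet_def sum_product cis_cnj)
  also have "\<dots> = (\<Sum>i<L. \<Sum>j<L. cis (2 * pi * (real i - real j) * x))"
    by (intro sum.cong refl) (simp add: cis_mult algebra_simps)
  finally have "(cmod (dirichlet L x))\<^sup>2 = Re (\<Sum>i<L. \<Sum>j<L. cis (2 * pi * (real i - real j) * x))"
    by (metis Re_complex_of_real)
  then show ?thesis by simp
qed

lemma fejer_eq: "fejer L x = (\<Sum>i<L. \<Sum>j<L. cos (2 * pi * (real i - real j) * x)) / real L"
  by (simp add: fejer_def dirichlet_norm_sq)

lemma fejer_measurable [measurable]: "fejer L \<in> borel_measurable borel"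
  unfolding fejer_eq[abs_def] by measurable

lemma fejer_periodic: "fejer L (x + real_of_int n) = fejer L x"
proof -
  have "cos (2 * pi * (real i - real j) * (x + real_of_int n)) = cos (2 * pi * (real i - real j) * x)" for i j
  proof -
    have "2 * pi * (real i - real j) * (x + real_of_int n) = 2 * pi * (real i - real j) * x + 2 * pi * real_of_int ((int i - int j) * n)"
      by (simp add: algebra_simps)
    moreover have "cos (A + 2 * pi * real_of_int m) = cos A" for A m by (simp add: cos_add cos_int_2pin sin_int_2pin)
    ultimately show ?thesis by (simp only:)
  qed
  then show ?thesis by (simp add: fejer_eq)
qed

text \<open>Jordan's inequality: on a quarter period the concave sine lies above its chord. It gives
  both the decay of the Fejer kernel and the lower bound for the second difference factor in
  \<open>freq_sum_mean_square\<close>.\<close>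

lemma abs_sin_pi_ge:
  assumes "\<bar>x\<bar> \<le> 1 / 2"
  shows "2 * \<bar>x\<bar> \<le> \<bar>sin (pi * x)\<bar>"
proof -
  have "2 * y \<le> sin (pi * y)" if "0 \<le> y" "y \<le> 1 / 2" for y :: real
  proof -
    have cc: "concave_on {0..pi} sin" 
    proof (rule f''_le0_imp_concave)
      show "(sin has_real_derivative cos x) (at x)" for x :: real by (rule DERIV_sin)
      show "(cos has_real_derivative - sin x) (at x)" for x :: real by (rule DERIV_cos)
    qed (auto simp: sin_ge_zero)
    have "(1 - 2 * y) * sin 0 + (2 * y) * sin (pi / 2) \<le> sin ((1 - 2 * y) * 0 + (2 * y) * (pi / 2))"
      using concave_onD[OF cc, of "2 * y" 0 "pi / 2"] that by simp
    then show ?thesis by (simp add: mult.commute)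
  qed
  from this[of "\<bar>x\<bar>"] assms have "2 * \<bar>x\<bar> \<le> sin (pi * \<bar>x\<bar>)" by simp
  then show ?thesis by (cases "0 \<le> x") auto
qed

lemma fejer_le:
  assumes "0 < \<bar>x\<bar>" "\<bar>x\<bar> \<le> 1 / 2" "0 < L"
  shows "fejer L x \<le> 1 / (4 * real L * x\<^sup>2)"
proof -
  define z where "z = cis (2 * pi * x)"
  have z1: "cmod (z - 1) = 2 * \<bar>sin (pi * x)\<bar>"
  proof -
    have "(cmod (z - 1))\<^sup>2 = (cos (2 * (pi * x)) - 1)\<^sup>2 + (sin (2 * (pi * x)))\<^sup>2"
      by (simp add: z_def cmod_power2 mult.assoc)
    also have "\<dots> = 2 - 2 * cos (2 * (pi * x))"
    proof -
      have "(c - 1)\<^sup>2 + s\<^sup>2 = 2 - 2 * c" if "s\<^sup>2 + c\<^sup>2 = 1" for c s :: real using that by (simp add: power2_eq_square algebra_simps)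
      then show ?thesis using sin_cos_squared_add by blast
    qed
    also have "\<dots> = (2 * \<bar>sin (pi * x)\<bar>)\<^sup>2" by (simp add: cos_double_sin power_mult_distrib)
    finally show ?thesis by (rule power2_eq_imp_eq) auto
  qed
  have "0 < 4 * \<bar>x\<bar>" using assms by simp
  also have le: "4 * \<bar>x\<bar> \<le> cmod (z - 1)" using abs_sin_pi_ge[OF assms(2)] z1 by simp
  finally have pos: "0 < cmod (z - 1)" .
  then have "z \<noteq> 1" by auto
  have "cis (2 * pi * real j * x) = z ^ j" for j
    using Complex.DeMoivre[of "2 * pi * x" j] by (simp add: z_def mult_ac)
  then have "dirichlet L x = (\<Sum>j<L. z ^ j)" by (simp add: dirichlet_def)
  also have "\<dots> = (z ^ L - 1) / (z - 1)" using \<open>z \<noteq> 1\<close> by (rule geometric_sum)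
  finally have "cmod (dirichlet L x) = cmod (z ^ L - 1) / cmod (z - 1)" by (simp add: norm_divide)
  also have "\<dots> \<le> 2 / (4 * \<bar>x\<bar>)"
  proof (rule frac_le)
    show "cmod (z ^ L - 1) \<le> 2" using norm_triangle_ineq4[of "z ^ L" 1] by (simp add: norm_power z_def)
  qed (use assms le in auto)
  finally have "cmod (dirichlet L x) \<le> 1 / (2 * \<bar>x\<bar>)" by simp
  then have "(cmod (dirichlet L x))\<^sup>2 \<le> (1 / (2 * \<bar>x\<bar>))\<^sup>2" by (intro power_mono) auto
  also have "\<dots> = 1 / (4 * x\<^sup>2)" by (simp add: power_divide power_mult_distrib)
  finally have "fejer L x \<le> 1 / (4 * x\<^sup>2) / real L" unfolding fejer_def by (intro divide_right_mono) auto
  then show ?thesis by (simp add: mult_ac)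
qed

lemma fejer_integral:
  assumes "0 < L"
  shows "(\<integral>\<^sup>+x. ennreal (fejer L x) * indicator {-1/2..<1/2} x \<partial>lborel) = 1"
proof -
  \<comment> \<open>A termwise primitive. Off the diagonal the sines vanish at both ends of the
    period, so only the \<open>L\<close> diagonal terms contribute to the integral.\<close>
  define F where "F = (\<lambda>x. (\<Sum>i<L. \<Sum>j<L. if i = j then x else sin (2 * pi * (real i - real j) * x) / (2 * pi * (real i - real j))) / real L)"
  have D: "(F has_real_derivative fejer L x) (at x)" for x
    unfolding F_def fejer_eq
  proof (intro DERIV_cdivide DERIV_sum)
    fix i j
    show "((\<lambda>x. if i = j then x else sin (2 * pi * (real i - real j) * x) / (2 * pi * (real i - real j))) has_real_derivative cos (2 * pi * (real i - real j) * x)) (at x)"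
    proof (cases "i = j")
      case False
      then have "2 * pi * (real i - real j) \<noteq> 0" by simp
      then show ?thesis using False by (auto intro!: derivative_eq_intros)
    qed auto
  qed
  have "sin (pi * (real i - real j)) = 0" for i j
    using sin_npi_int[of "int i - int j"] by (simp add: mult.commute)
  then have s: "sin (2 * pi * (real i - real j) * (1/2)) = 0" "sin (2 * pi * (real i - real j) * (-1/2)) = 0" for i j
    by (simp_all add: algebra_simps)
  have F: "F (1/2) - F (-1/2) = 1"
  proof -
    have "F (1/2) = (\<Sum>i<L. \<Sum>j<L. if i = j then 1/2 else 0) / real L"
      unfolding F_def s by (simp only: div_0)
    moreover have "F (-1/2) = (\<Sum>i<L. \<Sum>j<L. if i = j then -1/2 else 0) / real L"
      unfolding F_def s by (simp only: div_0)
    ultimately show ?thesis using assms by (simp add: sum.delta)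
  qed
  have "(\<integral>\<^sup>+x. ennreal (fejer L x) * indicator {-1/2..<1/2} x \<partial>lborel) = (\<integral>\<^sup>+x. ennreal (fejer L x) * indicator {-1/2..1/2} x \<partial>lborel)"
  proof (rule nn_integral_cong_AE)
    have "AE x in lborel. x \<noteq> (1/2::real)" by (rule AE_lborel_singleton)
    then show "AE x in lborel. ennreal (fejer L x) * indicator {-1/2..<1/2} x = ennreal (fejer L x) * indicator {-1/2..1/2} x"
      by eventually_elim (auto simp: indicator_def)
  qed
  also have "\<dots> = ennreal (F (1/2) - F (-1/2))"
    using D fejer_nonneg by (intro nn_integral_FTC_Icc) auto
  finally show ?thesis using F by simp
qed

lemma fejer_tail:
  assumes "0 < L" "0 < s" "s \<le> 1 / 2"
  shows "(\<integral>\<^sup>+x. ennreal (fejer L x) * indicator {x \<in> {-1/2..<1/2}. s < \<bar>x\<bar>} x \<partial>lborel) \<le> ennreal (1 / (2 * real L * s))"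
proof -
  have h: "(\<integral>\<^sup>+x. ennreal (1 / (4 * real L * x\<^sup>2)) * indicator {s..1/2} x \<partial>lborel) \<le> ennreal (1 / (4 * real L * s))"
  proof -
    have "(\<integral>\<^sup>+x. ennreal (1 / (4 * real L * x\<^sup>2)) * indicator {s..1/2} x \<partial>lborel) = ennreal ((- 1 / (4 * real L * (1/2))) - (- 1 / (4 * real L * s)))"
    proof (rule nn_integral_FTC_Icc)
      fix x :: real assume "x \<in> {s..1/2}"
      then have "x \<noteq> 0" using assms by auto
      then show "((\<lambda>x. - 1 / (4 * real L * x)) has_real_derivative 1 / (4 * real L * x\<^sup>2)) (at x)"
        using assms(1) by (auto intro!: derivative_eq_intros simp: power2_eq_square field_simps)
    qed (use assms in auto)
    also have "\<dots> \<le> ennreal (1 / (4 * real L * s))" using assms(1) by (intro ennreal_leI) simp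
    finally show ?thesis .
  qed
  have h': "(\<integral>\<^sup>+x. ennreal (1 / (4 * real L * x\<^sup>2)) * indicator {-1/2..-s} x \<partial>lborel) \<le> ennreal (1 / (4 * real L * s))"
  proof -
    have "(\<integral>\<^sup>+x. ennreal (1 / (4 * real L * x\<^sup>2)) * indicator {-1/2..-s} x \<partial>lborel) = (\<integral>\<^sup>+x. ennreal (1 / (4 * real L * x\<^sup>2)) * indicator {s..1/2} x \<partial>lborel)"
      by (subst nn_integral_real_affine[where c="-1" and t=0]) (auto intro!: nn_integral_cong simp: indicator_def)
    then show ?thesis using h by simp
  qed
  have "(\<integral>\<^sup>+x. ennreal (fejer L x) * indicator {x \<in> {-1/2..<1/2}. s < \<bar>x\<bar>} x \<partial>lborel)
     \<le> (\<integral>\<^sup>+x. ennreal (1 / (4 * real L * x\<^sup>2)) * indicator {s..1/2} x + ennreal (1 / (4 * real L * x\<^sup>2)) * indicator {-1/2..-s} x \<partial>lborel)"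
  proof (rule nn_integral_mono)
    fix x :: real
    show "ennreal (fejer L x) * indicator {x \<in> {-1/2..<1/2}. s < \<bar>x\<bar>} x \<le> ennreal (1 / (4 * real L * x\<^sup>2)) * indicator {s..1/2} x + ennreal (1 / (4 * real L * x\<^sup>2)) * indicator {-1/2..-s} x"
    proof (cases "x \<in> {-1/2..<1/2} \<and> s < \<bar>x\<bar>")
      case True
      then have "ennreal (fejer L x) \<le> ennreal (1 / (4 * real L * x\<^sup>2))" using assms by (intro ennreal_leI fejer_le) auto
      moreover have "x \<in> {s..1/2} \<and> x \<notin> {-1/2..-s} \<or> x \<in> {-1/2..-s} \<and> x \<notin> {s..1/2}" using True assms by auto
      ultimately show ?thesis using True by auto
    qed auto
  qed
  also have "\<dots> = (\<integral>\<^sup>+x. ennreal (1 / (4 * real L * x\<^sup>2)) * indicator {s..1/2} x \<partial>lborel) + (\<integral>\<^sup>+x. ennreal (1 / (4 * real L * x\<^sup>2)) * indicator {-1/2..-s} x \<partial>lborel)"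
    by (intro nn_integral_add) auto
  also have "\<dots> \<le> ennreal (1 / (4 * real L * s)) + ennreal (1 / (4 * real L * s))" by (intro add_mono h h')
  also have "\<dots> = ennreal (1 / (2 * real L * s))" using assms by (simp add: ennreal_plus[symmetric] del: ennreal_plus)
  finally show ?thesis .
qed

definition fejer2 :: "nat \<Rightarrow> real \<times> real \<Rightarrow> real" where
  "fejer2 L x = fejer L (fst x) * fejer L (snd x)"

lemma fejer2_nonneg: "0 \<le> fejer2 L x" by (simp add: fejer2_def fejer_nonneg)

lemma fejer2_measurable [measurable]: "fejer2 L \<in> borel_measurable borel"
  proof -
  have c: "continuous_on UNIV (fejer L)"
    unfolding fejer_eq[abs_def] divide_inverse by (intro continuous_intros)
  have "continuous_on UNIV (\<lambda>x. fejer L (fst x) * fejer L (snd x))"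
    by (intro continuous_intros continuous_on_compose2[OF c]) auto
  then show ?thesis unfolding fejer2_def[abs_def] by (rule borel_measurable_continuous_onI)
qed

lemma fejer2_periodic: "fejer2 L (x + lat p) = fejer2 L x"
  by (simp add: fejer2_def lat_def fejer_periodic)

lemma nn_integral_fejer2_Times:
  assumes "A \<in> sets borel" "B \<in> sets borel"
  shows "(\<integral>\<^sup>+x. ennreal (fejer2 L x) * indicator (A \<times> B) x \<partial>lborel) 
    = (\<integral>\<^sup>+x. ennreal (fejer L x) * indicator A x \<partial>lborel) * (\<integral>\<^sup>+x. ennreal (fejer L x) * indicator B x \<partial>lborel)"
proof -
  have "(\<integral>\<^sup>+x. ennreal (fejer2 L x) * indicator (A \<times> B) x \<partial>lborel) = 
    (\<integral>\<^sup>+p. (ennreal (fejer L (fst p)) * indicator A (fst p)) * (ennreal (fejer L (snd p)) * indicator B (snd p)) \<partial>(lborel \<Otimes>\<^sub>M lborel))"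
    unfolding lborel_prod by (intro nn_integral_cong) (auto simp: fejer2_def indicator_def ennreal_mult fejer_nonneg)
  also have "\<dots> = (\<integral>\<^sup>+x. \<integral>\<^sup>+y. (ennreal (fejer L x) * indicator A x) * (ennreal (fejer L y) * indicator B y) \<partial>lborel \<partial>lborel)"
    using assms by (subst lborel.nn_integral_fst[symmetric]) auto
  also have "\<dots> = (\<integral>\<^sup>+x. ennreal (fejer L x) * indicator A x \<partial>lborel) * (\<integral>\<^sup>+x. ennreal (fejer L x) * indicator B x \<partial>lborel)"
    using assms by (simp add: nn_integral_cmult nn_integral_multc)
  finally show ?thesis .
qed

lemma fejer2_integral:
  assumes "0 < L"
  shows "(\<integral>\<^sup>+x. ennreal (fejer2 L x) * indicator cell x \<partial>lborel) = 1"
  unfolding cell_def by (subst nn_integral_fejer2_Times) (auto simp: fejer_integral[OF assms, simplified])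

definition far :: "real \<Rightarrow> (real \<times> real) set" where
  "far s = {y \<in> cell. s < \<bar>fst y\<bar> \<or> s < \<bar>snd y\<bar>}"

lemma fejer2_tail:
  assumes "0 < L" "0 < s" "s \<le> 1 / 2"
  shows "(\<integral>\<^sup>+x. ennreal (fejer2 L x) * indicator (far s) x \<partial>lborel) \<le> ennreal (1 / (real L * s))"
proof -
  let ?I = "{-1/2..<1/2::real}" and ?J = "{x \<in> {-1/2..<1/2::real}. s < \<bar>x\<bar>}"
  have J: "?J \<in> sets borel" by measurable
  have J': "(?J \<times> ?I) \<in> sets borel" "(?I \<times> ?J) \<in> sets borel" using J by (auto intro!: borel_Times)
  have "(\<integral>\<^sup>+x. ennreal (fejer2 L x) * indicator (far s) x \<partial>lborel) \<le> (\<integral>\<^sup>+x. ennreal (fejer2 L x) * indicator (?J \<times> ?I) x + ennreal (fejer2 L x) * indicator (?I \<times> ?J) x \<partial>lborel)"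
    by (intro nn_integral_mono) (auto simp: far_def cell_def indicator_def)
  also have "\<dots> = (\<integral>\<^sup>+x. ennreal (fejer2 L x) * indicator (?J \<times> ?I) x \<partial>lborel) + (\<integral>\<^sup>+x. ennreal (fejer2 L x) * indicator (?I \<times> ?J) x \<partial>lborel)"
    using J' by (intro nn_integral_add) auto
  also have "\<dots> = 2 * (\<integral>\<^sup>+x. ennreal (fejer L x) * indicator ?J x \<partial>lborel)"
    using J fejer_integral[OF assms(1)] by (subst (1 2) nn_integral_fejer2_Times) (auto simp: mult_2)
  also have "\<dots> \<le> 2 * ennreal (1 / (2 * real L * s))" by (intro mult_left_mono fejer_tail assms) auto
  also have "\<dots> = ennreal (1 / (real L * s))"
  proof -
    have "2 * ennreal (1 / (2 * real L * s)) = ennreal (2 * (1 / (2 * real L * s)))"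
      using assms by (subst ennreal_mult) auto
    then show ?thesis by simp
  qed
  finally show ?thesis .
qed

section \<open>Averages of shifted lattice counts\<close>

lemma lattice_count_alt: "lattice_count S t = card {p. lat p \<in> (\<lambda>x. t *\<^sub>R x) ` S}"
  by (simp add: lattice_count_def lat_def)

text \<open>One finite index set works for all shifts in the cell. The shifted count thereby becomes
  a finite sum of indicators, which can be integrated and measured in the shift.\<close>

lemma card_shifted:
  assumes "bounded T"
  obtains A where "finite A" "\<And>p y. y \<in> cell \<Longrightarrow> lat p + y \<in> T \<Longrightarrow> p \<in> A"
    "\<And>y. y \<in> cell \<Longrightarrow> ennreal (real (card {p. lat p + y \<in> T})) = (\<Sum>p\<in>A. indicator T (lat p + y))"
proof -
  obtain B where B: "\<And>x. x \<in> T \<Longrightarrow> norm x \<le> B" using assms by (auto simp: bounded_iff)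
  define A where "A = {p. lat p \<in> cball 0 (B + 1)}"
  have A: "finite A" unfolding A_def by (rule finite_lat_bounded) simp
  have inA: "p \<in> A" if "y \<in> cell" "lat p + y \<in> T" for p y
  proof -
    have "norm (lat p) \<le> norm (lat p + y) + norm y" using norm_triangle_ineq4[of "lat p + y" y] by simp
    then show ?thesis using B[OF that(2)] norm_cell[OF that(1)] by (simp add: A_def)
  qed
  have "ennreal (real (card {p. lat p + y \<in> T})) = (\<Sum>p\<in>A. indicator T (lat p + y))" if "y \<in> cell" for y
  proof -
    have "{p. lat p + y \<in> T} = {p \<in> A. lat p + y \<in> T}" using inA[OF that] by auto
    then show ?thesis using A by (simp add: indicator_def sum.If_cases Int_def ennreal_of_nat_eq_real_of_nat)
  qed
  with A inA show ?thesis by (rule that)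
qed

lemma indicator_shift_measurable:
  assumes "T \<in> sets borel"
  shows "(\<lambda>y :: real \<times> real. indicator T (v + y) :: ennreal) \<in> borel_measurable borel"
  by (rule measurable_compose[of "\<lambda>y. v + y" borel borel]) (use assms in auto)

lemma card_shifted_measurable:
  assumes "T \<in> sets borel" "bounded T"
  shows "(\<lambda>y. indicator cell y * ennreal (real (card {p. lat p + y \<in> T}))) \<in> borel_measurable borel"
proof -
  obtain A where A: "finite A" "\<And>y. y \<in> cell \<Longrightarrow> ennreal (real (card {p. lat p + y \<in> T})) = (\<Sum>p\<in>A. indicator T (lat p + y))"
    using card_shifted[OF assms(2)] by metis
  have "(\<lambda>y. indicator cell y * ennreal (real (card {p. lat p + y \<in> T}))) = (\<lambda>y. indicator cell y * (\<Sum>p\<in>A. indicator T (lat p + y)))"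
    using A(2) by (auto simp: fun_eq_iff indicator_def)
  then show ?thesis
    by (simp only:) (intro borel_measurable_times_ennreal borel_measurable_sum indicator_shift_measurable assms borel_measurable_indicator cell_sets)
qed

text \<open>Cutting the plane into cells and using periodicity folds the integral onto a single
  cell. Since the kernel has mass 1 there, the smoothed count is an average of the lattice counts of
  translates of \<open>T\<close>.\<close>

lemma periodization:
  assumes T: "T \<in> sets borel" "bounded T"
  shows "(\<integral>\<^sup>+x. ennreal (fejer2 L x) * indicator T x \<partial>lborel)
    = (\<integral>\<^sup>+y. ennreal (fejer2 L y) * indicator cell y * ennreal (real (card {p. lat p + y \<in> T})) \<partial>lborel)"
proof -
  obtain A where A: "finite A" and inA: "\<And>p y. y \<in> cell \<Longrightarrow> lat p + y \<in> T \<Longrightarrow> p \<in> A"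
    and card: "\<And>y. y \<in> cell \<Longrightarrow> ennreal (real (card {p. lat p + y \<in> T})) = (\<Sum>p\<in>A. indicator T (lat p + y))"
    using card_shifted[OF T(2)] by metis
  have meas: "(\<lambda>x. x - lat p) \<in> borel \<rightarrow>\<^sub>M borel" for p by simp
  have cm: "(\<lambda>x. indicator cell (x - lat p) :: ennreal) \<in> borel_measurable borel" for p
    by (rule measurable_compose[OF meas]) simp
  have dec: "ennreal (fejer2 L x) * indicator T x = (\<Sum>p\<in>A. ennreal (fejer2 L x) * indicator T x * indicator cell (x - lat p))" for x
  proof (cases "x \<in> T")
    case True
    obtain q where q: "x - lat q \<in> cell" using lat_cell_exists by blast
    then have "q \<in> A" using inA[of "x - lat q" q] True by simp
    have "indicator cell (x - lat p) = (if p = q then 1 else (0::ennreal))" for p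
    proof (cases "p = q")
      case False
      then have "x - lat p \<notin> cell" using lat_cell_unique[OF _ q] by blast
      then show ?thesis using False by simp
    qed (use q in simp)
    then have "(\<Sum>p\<in>A. ennreal (fejer2 L x) * indicator T x * indicator cell (x - lat p)) = (\<Sum>p\<in>A. if p = q then ennreal (fejer2 L x) * indicator T x else 0)"
      by (intro sum.cong refl) simp
    also have "\<dots> = ennreal (fejer2 L x) * indicator T x" using A \<open>q \<in> A\<close> by (simp only: sum.delta if_True)
    finally show ?thesis by simp
  qed simp
  have "(\<integral>\<^sup>+x. ennreal (fejer2 L x) * indicator T x \<partial>lborel) 
     = (\<Sum>p\<in>A. \<integral>\<^sup>+x. ennreal (fejer2 L x) * indicator T x * indicator cell (x - lat p) \<partial>lborel)"
  proof (subst nn_integral_sum[symmetric])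
    show "(\<lambda>x. ennreal (fejer2 L x) * indicator T x * indicator cell (x - lat p)) \<in> borel_measurable lborel" for p
      using borel_measurable_times_ennreal[OF _ cm[of p], of "\<lambda>x. ennreal (fejer2 L x) * indicator T x"] T by simp
    show "(\<integral>\<^sup>+x. ennreal (fejer2 L x) * indicator T x \<partial>lborel) 
     = (\<integral>\<^sup>+x. (\<Sum>p\<in>A. ennreal (fejer2 L x) * indicator T x * indicator cell (x - lat p)) \<partial>lborel)"
      by (rule nn_integral_cong) (rule dec)
  qed
  also have "\<dots> = (\<Sum>p\<in>A. \<integral>\<^sup>+y. ennreal (fejer2 L y) * indicator cell y * indicator T (lat p + y) \<partial>lborel)"
  proof (rule sum.cong[OF refl])
    fix p
    have "(\<integral>\<^sup>+x. ennreal (fejer2 L x) * indicator T x * indicator cell (x - lat p) \<partial>lborel)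
       = (\<integral>\<^sup>+x. ennreal (fejer2 L x) * indicator T x * indicator cell (x - lat p) \<partial>(distr lborel borel ((+) (lat p))))"
      by (simp add: lborel_distr_plus)
    also have "\<dots> = (\<integral>\<^sup>+y. ennreal (fejer2 L (lat p + y)) * indicator T (lat p + y) * indicator cell (lat p + y - lat p) \<partial>lborel)"
    proof -
      have "(\<lambda>x. ennreal (fejer2 L x) * indicator T x * indicator cell (x - lat p)) \<in> borel_measurable borel"
        using borel_measurable_times_ennreal[OF _ cm[of p], of "\<lambda>x. ennreal (fejer2 L x) * indicator T x"] T by simp
      then show ?thesis using nn_integral_distr[of "(+) (lat p)" lborel borel "\<lambda>x. ennreal (fejer2 L x) * indicator T x * indicator cell (x - lat p)"] by simp
    qed
    also have "\<dots> = (\<integral>\<^sup>+y. ennreal (fejer2 L y) * indicator cell y * indicator T (lat p + y) \<partial>lborel)"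
      using fejer2_periodic by (intro nn_integral_cong) (simp add: add.commute[of "lat p"] mult_ac)
    finally show "(\<integral>\<^sup>+x. ennreal (fejer2 L x) * indicator T x * indicator cell (x - lat p) \<partial>lborel)
       = (\<integral>\<^sup>+y. ennreal (fejer2 L y) * indicator cell y * indicator T (lat p + y) \<partial>lborel)" .
  qed
  also have "\<dots> = (\<integral>\<^sup>+y. (\<Sum>p\<in>A. ennreal (fejer2 L y) * indicator cell y * indicator T (lat p + y)) \<partial>lborel)"
    by (rule nn_integral_sum[symmetric]) (auto intro!: borel_measurable_times_ennreal indicator_shift_measurable T)
  also have "\<dots> = (\<integral>\<^sup>+y. ennreal (fejer2 L y) * indicator cell y * ennreal (real (card {p. lat p + y \<in> T})) \<partial>lborel)"
  proof (rule nn_integral_cong)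
    fix y
    show "(\<Sum>p\<in>A. ennreal (fejer2 L y) * indicator cell y * indicator T (lat p + y)) = ennreal (fejer2 L y) * indicator cell y * ennreal (real (card {p. lat p + y \<in> T}))"
    proof (cases "y \<in> cell")
      case True
      then show ?thesis by (simp add: sum_distrib_left[symmetric] card)
    qed simp
  qed
  finally show ?thesis .
qed

definition smooth_count :: "nat \<Rightarrow> (real \<times> real) set \<Rightarrow> real \<Rightarrow> real" where
  "smooth_count L S t = (\<integral>x. indicator ((\<lambda>x. t *\<^sub>R x) ` S) x * fejer2 L x \<partial>lborel)"

lemma fejer2_bounded: obtains B where "\<And>x. \<bar>fejer2 L x\<bar> \<le> B"
proof
  fix x
  have "fejer L y \<le> real L * real L / real L" for y
  proof -
    have "cmod (dirichlet L y) \<le> (\<Sum>j<L. cmod (cis (2 * pi * real j * y)))" unfolding dirichlet_def by (rule norm_sum)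
    then have "(cmod (dirichlet L y))\<^sup>2 \<le> (real L)\<^sup>2" by (intro power_mono) auto
    then show ?thesis unfolding fejer_def power2_eq_square by (intro divide_right_mono) auto
  qed
  then show "\<bar>fejer2 L x\<bar> \<le> (real L * real L / real L) * (real L * real L / real L)"
    unfolding fejer2_def abs_mult abs_of_nonneg[OF fejer_nonneg] by (intro mult_mono fejer_nonneg) auto
qed

lemma integrable_bounded_on:
  fixes f :: "real \<times> real \<Rightarrow> real"
  assumes "T \<in> sets borel" "bounded T" "f \<in> borel_measurable borel" "\<And>x. \<bar>f x\<bar> \<le> B"
  shows "integrable lborel (\<lambda>x. indicator T x * f x)"
proof (rule Bochner_Integration.integrable_bound[where f="\<lambda>x. B * indicator T x"])
  show "integrable lborel (\<lambda>x. B * indicator T x)"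
    using emeasure_bounded_finite[OF assms(2)] assms(1) by (intro integrable_mult_right integrable_real_indicator) auto
  show "AE x in lborel. norm (indicator T x * f x) \<le> norm (B * indicator T x)"
  proof (rule AE_I2)
    fix x show "norm (indicator T x * f x) \<le> norm (B * indicator T x)"
      using assms(4)[of x] by (auto simp: indicator_def)
  qed
qed (use assms in measurable)

lemma smooth_count_eq:
  assumes "convex_body \<rho> r S" "0 < t"
  shows "ennreal (smooth_count L S t) = (\<integral>\<^sup>+y. ennreal (fejer2 L y) * indicator cell y * ennreal (real (card {p. lat p + y \<in> (\<lambda>x. t *\<^sub>R x) ` S})) \<partial>lborel)"
    "0 \<le> smooth_count L S t"
proof -
  note b = convex_bodyD[OF assms(1)]
  have T: "(\<lambda>x. t *\<^sub>R x) ` S \<in> sets borel" "bounded ((\<lambda>x. t *\<^sub>R x) ` S)"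
    using b assms(2) by (auto intro!: sets_scaleR_image bounded_scaled)
  obtain B where B: "\<And>x. \<bar>fejer2 L x\<bar> \<le> B" by (rule fejer2_bounded[of L]) blast
  have "(\<integral>\<^sup>+x. ennreal (fejer2 L x) * indicator ((\<lambda>x. t *\<^sub>R x) ` S) x \<partial>lborel) = (\<integral>\<^sup>+x. ennreal (indicator ((\<lambda>x. t *\<^sub>R x) ` S) x * fejer2 L x) \<partial>lborel)"
    by (intro nn_integral_cong) (auto simp: indicator_def)
  also have "\<dots> = ennreal (smooth_count L S t)"
    unfolding smooth_count_def using fejer2_nonneg
    by (intro nn_integral_eq_integral integrable_bounded_on[OF T _ B]) auto
  finally show "ennreal (smooth_count L S t) = (\<integral>\<^sup>+y. ennreal (fejer2 L y) * indicator cell y * ennreal (real (card {p. lat p + y \<in> (\<lambda>x. t *\<^sub>R x) ` S})) \<partial>lborel)"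
    using periodization[OF T, of L] by simp
  show "0 \<le> smooth_count L S t" unfolding smooth_count_def using fejer2_nonneg by (intro integral_nonneg_AE) auto
qed

definition shell_const :: "real \<Rightarrow> real \<Rightarrow> real" where
  "shell_const \<rho> r = 4 * r\<^sup>2 * (2 + 4 / \<rho>)\<^sup>2 * (2 / \<rho> + 3) * (2 / \<rho> + 2)"

lemma far_sets [measurable]: "far s \<in> sets borel"
proof -
  have "open {y :: real \<times> real. s < \<bar>fst y\<bar> \<or> s < \<bar>snd y\<bar>}" by (intro open_Collect_disj open_Collect_less continuous_intros)
  then show ?thesis unfolding far_def using sets.Int[OF cell_sets, of "{y. s < \<bar>fst y\<bar> \<or> s < \<bar>snd y\<bar>}"] by (simp add: Int_def)
qed

lemma nn_integral_two_levels:
  assumes "0 < L" "0 < s" "s \<le> 1 / 2" "0 \<le> N" "0 \<le> M"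
  shows "(\<integral>\<^sup>+y. ennreal (fejer2 L y) * indicator cell y * ennreal N + ennreal (fejer2 L y) * indicator (far s) y * ennreal M \<partial>lborel)
     \<le> ennreal (N + M / (real L * s))"
proof -
  note fm = far_sets[of s]
  have "(\<integral>\<^sup>+y. ennreal (fejer2 L y) * indicator cell y * ennreal N + ennreal (fejer2 L y) * indicator (far s) y * ennreal M \<partial>lborel)
    = 1 * ennreal N + (\<integral>\<^sup>+y. ennreal (fejer2 L y) * indicator (far s) y \<partial>lborel) * ennreal M"
    using fm fejer2_integral[OF assms(1)] by (simp add: nn_integral_add nn_integral_multc)
  also have "\<dots> \<le> 1 * ennreal N + ennreal (1 / (real L * s)) * ennreal M"
    by (intro add_mono mult_right_mono fejer2_tail assms) auto
  also have "\<dots> = ennreal (N + M / (real L * s))"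
    using assms by (simp add: ennreal_mult[symmetric] ennreal_plus[symmetric] del: ennreal_plus)
  finally show ?thesis .
qed

text \<open>If both coordinates of the shift \<open>y\<close> are at most \<open>s\<close> in
  modulus, then \<open>y\<close> lies in the dilate by \<eta> and the translated body is sandwiched
  between the dilates by \<open>t - \<eta>\<close> and \<open>t + \<eta>\<close>. The other shifts
  have mass at most \<open>1 / (L * s)\<close>, and for them the counts are off by at most the
  \<open>O(t + 1)\<close> points of a shell. The product of the two is \<open>e\<close>.\<close>

lemma smoothing:
  assumes S: "convex_body \<rho> r S" and L: "0 < L" and \<eta>: "0 < \<eta>" "\<eta> \<le> 1" and t: "1 < t" and \<rho>1: "\<rho> \<le> 1"
  defines "e \<equiv> shell_const \<rho> r * (t + 1) / (real L * (\<rho> * \<eta> / 3))"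
  shows "smooth_count L S t \<le> real (lattice_count S (t + \<eta>)) + e"
    and "real (lattice_count S (t - \<eta>)) \<le> smooth_count L S t + e"
proof -
  note b = convex_bodyD[OF S]
  \<comment> \<open>The norm of a near shift is at most the sum of its coordinates in modulus,
    \<open>2 * s < \<eta> * \<rho>\<close>; and \<open>\<rho> \<le> 1\<close> keeps \<open>s\<close>
    within half a period.\<close>
  define s where "s = \<rho> * \<eta> / 3"
  have "\<rho> * \<eta> \<le> 1 * 1" using b(3) \<eta> \<rho>1 by (intro mult_mono) auto
  then have s: "0 < s" "s \<le> 1 / 2" using b(3) \<eta> by (auto simp: s_def)
  \<comment> \<open>The dilate by \<open>c\<close> contains every shift from the cell, and the extra
    1 ensures \<open>c > \<eta>\<close>, so the dilates by \<open>t - c\<close> and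
    \<open>t + c\<close> enclose those by \<open>t - \<eta>\<close> and
    \<open>t + \<eta>\<close>.\<close>
  define c where "c = 2 / \<rho> + 1"
  have c: "1 < c" "1 < c * \<rho>" using b(3) by (auto simp: c_def distrib_right)
  define M where "M = shell_const \<rho> r * (t + 1)"
  have M: "0 \<le> M" using b(3) t by (simp add: M_def shell_const_def)
  define sc where "sc = (\<lambda>a. (\<lambda>x. a *\<^sub>R x) ` S)"
  have sc_add: "x + y \<in> sc (a + c)" if "x \<in> sc a" "y \<in> sc c" "0 \<le> a" "0 \<le> c" "0 < a + c" for x y a c
    using that unfolding sc_def by (intro scaled_body_add b)
  have sc_ball: "y \<in> sc a" if "norm y < a * \<rho>" "0 < a" for y a
    using that unfolding sc_def by (rule scaled_ball_subset[OF S])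
  have small: "y \<in> sc \<eta>" "- y \<in> sc \<eta>" if "y \<in> cell" "y \<notin> far s" for y
  proof -
    have "\<bar>fst y\<bar> \<le> s" "\<bar>snd y\<bar> \<le> s" using that by (auto simp: far_def)
    then have "norm y \<le> 2 * s" using norm_Pair_le[of "fst y" "snd y"] by simp
    also have "\<dots> < \<eta> * \<rho>" using b(3) \<eta> by (simp add: s_def)
    finally show "y \<in> sc \<eta>" "- y \<in> sc \<eta>" using \<eta> sc_ball[of y \<eta>] sc_ball[of "-y" \<eta>] by simp_all
  qed
  have big: "y \<in> sc c" "- y \<in> sc c" if "y \<in> cell" for y
    using norm_cell[OF that] c sc_ball[of y c] sc_ball[of "-y" c] by simp_all
  have shell: "real (card {p. lat p \<in> sc v \<and> (a = 0 \<or> lat p \<notin> sc a)}) \<le> M"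
    if "0 \<le> a" "a \<le> v" "v - a \<le> c + \<eta>" "v \<le> t + c" for a v
  proof -
    have "real (card {p. lat p \<in> sc v \<and> (a = 0 \<or> lat p \<notin> sc a)}) \<le> 4 * r\<^sup>2 * (2 + 4 / \<rho>)\<^sup>2 * (v - a + 1) * (v + 1)"
      unfolding sc_def by (rule shell_count[OF S that(1,2)])
    also have "\<dots> \<le> 4 * r\<^sup>2 * (2 + 4 / \<rho>)\<^sup>2 * (2 / \<rho> + 3) * ((2 / \<rho> + 2) * (t + 1))"
    proof (intro mult_mono mult_left_mono)
      show "v - a + 1 \<le> 2 / \<rho> + 3" using that \<eta> by (simp add: c_def)
      have "v + 1 \<le> 1 * t + (2 / \<rho> + 2)" using that by (simp add: c_def)
      also have "\<dots> \<le> (2 / \<rho> + 2) * t + (2 / \<rho> + 2)" using t b(3) by (intro add_right_mono mult_right_mono) auto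
      finally show "v + 1 \<le> (2 / \<rho> + 2) * (t + 1)" by (simp add: distrib_left)
    qed (use that b(3) in auto)
    also have "\<dots> = M" by (simp add: M_def shell_const_def)
    finally show ?thesis .
  qed
  define N where "N = (\<lambda>a. {p. lat p \<in> sc a})"
  have fN: "finite (N a)" for a unfolding N_def sc_def by (intro finite_lat_bounded bounded_scaled b)
  define Y where "Y = (\<lambda>y. {p. lat p + y \<in> sc t})"
  have up: "p \<in> N (t + a)" if "p \<in> Y y" "- y \<in> sc a" "0 < a" for p y a
  proof -
    have "(lat p + y) + - y \<in> sc (t + a)" using that t by (intro sc_add) (auto simp: Y_def)
    then show ?thesis by (simp add: N_def)
  qed
  have down: "p \<in> Y y" if "p \<in> N (t - a)" "y \<in> sc a" "0 < a" "a \<le> t" for p y a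
  proof -
    have "lat p + y \<in> sc ((t - a) + a)" using that t by (intro sc_add) (auto simp: N_def)
    then show ?thesis by (simp add: Y_def)
  qed
  have upc: "Y y \<subseteq> N (t + c)" if "y \<in> cell" for y
  proof
    fix p assume "p \<in> Y y"
    from up[OF this big(2)[OF that]] c show "p \<in> N (t + c)" by simp
  qed
  have fY: "finite (Y y)" if "y \<in> cell" for y
    using fN[of "t + c"] upc[OF that] by (rule rev_finite_subset)
  have cN: "real (lattice_count S a) = real (card (N a))" for a by (simp add: lattice_count_alt N_def sc_def)
  have upper: "real (card (Y y)) \<le> real (card (N (t + \<eta>))) + (if y \<in> far s then M else 0)" if y: "y \<in> cell" for y
  proof (cases "y \<in> far s")
    case False
    have "Y y \<subseteq> N (t + \<eta>)"
    proof
      fix p assume "p \<in> Y y"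
      from up[OF this small(2)[OF y False] \<eta>(1)] show "p \<in> N (t + \<eta>)" .
    qed
    then show ?thesis using card_mono[OF fN] False by simp
  next
    case True
    let ?Z = "{p. lat p \<in> sc (t + c) \<and> (t + \<eta> = 0 \<or> lat p \<notin> sc (t + \<eta>))}"
    have "N (t + c) \<subseteq> N (t + \<eta>) \<union> ?Z" by (auto simp: N_def)
    then have "Y y \<subseteq> N (t + \<eta>) \<union> ?Z" using upc[OF y] by simp
    moreover have fZ: "finite ?Z" using fN[of "t + c"] by (rule rev_finite_subset) (auto simp: N_def)
    ultimately have "card (Y y) \<le> card (N (t + \<eta>) \<union> ?Z)" using fN by (intro card_mono) auto
    also have "\<dots> \<le> card (N (t + \<eta>)) + card ?Z" by (rule card_Un_le)
    finally have "real (card (Y y)) \<le> real (card (N (t + \<eta>))) + real (card ?Z)" by linarith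
    also have "real (card ?Z) \<le> M" using \<eta> c t by (intro shell) auto
    finally show ?thesis using True by simp
  qed
  have lower: "real (card (N (t - \<eta>))) \<le> real (card (Y y)) + (if y \<in> far s then M else 0)" if y: "y \<in> cell" for y
  proof (cases "y \<in> far s")
    case False
    have "N (t - \<eta>) \<subseteq> Y y"
    proof
      fix p assume "p \<in> N (t - \<eta>)"
      from down[OF this small(1)[OF y False] \<eta>(1)] \<eta> t show "p \<in> Y y" by simp
    qed
    then show ?thesis using card_mono[OF fY[OF y]] False by simp
  next
    case True
    \<comment> \<open>For \<open>t \<le> c\<close> no inner dilate is available; then
      \<open>a = 0\<close> and the shell is the whole dilate by \<open>t - \<eta>\<close>.\<close>
    define a where "a = max (t - c) 0"
    let ?Z = "{p. lat p \<in> sc (t - \<eta>) \<and> (a = 0 \<or> lat p \<notin> sc a)}"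
    have "N (t - \<eta>) \<subseteq> Y y \<union> ?Z"
    proof
      fix p assume p: "p \<in> N (t - \<eta>)"
      show "p \<in> Y y \<union> ?Z"
      proof (cases "a = 0 \<or> lat p \<notin> sc a")
        case True
        then show ?thesis using p by (auto simp: N_def)
      next
        case False
        then have "a = t - c" "c \<le> t" by (auto simp: a_def max_def split: if_splits)
        then have "p \<in> N (t - c)" using False by (auto simp: N_def)
        from down[OF this big(1)[OF y]] show ?thesis using c \<open>c \<le> t\<close> by auto
      qed
    qed
    moreover have fZ: "finite ?Z" using fN[of "t - \<eta>"] by (rule rev_finite_subset) (auto simp: N_def)
    ultimately have "card (N (t - \<eta>)) \<le> card (Y y \<union> ?Z)" using fY[OF y] by (intro card_mono) auto
    also have "\<dots> \<le> card (Y y) + card ?Z" by (rule card_Un_le)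
    finally have "real (card (N (t - \<eta>))) \<le> real (card (Y y)) + real (card ?Z)" by linarith
    also have "real (card ?Z) \<le> M" using \<eta> c t by (intro shell) (auto simp: a_def)
    finally show ?thesis using True by simp
  qed
  have e: "e = M / (real L * s)" by (simp add: e_def M_def s_def)
  have e0: "0 \<le> e" unfolding e using M s by simp
  have P: "ennreal (smooth_count L S t) = (\<integral>\<^sup>+y. ennreal (fejer2 L y) * indicator cell y * ennreal (real (card (Y y))) \<partial>lborel)"
    unfolding Y_def sc_def using t by (intro smooth_count_eq[OF S]) auto
  have P0: "0 \<le> smooth_count L S t" using t by (intro smooth_count_eq[OF S]) auto
  have "ennreal (smooth_count L S t) \<le> (\<integral>\<^sup>+y. ennreal (fejer2 L y) * indicator cell y * ennreal (real (card (N (t + \<eta>)))) + ennreal (fejer2 L y) * indicator (far s) y * ennreal M \<partial>lborel)"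
    unfolding P
  proof (rule nn_integral_mono)
    fix y
    show "ennreal (fejer2 L y) * indicator cell y * ennreal (real (card (Y y)))
      \<le> ennreal (fejer2 L y) * indicator cell y * ennreal (real (card (N (t + \<eta>)))) + ennreal (fejer2 L y) * indicator (far s) y * ennreal M"
    proof (cases "y \<in> cell")
      case True
      have "ennreal (real (card (Y y))) \<le> ennreal (real (card (N (t + \<eta>)))) + indicator (far s) y * ennreal M"
        using ennreal_leI[OF upper[OF True]] M by (auto simp: indicator_def split: if_splits)
      then have "ennreal (fejer2 L y) * ennreal (real (card (Y y))) \<le> ennreal (fejer2 L y) * (ennreal (real (card (N (t + \<eta>)))) + indicator (far s) y * ennreal M)"
        by (intro mult_left_mono) auto
      then show ?thesis using True by (simp add: distrib_left mult_ac)
    qed simp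
  qed
  also have "\<dots> \<le> ennreal (real (card (N (t + \<eta>))) + e)"
    unfolding e by (rule nn_integral_two_levels[OF L s _ M]) simp
  finally show "smooth_count L S t \<le> real (lattice_count S (t + \<eta>)) + e"
    unfolding cN using e0 by (subst (asm) ennreal_le_iff) auto
  have "ennreal (real (card (N (t - \<eta>)))) = (\<integral>\<^sup>+y. ennreal (fejer2 L y) * indicator cell y \<partial>lborel) * ennreal (real (card (N (t - \<eta>))))"
    unfolding fejer2_integral[OF L] by simp
  also have "\<dots> = (\<integral>\<^sup>+y. ennreal (fejer2 L y) * indicator cell y * ennreal (real (card (N (t - \<eta>)))) \<partial>lborel)"
    by (rule nn_integral_multc[symmetric]) simp
  \<comment> \<open>The summand with \<open>ennreal 0\<close> gives the far term the shape of
    \<open>nn_integral_two_levels\<close>, with level 0 on the cell.\<close>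
  also have "\<dots> \<le> (\<integral>\<^sup>+y. ennreal (fejer2 L y) * indicator cell y * ennreal (real (card (Y y))) + (ennreal (fejer2 L y) * indicator cell y * ennreal 0 + ennreal (fejer2 L y) * indicator (far s) y * ennreal M) \<partial>lborel)"
  proof (rule nn_integral_mono)
    fix y
    show "ennreal (fejer2 L y) * indicator cell y * ennreal (real (card (N (t - \<eta>))))
      \<le> ennreal (fejer2 L y) * indicator cell y * ennreal (real (card (Y y))) + (ennreal (fejer2 L y) * indicator cell y * ennreal 0 + ennreal (fejer2 L y) * indicator (far s) y * ennreal M)"
    proof (cases "y \<in> cell")
      case True
      have "ennreal (real (card (N (t - \<eta>)))) \<le> ennreal (real (card (Y y))) + indicator (far s) y * ennreal M"
        using ennreal_leI[OF lower[OF True]] M by (auto simp: indicator_def split: if_splits)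
      then have "ennreal (fejer2 L y) * ennreal (real (card (N (t - \<eta>)))) \<le> ennreal (fejer2 L y) * (ennreal (real (card (Y y))) + indicator (far s) y * ennreal M)"
        by (intro mult_left_mono) auto
      then show ?thesis using True by (simp add: distrib_left mult_ac)
    qed simp
  qed
  also have "\<dots> \<le> ennreal (smooth_count L S t) + ennreal (0 + M / (real L * s))"
  proof (subst nn_integral_add)
    have "(\<lambda>y. indicator cell y * ennreal (real (card (Y y)))) \<in> borel_measurable borel"
      unfolding Y_def sc_def using b t by (intro card_shifted_measurable sets_scaleR_image bounded_scaled) auto
    from borel_measurable_times_ennreal[OF _ this, of "\<lambda>y. ennreal (fejer2 L y)"]
    show "(\<lambda>y. ennreal (fejer2 L y) * indicator cell y * ennreal (real (card (Y y)))) \<in> borel_measurable lborel"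
      unfolding mult.assoc by simp
    show "(\<lambda>y. ennreal (fejer2 L y) * indicator cell y * ennreal 0 + ennreal (fejer2 L y) * indicator (far s) y * ennreal M) \<in> borel_measurable lborel"
      using far_sets by measurable
    show "(\<integral>\<^sup>+y. ennreal (fejer2 L y) * indicator cell y * ennreal (real (card (Y y))) \<partial>lborel)
      + (\<integral>\<^sup>+y. ennreal (fejer2 L y) * indicator cell y * ennreal 0 + ennreal (fejer2 L y) * indicator (far s) y * ennreal M \<partial>lborel)
      \<le> ennreal (smooth_count L S t) + ennreal (0 + M / (real L * s))"
      unfolding P by (intro add_left_mono nn_integral_two_levels L s M) simp
  qed
  finally have "ennreal (real (card (N (t - \<eta>)))) \<le> ennreal (smooth_count L S t + e)"
    using P0 e0 by (simp add: e)
  then show "real (lattice_count S (t - \<eta>)) \<le> smooth_count L S t + e"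
    unfolding cN using e0 P0 by (subst (asm) ennreal_le_iff) auto
qed

subsection \<open>The Fourier expansion of the smoothed count\<close>

text \<open>The coefficients vanish where a coordinate has modulus \<open>L\<close>. With these
  frequencies included, \<open>freqs L\<close> consists of 0 and the square shells of radius 1 to
  \<open>L\<close>.\<close>

definition freqs :: "nat \<Rightarrow> (int \<times> int) set" where
  "freqs L = {-int L..int L} \<times> {-int L..int L}"

text \<open>On \<open>freqs L\<close> this is the familiar
  \<open>(1 - |k1| / L) * (1 - |k2| / L)\<close>. As a count of index pairs it turns the expansion
  of the kernel into a regrouping of a double sum, and the bounds 0 and 1 come from an
  injection.\<close>

definition fejer_coeff :: "nat \<Rightarrow> int \<times> int \<Rightarrow> real" where
  "fejer_coeff L k = real (card {q \<in> ({..<L} \<times> {..<L}) \<times> ({..<L} \<times> {..<L}).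
     (int (fst (fst q)) - int (fst (snd q)), int (snd (fst q)) - int (snd (snd q))) = k}) / (real L)\<^sup>2"

lemma finite_freqs [simp]: "finite (freqs L)" by (simp add: freqs_def)

lemma zero_in_freqs: "0 \<in> freqs L" by (simp add: freqs_def zero_prod_def)

lemma fejer_coeff_bounds:
  assumes "0 < L"
  shows "0 \<le> fejer_coeff L k" "fejer_coeff L k \<le> 1"
proof -
  show "0 \<le> fejer_coeff L k" by (simp add: fejer_coeff_def)
  define Q where "Q = {q \<in> ({..<L} \<times> {..<L}) \<times> ({..<L} \<times> {..<L}).
     (int (fst (fst q)) - int (fst (snd q)), int (snd (fst q)) - int (snd (snd q))) = k}"
  have "inj_on snd Q" by (auto simp: inj_on_def Q_def)
  moreover have "snd ` Q \<subseteq> {..<L} \<times> {..<L}" by (auto simp: Q_def)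
  ultimately have "card Q \<le> card ({..<L} \<times> {..<L})" by (intro card_inj_on_le) auto
  then have "real (card Q) \<le> real (L * L)" by (simp only: card_cartesian_product card_lessThan of_nat_le_iff)
  then have "real (card Q) \<le> (real L)\<^sup>2" by (simp add: power2_eq_square)
  then show "fejer_coeff L k \<le> 1" using assms by (simp add: fejer_coeff_def Q_def)
qed

lemma fejer_coeff_0:
  assumes "0 < L"
  shows "fejer_coeff L 0 = 1"
proof -
  have "{q \<in> ({..<L} \<times> {..<L}) \<times> ({..<L} \<times> {..<L}). (int (fst (fst q)) - int (fst (snd q)), int (snd (fst q)) - int (snd (snd q))) = 0}
    = (\<lambda>n. (n, n)) ` ({..<L} \<times> {..<L})"
    by (auto simp: zero_prod_def)
  moreover have "card ((\<lambda>n. (n, n)) ` ({..<L} \<times> {..<L})) = L * L"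
    by (subst card_image) (auto simp: inj_on_def)
  ultimately show ?thesis using assms by (simp add: fejer_coeff_def power2_eq_square)
qed

lemma fejer2_expand: "fejer2 L x = (\<Sum>k\<in>freqs L. fejer_coeff L k * cos (2 * pi * (lat k \<bullet> x)))"
proof -
  let ?A = "{..<L} \<times> {..<L}"
  define d where "d = (\<lambda>q :: (nat \<times> nat) \<times> (nat \<times> nat). (int (fst (fst q)) - int (fst (snd q)), int (snd (fst q)) - int (snd (snd q))))"
  have e0: "fejer2 L x = (\<Sum>i<L. \<Sum>j<L. cos (2 * pi * (real i - real j) * fst x)) * (\<Sum>i<L. \<Sum>j<L. cos (2 * pi * (real i - real j) * snd x)) / (real L)\<^sup>2"
    by (simp add: fejer2_def fejer_eq power2_eq_square)
  have e1: "(\<Sum>i<L. \<Sum>j<L. cos (2 * pi * (real i - real j) * fst x)) * (\<Sum>i<L. \<Sum>j<L. cos (2 * pi * (real i - real j) * snd x))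
     = (cmod (dirichlet L (fst x) * dirichlet L (snd x)))\<^sup>2"
    by (simp add: norm_mult power_mult_distrib dirichlet_norm_sq)
  have e2: "dirichlet L (fst x) * dirichlet L (snd x) = (\<Sum>n\<in>?A. cis (2 * pi * (real (fst n) * fst x + real (snd n) * snd x)))"
    by (simp add: dirichlet_def sum_product sum.cartesian_product cis_mult split_beta algebra_simps)
  have "(cmod (\<Sum>n\<in>?A. cis (2 * pi * (real (fst n) * fst x + real (snd n) * snd x))))\<^sup>2 = (\<Sum>n\<in>?A. \<Sum>m\<in>?A. cos (2 * pi * (real (fst n) * fst x + real (snd n) * snd x) - 2 * pi * (real (fst m) * fst x + real (snd m) * snd x)))"
    (is "(cmod (\<Sum>n\<in>?A. cis (?a n)))\<^sup>2 = _")
  proof -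
    have "complex_of_real ((cmod (\<Sum>n\<in>?A. cis (?a n)))\<^sup>2) = (\<Sum>n\<in>?A. cis (?a n)) * cnj (\<Sum>n\<in>?A. cis (?a n))"
      by (simp only: complex_norm_square)
    also have "\<dots> = (\<Sum>n\<in>?A. \<Sum>m\<in>?A. cis (?a n - ?a m))"
      by (simp add: sum_product cis_cnj cis_mult)
    finally have "(cmod (\<Sum>n\<in>?A. cis (?a n)))\<^sup>2 = Re (\<Sum>n\<in>?A. \<Sum>m\<in>?A. cis (?a n - ?a m))"
      by (metis Re_complex_of_real)
    then show ?thesis by simp
  qed
  also have "\<dots> = (\<Sum>q\<in>?A \<times> ?A. cos (2 * pi * (lat (d q) \<bullet> x)))"
  proof -
    have "?a n - ?a m = 2 * pi * (lat (d (n, m)) \<bullet> x)" for n m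
      by (cases x) (simp add: d_def lat_def algebra_simps)
    then show ?thesis by (simp add: sum.cartesian_product split_beta)
  qed
  also have "\<dots> = (\<Sum>k\<in>freqs L. \<Sum>q\<in>{q \<in> ?A \<times> ?A. d q = k}. cos (2 * pi * (lat (d q) \<bullet> x)))"
    by (intro sum.group[symmetric]) (auto simp: d_def freqs_def)
  finally have "fejer2 L x = (\<Sum>k\<in>freqs L. \<Sum>q\<in>{q \<in> ?A \<times> ?A. d q = k}. cos (2 * pi * (lat (d q) \<bullet> x))) / (real L)\<^sup>2"
    unfolding e0 e1 e2 by (rule arg_cong[where f="\<lambda>z. z / (real L)\<^sup>2"])
  also have "\<dots> = (\<Sum>k\<in>freqs L. (\<Sum>q\<in>{q \<in> ?A \<times> ?A. d q = k}. cos (2 * pi * (lat (d q) \<bullet> x))) / (real L)\<^sup>2)"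
    by (rule sum_divide_distrib)
  also have "\<dots> = (\<Sum>k\<in>freqs L. fejer_coeff L k * cos (2 * pi * (lat k \<bullet> x)))"
  proof (rule sum.cong[OF refl])
    fix k
    have "(\<Sum>q\<in>{q \<in> ?A \<times> ?A. d q = k}. cos (2 * pi * (lat (d q) \<bullet> x))) = (\<Sum>q\<in>{q \<in> ?A \<times> ?A. d q = k}. cos (2 * pi * (lat k \<bullet> x)))"
      by (intro sum.cong refl) auto
    then show "(\<Sum>q\<in>{q \<in> ?A \<times> ?A. d q = k}. cos (2 * pi * (lat (d q) \<bullet> x))) / (real L)\<^sup>2 = fejer_coeff L k * cos (2 * pi * (lat k \<bullet> x))"
      by (simp add: fejer_coeff_def d_def)
  qed
  finally show ?thesis .
qed

definition body_trans :: "(real \<times> real) set \<Rightarrow> real \<times> real \<Rightarrow> real \<Rightarrow> real" where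
  "body_trans S v t = (\<integral>x. indicator S x * cos (2 * pi * t * (v \<bullet> x)) \<partial>lborel)"

text \<open>The dilation is moved from the body to the frequency, whence the factor
  \<open>t^2\<close>. The zero frequency yields the main term of the lattice count, and the
  remaining sum is \<open>freq_sum\<close>.\<close>

lemma smooth_count_fourier:
  assumes "convex_body \<rho> r S" "0 < t" "0 < L"
  shows "smooth_count L S t = t\<^sup>2 * measure lborel S + t\<^sup>2 * (\<Sum>k\<in>freqs L - {0}. fejer_coeff L k * body_trans S (lat k) t)"
proof -
  note b = convex_bodyD[OF assms(1)]
  have S[measurable]: "S \<in> sets borel" using b(1) by simp
  have meas: "(\<lambda>x. cos (2 * pi * t * (v \<bullet> x))) \<in> borel_measurable borel" for v :: "real \<times> real" and t
    by (intro borel_measurable_continuous_onI continuous_intros)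
  have Tm: "(\<lambda>x. t *\<^sub>R x) ` S \<in> sets borel" "bounded ((\<lambda>x. t *\<^sub>R x) ` S)"
    using b assms(2) by (auto intro!: sets_scaleR_image bounded_scaled)
  have tt: "(\<integral>x. indicator ((\<lambda>x. t *\<^sub>R x) ` S) x * cos (2 * pi * (v \<bullet> x)) \<partial>lborel) = t\<^sup>2 * body_trans S v t" for v
  proof -
    have "(\<lambda>x. indicator ((\<lambda>x. t *\<^sub>R x) ` S) x * cos (2 * pi * (v \<bullet> x))) \<in> borel_measurable borel"
      using Tm(1) meas[of 1 v] by measurable
    from integral_scale[OF this, of t] assms(2)
    have "(\<integral>x. indicator ((\<lambda>x. t *\<^sub>R x) ` S) x * cos (2 * pi * (v \<bullet> x)) \<partial>lborel)
      = t\<^sup>2 * (\<integral>x. indicator ((\<lambda>x. t *\<^sub>R x) ` S) (t *\<^sub>R x) * cos (2 * pi * (v \<bullet> (t *\<^sub>R x))) \<partial>lborel)" by simp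
    also have "(\<integral>x. indicator ((\<lambda>x. t *\<^sub>R x) ` S) (t *\<^sub>R x) * cos (2 * pi * (v \<bullet> (t *\<^sub>R x))) \<partial>lborel) = body_trans S v t"
      unfolding body_trans_def using assms(2)
      by (intro Bochner_Integration.integral_cong refl) (auto simp: indicator_def mult.assoc)
    finally show ?thesis .
  qed
  have "smooth_count L S t = (\<integral>x. (\<Sum>k\<in>freqs L. fejer_coeff L k * (indicator ((\<lambda>x. t *\<^sub>R x) ` S) x * cos (2 * pi * (lat k \<bullet> x)))) \<partial>lborel)"
    unfolding smooth_count_def fejer2_expand by (simp add: sum_distrib_left mult_ac)
  also have "\<dots> = (\<Sum>k\<in>freqs L. \<integral>x. fejer_coeff L k * (indicator ((\<lambda>x. t *\<^sub>R x) ` S) x * cos (2 * pi * (lat k \<bullet> x))) \<partial>lborel)"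
  proof (rule Bochner_Integration.integral_sum)
    fix k
    have "integrable lborel (\<lambda>x. indicator ((\<lambda>x. t *\<^sub>R x) ` S) x * cos (2 * pi * (lat k \<bullet> x)))"
      using meas[of 1 "lat k"] by (intro integrable_bounded_on[OF Tm, where B=1]) auto
    then show "integrable lborel (\<lambda>x. fejer_coeff L k * (indicator ((\<lambda>x. t *\<^sub>R x) ` S) x * cos (2 * pi * (lat k \<bullet> x))))" by simp
  qed
  also have "\<dots> = (\<Sum>k\<in>freqs L. t\<^sup>2 * (fejer_coeff L k * body_trans S (lat k) t))" by (intro sum.cong refl) (simp only: integral_mult_right_zero tt mult.left_commute)
  also have "\<dots> = t\<^sup>2 * (fejer_coeff L 0 * body_trans S (lat 0) t) + (\<Sum>k\<in>freqs L - {0}. t\<^sup>2 * (fejer_coeff L k * body_trans S (lat k) t))"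
    by (rule sum.remove) (auto simp: zero_in_freqs)
  also have "fejer_coeff L 0 * body_trans S (lat 0) t = measure lborel S"
    using assms(3) by (simp add: fejer_coeff_0 body_trans_def lat_def zero_prod_def[symmetric])
  finally show ?thesis by (simp add: sum_distrib_left)
qed

text \<open>Testing the density against cosines and against indicators of half-lines gives the
  transform and both caps from the same \<open>G\<close>. Bounds for a second difference by tails
  thus become bounds by cap areas.\<close>

lemma body_density:
  assumes S: "convex_body \<rho> r S" and "k \<noteq> 0"
  obtains G where "concave_bump (- supp S (- k)) (supp S k) G"
    "\<And>t. body_trans S k t = ctrans G t"
    "\<And>d. right_mass G (supp S k - d) = vcap S k d"
    "\<And>d. left_mass G (- supp S (- k) + d) = vcap S (- k) d"
proof -
  note b = convex_bodyD[OF S]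
  obtain G where G: "concave_bump (- supp S (- k)) (supp S k) G"
    and I: "\<And>f B. f \<in> borel_measurable borel \<Longrightarrow> (\<And>x. \<bar>f x\<bar> \<le> B) \<Longrightarrow>
      (\<integral>x. indicator S x * f (k \<bullet> x) \<partial>lborel) = (\<integral>y. G y * f y \<partial>lborel)"
    by (rule slice_density[OF assms]) blast
  have c: "cap S v d \<in> sets lborel" for v d using sets_cap[OF b(1)] by simp
  show ?thesis
  proof (rule that[OF G])
    show "body_trans S k t = ctrans G t" for t
      unfolding body_trans_def ctrans_def by (rule I[where B=1]) auto
    show "right_mass G (supp S k - d) = vcap S k d" for d
    proof -
      have "vcap S k d = (\<integral>x. indicator (cap S k d) x \<partial>lborel)" using c by (simp add: vcap_def)
      also have "\<dots> = (\<integral>x. indicator S x * indicator {supp S k - d..} (k \<bullet> x) \<partial>lborel)"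
        by (intro Bochner_Integration.integral_cong refl) (auto simp: cap_def indicator_def)
      also have "\<dots> = (\<integral>y. G y * indicator {supp S k - d..} y \<partial>lborel)" by (rule I[where B=1]) (auto simp: indicator_def)
      finally show ?thesis by (simp add: right_mass_def mult.commute)
    qed
    show "left_mass G (- supp S (- k) + d) = vcap S (- k) d" for d
    proof -
      have "vcap S (- k) d = (\<integral>x. indicator (cap S (- k) d) x \<partial>lborel)" using c by (simp add: vcap_def)
      also have "\<dots> = (\<integral>x. indicator S x * indicator {..- supp S (- k) + d} (k \<bullet> x) \<partial>lborel)"
        by (intro Bochner_Integration.integral_cong refl) (auto simp: cap_def indicator_def)
      also have "\<dots> = (\<integral>y. G y * indicator {..- supp S (- k) + d} y \<partial>lborel)" by (rule I[where B=1]) (auto simp: indicator_def)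
      finally show ?thesis by (simp add: left_mass_def mult.commute)
    qed
  qed
qed

lemma ctrans_diff2:
  assumes G: "integrable lborel G"
  shows "ctrans (diff2 \<delta> G) t = - 4 * (sin (pi * (t * \<delta>)))\<^sup>2 * ctrans G t"
proof -
  have sh: "(\<integral>x. G (x + c) * cos (2 * pi * t * x) \<partial>lborel) = (\<integral>x. G x * cos (2 * pi * t * (x - c)) \<partial>lborel)" for c
    by (subst (2) lborel_integral_real_affine[where c=1 and t=c]) (auto simp: add.commute)
  have i: "integrable lborel (\<lambda>x. G (x + c) * cos (2 * pi * t * x))" for c
    using trans_integrable(1)[OF integrable_shift(1)[OF G], of c "2 * pi * t"] .
  have j: "integrable lborel (\<lambda>x. G x * cos (2 * pi * t * (x - c)))" for c
  proof (rule Bochner_Integration.integrable_bound[OF G])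
    show "(\<lambda>x. G x * cos (2 * pi * t * (x - c))) \<in> borel_measurable lborel"
      using borel_measurable_integrable[OF G] by measurable
  qed (auto simp: abs_mult mult_left_le)
  have "ctrans (diff2 \<delta> G) t = (\<integral>x. G (x + \<delta>) * cos (2 * pi * t * x) - 2 * (G (x + 0) * cos (2 * pi * t * x)) + G (x + (- \<delta>)) * cos (2 * pi * t * x) \<partial>lborel)"
    unfolding ctrans_def diff2_def by (intro Bochner_Integration.integral_cong refl) (simp add: algebra_simps)
  also have "\<dots> = (\<integral>x. G (x + \<delta>) * cos (2 * pi * t * x) \<partial>lborel) - 2 * (\<integral>x. G (x + 0) * cos (2 * pi * t * x) \<partial>lborel) + (\<integral>x. G (x + (- \<delta>)) * cos (2 * pi * t * x) \<partial>lborel)"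
    using i by (subst Bochner_Integration.integral_add, (intro Bochner_Integration.integrable_diff integrable_mult_right i)+, subst Bochner_Integration.integral_diff, (intro integrable_mult_right i)+) simp
  also have "\<dots> = (\<integral>x. G x * cos (2 * pi * t * (x - \<delta>)) \<partial>lborel) - 2 * (\<integral>x. G x * cos (2 * pi * t * (x - 0)) \<partial>lborel) + (\<integral>x. G x * cos (2 * pi * t * (x - (- \<delta>))) \<partial>lborel)"
    unfolding sh ..
  also have "\<dots> = (\<integral>x. G x * cos (2 * pi * t * (x - \<delta>)) - 2 * (G x * cos (2 * pi * t * (x - 0))) + G x * cos (2 * pi * t * (x - (- \<delta>))) \<partial>lborel)"
    by (subst Bochner_Integration.integral_add, (intro Bochner_Integration.integrable_diff integrable_mult_right j)+, subst Bochner_Integration.integral_diff, (intro integrable_mult_right j)+) simp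
  also have "\<dots> = (\<integral>x. (- 4 * (sin (pi * (t * \<delta>)))\<^sup>2) * (G x * cos (2 * pi * t * x)) \<partial>lborel)"
  proof (intro Bochner_Integration.integral_cong refl)
    fix x
    define a c where "a = 2 * pi * t * x" and "c = pi * (t * \<delta>)"
    have e: "2 * pi * t * (x - \<delta>) = a - 2 * c" "2 * pi * t * (x - 0) = a" "2 * pi * t * (x - (- \<delta>)) = a + 2 * c"
      by (auto simp: a_def c_def algebra_simps)
    show "G x * cos (2 * pi * t * (x - \<delta>)) - 2 * (G x * cos (2 * pi * t * (x - 0))) + G x * cos (2 * pi * t * (x - (- \<delta>)))
      = (- 4 * (sin (pi * (t * \<delta>)))\<^sup>2) * (G x * cos (2 * pi * t * x))"
      unfolding e a_def[symmetric] c_def[symmetric] cos_add cos_diff cos_double_sin by (simp add: algebra_simps)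
  qed
  also have "\<dots> = - 4 * (sin (pi * (t * \<delta>)))\<^sup>2 * ctrans G t" unfolding ctrans_def by simp
  finally show ?thesis .
qed

lemma ctrans_measurable [measurable]:
  assumes [measurable]: "f \<in> borel_measurable borel"
  shows "ctrans f \<in> borel_measurable borel"
  unfolding ctrans_def[abs_def] by measurable

lemma ctrans_reflect: "ctrans (\<lambda>x. f (- x)) t = ctrans f t"
  unfolding ctrans_def by (subst (2) lborel_integral_real_affine[where c="-1" and t=0]) auto

definition freq_sum :: "nat \<Rightarrow> (real \<times> real) set \<Rightarrow> real \<Rightarrow> real" where
  "freq_sum L S t = (\<Sum>k\<in>freqs L - {0}. fejer_coeff L k * body_trans S (lat k) t)"

definition caps :: "(real \<times> real) set \<Rightarrow> int \<times> int \<Rightarrow> real \<Rightarrow> real" where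
  "caps S k d = vcap S (lat k) d + vcap S (- lat k) d"

text \<open>The weight \<open>norm (lat k)\<close> is the one that
  \<open>quadratic_form_bound\<close> produces.\<close>

definition end_sum :: "nat \<Rightarrow> (real \<times> real) set \<Rightarrow> real \<Rightarrow> real" where
  "end_sum L S d = (\<Sum>k\<in>freqs L - {0}. norm (lat k) * (caps S k d)\<^sup>2)"

definition interior_sum :: "nat \<Rightarrow> (real \<times> real) set \<Rightarrow> real" where
  "interior_sum L S = (\<Sum>k\<in>freqs L - {0}. caps S k 1)"

lemma supp_uminus: "supp (rot pi ` S) v = supp S (- v)"
proof -
  have "rot (- pi) v = - v" by (cases v) (simp add: rot_def)
  then show ?thesis by (simp add: supp_rot)
qed

lemma lat_nonzero: "k \<noteq> 0 \<Longrightarrow> lat k \<noteq> 0"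
  using norm_lat_ge_1[of k] by auto

text \<open>With the step \<open>\<delta>\<close> in the variable \<open>k \<bullet> x\<close>, second differences multiply every transform by the same factor
  \<open>- 4 * (sin (pi * t * \<delta>))\<^sup>2\<close>, independently of the frequency. The second difference of a concave density then lives,
  up to a small error, near the two ends of its support.\<close>

lemma freq_sum_split:
  assumes S: "convex_body \<rho> r S" and L: "0 < L" and \<delta>: "0 < \<delta>" "\<delta> \<le> 1 / 2"
  defines "K \<equiv> freqs L - {0}"
  obtains A B C :: "int \<times> int \<Rightarrow> real \<Rightarrow> real" where
    "\<And>k. k \<in> K \<Longrightarrow> integrable lborel (A k)" "\<And>k. k \<in> K \<Longrightarrow> integrable lborel (B k)" "\<And>k. k \<in> K \<Longrightarrow> integrable lborel (C k)"
    "\<And>k x. k \<in> K \<Longrightarrow> A k x \<noteq> 0 \<Longrightarrow> \<bar>x - supp S (lat k)\<bar> \<le> 1"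
    "\<And>k x. k \<in> K \<Longrightarrow> B k x \<noteq> 0 \<Longrightarrow> \<bar>x - supp (rot pi ` S) (lat k)\<bar> \<le> 1"
    "\<And>k. k \<in> K \<Longrightarrow> (\<integral>x. \<bar>A k x\<bar> \<partial>lborel) \<le> 6 * caps S k (3 * \<delta>)"
    "\<And>k. k \<in> K \<Longrightarrow> (\<integral>x. \<bar>B k x\<bar> \<partial>lborel) \<le> 6 * caps S k (3 * \<delta>)"
    "\<And>k. k \<in> K \<Longrightarrow> (\<integral>x. \<bar>C k x\<bar> \<partial>lborel) \<le> 8 * \<delta>\<^sup>2 * caps S k 1"
    "\<And>t. - 4 * (sin (pi * (t * \<delta>)))\<^sup>2 * freq_sum L S t = (\<Sum>k\<in>K. ctrans (A k) t) + (\<Sum>k\<in>K. ctrans (B k) t) + (\<Sum>k\<in>K. ctrans (C k) t)"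
proof -
  define P where "P = (\<lambda>k G. concave_bump (- supp S (- lat k)) (supp S (lat k)) G \<and> (\<forall>t. body_trans S (lat k) t = ctrans G t) \<and>
    (\<forall>d. right_mass G (supp S (lat k) - d) = vcap S (lat k) d) \<and> (\<forall>d. left_mass G (- supp S (- lat k) + d) = vcap S (- lat k) d))"
  have "\<exists>G. P k G" if "k \<in> K" for k
  proof -
    have nz: "lat k \<noteq> 0" using that lat_nonzero[of k] by (simp add: K_def)
    obtain G where "concave_bump (- supp S (- lat k)) (supp S (lat k)) G" "\<And>t. body_trans S (lat k) t = ctrans G t"
      "\<And>d. right_mass G (supp S (lat k) - d) = vcap S (lat k) d" "\<And>d. left_mass G (- supp S (- lat k) + d) = vcap S (- lat k) d"
      using body_density[OF S nz] by metis
    then have "P k G" by (simp add: P_def)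
    then show ?thesis by (rule exI[where x=G])
  qed
  then have "\<forall>k\<in>K. \<exists>G. P k G" by blast
  from bchoice[OF this] obtain G where "\<forall>k\<in>K. P k (G k)" by blast
  then have PG: "P k (G k)" if "k \<in> K" for k using that by blast
  have G: "concave_bump (- supp S (- lat k)) (supp S (lat k)) (G k)" and GT: "body_trans S (lat k) t = ctrans (G k) t"
    and GR: "right_mass (G k) (supp S (lat k) - d) = vcap S (lat k) d"
    and GL: "left_mass (G k) (- supp S (- lat k) + d) = vcap S (- lat k) d" if "k \<in> K" for k t d
    using PG[OF that] unfolding P_def by blast+
  define \<alpha> \<beta> where "\<alpha> = (\<lambda>k. - supp S (- lat k))" and "\<beta> = (\<lambda>k. supp S (lat k))"
  define c where "c = fejer_coeff L"
  define \<psi> where "\<psi> = (\<lambda>k x. c k * diff2 \<delta> (G k) x)"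
  have c: "0 \<le> c k" "c k \<le> 1" for k using fejer_coeff_bounds[OF L] by (auto simp: c_def)
  have di: "integrable lborel (diff2 \<delta> (G k))" if "k \<in> K" for k by (rule diff2_integrable[OF G[OF that]])
  have pi: "integrable lborel (\<psi> k)" if "k \<in> K" for k unfolding \<psi>_def using di[OF that] by simp
  have absle: "\<bar>\<psi> k x\<bar> \<le> \<bar>diff2 \<delta> (G k) x\<bar>" for k x unfolding \<psi>_def using c[of k] by (simp add: abs_mult mult_left_le_one_le)
  have total: "(\<integral>x. \<bar>\<psi> k x\<bar> \<partial>lborel) \<le> 6 * caps S k (3 * \<delta>)" if "k \<in> K" for k
  proof -
    have "(\<integral>x. \<bar>\<psi> k x\<bar> \<partial>lborel) \<le> (\<integral>x. \<bar>diff2 \<delta> (G k) x\<bar> \<partial>lborel)"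
      using absle di[OF that] by (intro integral_mono') auto
    also have "\<dots> \<le> 6 * (right_mass (G k) (supp S (lat k) - 3 * \<delta>) + left_mass (G k) (- supp S (- lat k) + 3 * \<delta>))"
      by (rule diff2_total[OF G[OF that] \<delta>(1)])
    finally show ?thesis unfolding GR[OF that] GL[OF that] by (simp add: caps_def)
  qed
  have zero: "\<psi> k x = 0" if "k \<in> K" "x \<le> \<alpha> k - \<delta> \<or> \<beta> k + \<delta> \<le> x" for k x
    using that(2) \<delta> concave_bumpD(3)[OF G[OF that(1)], of x] concave_bumpD(3)[OF G[OF that(1)], of "x + \<delta>"] concave_bumpD(3)[OF G[OF that(1)], of "x - \<delta>"]
    by (auto simp: \<psi>_def diff2_def \<alpha>_def \<beta>_def)
  define A where "A = (\<lambda>k x. indicator {\<beta> k - 1<..} x * \<psi> k x)"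
  \<comment> \<open>The lower end is cut against the upper one, so the three pieces partition the
    line even when the support is shorter than 2.\<close>
  define B0 where "B0 = (\<lambda>k x. indicator ({..\<beta> k - 1} \<inter> {..<\<alpha> k + 1}) x * \<psi> k x)"
  \<comment> \<open>Reflection leaves the cosine transform unchanged and moves this piece near
    \<open>supp S (- lat k)\<close>, a support value of the body turned by \<open>pi\<close>. The
    quadratic form bound then applies to that body.\<close>
  define B where "B = (\<lambda>k x. B0 k (- x))"
  define C where "C = (\<lambda>k x. indicator {\<alpha> k + 1..\<beta> k - 1} x * \<psi> k x)"
  have iA: "integrable lborel (A k)" if "k \<in> K" for k unfolding A_def by (intro integrable_indicator_mult pi[OF that]) auto
  have iB0: "integrable lborel (B0 k)" if "k \<in> K" for k unfolding B0_def by (intro integrable_indicator_mult pi[OF that]) auto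
  have iC: "integrable lborel (C k)" if "k \<in> K" for k unfolding C_def by (intro integrable_indicator_mult pi[OF that]) auto
  have iB: "integrable lborel (B k)" if "k \<in> K" for k
    unfolding B_def using lborel_integrable_real_affine[OF iB0[OF that], of "-1" 0] by simp
  show ?thesis
  proof (rule that[of A B C])
    show "\<bar>x - supp S (lat k)\<bar> \<le> 1" if "k \<in> K" "A k x \<noteq> 0" for k x
    proof -
      have "\<beta> k - 1 < x" "\<psi> k x \<noteq> 0" using that by (auto simp: A_def indicator_def split: if_splits)
      with zero[OF that(1), of x] \<delta> have "x < \<beta> k + 1" by force
      with \<open>\<beta> k - 1 < x\<close> show ?thesis by (simp add: \<beta>_def)
    qed
    show "\<bar>x - supp (rot pi ` S) (lat k)\<bar> \<le> 1" if "k \<in> K" "B k x \<noteq> 0" for k x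
    proof -
      have "- x < \<alpha> k + 1" "\<psi> k (- x) \<noteq> 0" using that by (auto simp: B_def B0_def indicator_def split: if_splits)
      with zero[OF that(1), of "-x"] \<delta> have "\<alpha> k - 1 < - x" by force
      with \<open>- x < \<alpha> k + 1\<close> show ?thesis by (simp add: \<alpha>_def supp_uminus)
    qed
    show "(\<integral>x. \<bar>A k x\<bar> \<partial>lborel) \<le> 6 * caps S k (3 * \<delta>)" if "k \<in> K" for k
    proof -
      have "(\<integral>x. \<bar>A k x\<bar> \<partial>lborel) \<le> (\<integral>x. \<bar>\<psi> k x\<bar> \<partial>lborel)"
        using pi[OF that] by (intro integral_mono') (auto simp: A_def indicator_def)
      with total[OF that] show ?thesis by linarith
    qed
    show "(\<integral>x. \<bar>B k x\<bar> \<partial>lborel) \<le> 6 * caps S k (3 * \<delta>)" if "k \<in> K" for k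
    proof -
      have "(\<integral>x. \<bar>B k x\<bar> \<partial>lborel) = (\<integral>x. \<bar>B0 k x\<bar> \<partial>lborel)"
        unfolding B_def by (subst (2) lborel_integral_real_affine[where c="-1" and t=0]) auto
      also have "\<dots> \<le> (\<integral>x. \<bar>\<psi> k x\<bar> \<partial>lborel)"
        using pi[OF that] by (intro integral_mono') (auto simp: B0_def indicator_def)
      finally show ?thesis using total[OF that] by linarith
    qed
    show "(\<integral>x. \<bar>C k x\<bar> \<partial>lborel) \<le> 8 * \<delta>\<^sup>2 * caps S k 1" if "k \<in> K" for k
    proof -
      have "(\<integral>x. \<bar>C k x\<bar> \<partial>lborel) \<le> (\<integral>x. indicator {\<alpha> k + 1..\<beta> k - 1} x * \<bar>diff2 \<delta> (G k) x\<bar> \<partial>lborel)"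
        using absle di[OF that] by (intro integral_mono' integrable_indicator_mult) (auto simp: C_def indicator_def)
      also have "\<dots> \<le> 8 * \<delta>\<^sup>2 / 1\<^sup>2 * (right_mass (G k) (\<beta> k - 1) + left_mass (G k) (\<alpha> k + 1))"
        unfolding \<alpha>_def \<beta>_def by (rule diff2_interior[OF G[OF that] \<delta>(1)]) (use \<delta> in simp)
      finally show ?thesis unfolding \<alpha>_def \<beta>_def GR[OF that] GL[OF that] by (simp add: caps_def)
    qed
    fix t
    have dec: "ctrans (\<psi> k) t = ctrans (A k) t + ctrans (B k) t + ctrans (C k) t" if "k \<in> K" for k
    proof -
      have "\<psi> k x * y = A k x * y + B0 k x * y + C k x * y" for x y
        by (auto simp: A_def B0_def C_def indicator_def)
      then have "ctrans (\<psi> k) t = (\<integral>x. A k x * cos (2 * pi * t * x) + B0 k x * cos (2 * pi * t * x) + C k x * cos (2 * pi * t * x) \<partial>lborel)"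
        unfolding ctrans_def by simp
      also have "\<dots> = ctrans (A k) t + ctrans (B0 k) t + ctrans (C k) t"
        unfolding ctrans_def using trans_integrable(1)[OF iA[OF that], of "2 * pi * t"] trans_integrable(1)[OF iB0[OF that], of "2 * pi * t"] trans_integrable(1)[OF iC[OF that], of "2 * pi * t"]
        by simp
      also have "ctrans (B0 k) t = ctrans (B k) t" unfolding B_def by (simp add: ctrans_reflect)
      finally show ?thesis .
    qed
    have "- 4 * (sin (pi * (t * \<delta>)))\<^sup>2 * freq_sum L S t = (\<Sum>k\<in>K. c k * (- 4 * (sin (pi * (t * \<delta>)))\<^sup>2 * ctrans (G k) t))"
      unfolding freq_sum_def K_def[symmetric] sum_distrib_left using GT by (intro sum.cong refl) (simp add: c_def)
    also have "\<dots> = (\<Sum>k\<in>K. ctrans (\<psi> k) t)"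
    proof (rule sum.cong[OF refl])
      fix k assume "k \<in> K"
      have "ctrans (\<psi> k) t = c k * ctrans (diff2 \<delta> (G k)) t" by (simp add: ctrans_def \<psi>_def mult.assoc)
      then show "c k * (- 4 * (sin (pi * (t * \<delta>)))\<^sup>2 * ctrans (G k) t) = ctrans (\<psi> k) t"
        using ctrans_diff2[OF concave_bumpD(2)[OF G[OF \<open>k \<in> K\<close>]]] by simp
    qed
    also have "\<dots> = (\<Sum>k\<in>K. ctrans (A k) t + ctrans (B k) t + ctrans (C k) t)" by (intro sum.cong refl dec)
    finally show "- 4 * (sin (pi * (t * \<delta>)))\<^sup>2 * freq_sum L S t = (\<Sum>k\<in>K. ctrans (A k) t) + (\<Sum>k\<in>K. ctrans (B k) t) + (\<Sum>k\<in>K. ctrans (C k) t)"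
      by (simp add: sum.distrib)
  qed (use iA iB iC in auto)
qed

text \<open>On the window \<open>t * \<delta>\<close> stays between 1/32 and 1/2, so the factor
  \<open>4 * sin^2\<close> is at least 1/64, and dividing by it costs
  \<open>12288 = 3 * 64^2\<close> after squaring three terms. The two end pieces go through the
  quadratic form. The middle piece is not localized, but it carries the gain
  \<open>\<delta>^2\<close> and can be bounded by absolute values, uniformly in
  \<open>t\<close>.\<close>

lemma freq_sum_mean_square:
  assumes S: "convex_body \<rho> r S" and L: "0 < L" and \<delta>: "0 < \<delta>" "\<delta> \<le> 1 / 2"
    and T: "1 / 32 \<le> (T - 3 / 2) * \<delta>" "(T + 3 / 2) * \<delta> \<le> 1 / 2"
  shows "(\<integral>\<^sup>+t. ennreal (indicator {T - 3/2..T + 3/2} t * (freq_sum L S t)\<^sup>2) \<partial>lborel)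
    \<le> ennreal (12288 * (165888 * supp_sum_const \<rho> r * end_sum L S (3 * \<delta>) + 192 * \<delta> ^ 4 * (interior_sum L S)\<^sup>2))"
proof -
  define K where "K = freqs L - {0}"
  have K: "finite K" "0 \<notin> K" by (auto simp: K_def)
  obtain A B C :: "int \<times> int \<Rightarrow> real \<Rightarrow> real" where i: "\<And>k. k \<in> K \<Longrightarrow> integrable lborel (A k)" "\<And>k. k \<in> K \<Longrightarrow> integrable lborel (B k)" "\<And>k. k \<in> K \<Longrightarrow> integrable lborel (C k)"
    and lA: "\<And>k x. k \<in> K \<Longrightarrow> A k x \<noteq> 0 \<Longrightarrow> \<bar>x - supp S (lat k)\<bar> \<le> 1"
    and lB: "\<And>k x. k \<in> K \<Longrightarrow> B k x \<noteq> 0 \<Longrightarrow> \<bar>x - supp (rot pi ` S) (lat k)\<bar> \<le> 1"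
    and bA: "\<And>k. k \<in> K \<Longrightarrow> (\<integral>x. \<bar>A k x\<bar> \<partial>lborel) \<le> 6 * caps S k (3 * \<delta>)"
    and bB: "\<And>k. k \<in> K \<Longrightarrow> (\<integral>x. \<bar>B k x\<bar> \<partial>lborel) \<le> 6 * caps S k (3 * \<delta>)"
    and bC: "\<And>k. k \<in> K \<Longrightarrow> (\<integral>x. \<bar>C k x\<bar> \<partial>lborel) \<le> 8 * \<delta>\<^sup>2 * caps S k 1"
    and dec: "\<And>t. - 4 * (sin (pi * (t * \<delta>)))\<^sup>2 * freq_sum L S t = (\<Sum>k\<in>K. ctrans (A k) t) + (\<Sum>k\<in>K. ctrans (B k) t) + (\<Sum>k\<in>K. ctrans (C k) t)"
    unfolding K_def by (rule freq_sum_split[OF S L \<delta>]) blast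
  define a b c where "a = (\<lambda>t. \<Sum>k\<in>K. ctrans (A k) t)" and "b = (\<lambda>t. \<Sum>k\<in>K. ctrans (B k) t)" and "c = (\<lambda>t. \<Sum>k\<in>K. ctrans (C k) t)"
  have [measurable]: "a \<in> borel_measurable borel" "b \<in> borel_measurable borel"
    unfolding a_def b_def using i by (auto intro!: borel_measurable_sum ctrans_measurable dest!: borel_measurable_integrable)
  let ?Q = "2304 * supp_sum_const \<rho> r * (36 * end_sum L S (3 * \<delta>))"
  have s0: "0 \<le> supp_sum_const \<rho> r" using convex_bodyD(10)[OF S] by (simp add: supp_sum_const_def)
  have Q: "ennreal (2304 * supp_sum_const \<rho> r * (\<Sum>k\<in>K. norm (lat k) * (\<integral>x. \<bar>\<phi> k x\<bar> \<partial>lborel)\<^sup>2)) \<le> ennreal ?Q"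
    if "\<And>k. k \<in> K \<Longrightarrow> (\<integral>x. \<bar>\<phi> k x\<bar> \<partial>lborel) \<le> 6 * caps S k (3 * \<delta>)" for \<phi> :: "int \<times> int \<Rightarrow> real \<Rightarrow> real"
  proof (intro ennreal_leI mult_left_mono)
    have "(\<Sum>k\<in>K. norm (lat k) * (\<integral>x. \<bar>\<phi> k x\<bar> \<partial>lborel)\<^sup>2) \<le> (\<Sum>k\<in>K. norm (lat k) * (6 * caps S k (3 * \<delta>))\<^sup>2)"
      using that by (intro sum_mono mult_left_mono power_mono) auto
    also have "\<dots> = 36 * end_sum L S (3 * \<delta>)" by (simp add: end_sum_def K_def sum_distrib_left power_mult_distrib mult_ac)
    finally show "(\<Sum>k\<in>K. norm (lat k) * (\<integral>x. \<bar>\<phi> k x\<bar> \<partial>lborel)\<^sup>2) \<le> 36 * end_sum L S (3 * \<delta>)" .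
  qed (use s0 in auto)
  let ?I = "indicator {T - 3/2..T + 3/2} :: real \<Rightarrow> real"
  have Ia: "(\<integral>\<^sup>+t. ennreal (?I t * (a t)\<^sup>2) \<partial>lborel) \<le> ennreal ?Q"
    unfolding a_def by (rule order_trans[OF quadratic_form_bound[OF S K i(1) lA] Q[OF bA]])
  have Ib: "(\<integral>\<^sup>+t. ennreal (?I t * (b t)\<^sup>2) \<partial>lborel) \<le> ennreal ?Q"
    unfolding b_def by (rule order_trans[OF quadratic_form_bound[OF convex_body_rot[OF S] K i(2) lB] Q[OF bB]])
  define m where "m = 64 * \<delta> ^ 4 * (interior_sum L S)\<^sup>2"
  have m0: "0 \<le> m" by (simp add: m_def)
  have cb: "(c t)\<^sup>2 \<le> m" for t
  proof -
    have "\<bar>c t\<bar> \<le> (\<Sum>k\<in>K. \<bar>ctrans (C k) t\<bar>)" unfolding c_def by (rule sum_abs)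
    also have "\<dots> \<le> (\<Sum>k\<in>K. 8 * \<delta>\<^sup>2 * caps S k 1)"
    proof (rule sum_mono)
      fix k assume k: "k \<in> K"
      have "\<bar>ctrans (C k) t\<bar> \<le> (\<integral>x. \<bar>C k x\<bar> \<partial>lborel) * 1" unfolding ctrans_def by (rule trans_bound[OF i(3)[OF k]]) simp
      with bC[OF k] show "\<bar>ctrans (C k) t\<bar> \<le> 8 * \<delta>\<^sup>2 * caps S k 1" by linarith
    qed
    also have "\<dots> = 8 * \<delta>\<^sup>2 * interior_sum L S" by (simp add: interior_sum_def K_def sum_distrib_left)
    finally have "\<bar>c t\<bar>\<^sup>2 \<le> (8 * \<delta>\<^sup>2 * interior_sum L S)\<^sup>2" by (intro power_mono) auto
    then show ?thesis by (simp add: m_def power_mult_distrib power_mult[symmetric])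
  qed
  have pw: "?I t * (freq_sum L S t)\<^sup>2 \<le> 12288 * (?I t * (a t)\<^sup>2) + 12288 * (?I t * (b t)\<^sup>2) + 12288 * m * ?I t" for t
  proof (cases "t \<in> {T - 3/2..T + 3/2}")
    case True
    have "(T - 3/2) * \<delta> \<le> t * \<delta>" "t * \<delta> \<le> (T + 3/2) * \<delta>" using True \<delta> by (auto intro!: mult_right_mono)
    then have t: "1 / 32 \<le> t * \<delta>" "t * \<delta> \<le> 1 / 2" using T by auto
    have "1 / 16 \<le> \<bar>sin (pi * (t * \<delta>))\<bar>" using abs_sin_pi_ge[of "t * \<delta>"] t by simp
    then have "(1 / 16)\<^sup>2 \<le> \<bar>sin (pi * (t * \<delta>))\<bar>\<^sup>2" by (intro power_mono) auto
    then have s: "1 / 64 \<le> 4 * (sin (pi * (t * \<delta>)))\<^sup>2" by (simp add: power2_eq_square)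
    have "\<bar>freq_sum L S t\<bar> * (1 / 64) \<le> \<bar>freq_sum L S t\<bar> * (4 * (sin (pi * (t * \<delta>)))\<^sup>2)" using s by (intro mult_left_mono) auto
    also have "\<dots> = \<bar>- 4 * (sin (pi * (t * \<delta>)))\<^sup>2 * freq_sum L S t\<bar>" by (simp add: abs_mult)
    also have "\<dots> = \<bar>a t + b t + c t\<bar>" unfolding dec a_def b_def c_def ..
    finally have "\<bar>freq_sum L S t\<bar> \<le> 64 * \<bar>a t + b t + c t\<bar>" by simp
    then have "\<bar>freq_sum L S t\<bar>\<^sup>2 \<le> (64 * \<bar>a t + b t + c t\<bar>)\<^sup>2" by (intro power_mono) auto
    then have "(freq_sum L S t)\<^sup>2 \<le> 4096 * (a t + b t + c t)\<^sup>2" by (simp add: power_mult_distrib)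
    also have "(a t + b t + c t)\<^sup>2 \<le> 3 * ((a t)\<^sup>2 + (b t)\<^sup>2 + (c t)\<^sup>2)"
    proof -
      have "0 \<le> (x - y)\<^sup>2 + (y - z)\<^sup>2 + (x - z)\<^sup>2" for x y z :: real by simp
      from this[of "a t" "b t" "c t"] show ?thesis by (simp add: power2_eq_square algebra_simps)
    qed
    finally have "(freq_sum L S t)\<^sup>2 \<le> 12288 * (a t)\<^sup>2 + 12288 * (b t)\<^sup>2 + 12288 * (c t)\<^sup>2" by simp
    then show ?thesis using cb[of t] True by simp
  qed auto
  have "(\<integral>\<^sup>+t. ennreal (?I t * (freq_sum L S t)\<^sup>2) \<partial>lborel)
    \<le> (\<integral>\<^sup>+t. ennreal 12288 * ennreal (?I t * (a t)\<^sup>2) + ennreal 12288 * ennreal (?I t * (b t)\<^sup>2) + ennreal (12288 * m) * indicator {T - 3/2..T + 3/2} t \<partial>lborel)"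
  proof (rule nn_integral_mono)
    fix t
    have "ennreal (?I t * (freq_sum L S t)\<^sup>2) \<le> ennreal (12288 * (?I t * (a t)\<^sup>2) + 12288 * (?I t * (b t)\<^sup>2) + 12288 * m * ?I t)"
      by (rule ennreal_leI[OF pw])
    also have "\<dots> = ennreal 12288 * ennreal (?I t * (a t)\<^sup>2) + ennreal 12288 * ennreal (?I t * (b t)\<^sup>2) + ennreal (12288 * m) * indicator {T - 3/2..T + 3/2} t"
      using m0 by (auto simp: indicator_def ennreal_mult'[symmetric] ennreal_plus[symmetric] simp del: ennreal_plus ennreal_numeral)
    finally show "ennreal (?I t * (freq_sum L S t)\<^sup>2) \<le> \<dots>" .
  qed
  also have "\<dots> = ennreal 12288 * (\<integral>\<^sup>+t. ennreal (?I t * (a t)\<^sup>2) \<partial>lborel) + ennreal 12288 * (\<integral>\<^sup>+t. ennreal (?I t * (b t)\<^sup>2) \<partial>lborel) + ennreal (12288 * m) * ennreal 3"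
    by (subst nn_integral_add, simp, simp, subst nn_integral_add, simp, simp) (simp add: nn_integral_cmult del: ennreal_numeral)
  also have "\<dots> \<le> ennreal 12288 * ennreal ?Q + ennreal 12288 * ennreal ?Q + ennreal (12288 * m) * ennreal 3"
    by (intro add_mono mult_left_mono Ia Ib) auto
  \<comment> \<open>Here \<open>165888 = 2 * 36 * 2304\<close>, for two ends and the square of 6,
    and \<open>192 = 3 * 64\<close>, where 3 is the length of the interval.\<close>
  also have "\<dots> = ennreal (12288 * (165888 * supp_sum_const \<rho> r * end_sum L S (3 * \<delta>) + 192 * \<delta> ^ 4 * (interior_sum L S)\<^sup>2))"
  proof -
    have e0: "0 \<le> end_sum L S (3 * \<delta>)" by (simp add: end_sum_def sum_nonneg)
    have "ennreal 12288 * ennreal ?Q + ennreal 12288 * ennreal ?Q + ennreal (12288 * m) * ennreal 3 = ennreal (12288 * ?Q + 12288 * ?Q + 12288 * m * 3)"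
      using e0 s0 m0 by (simp add: ennreal_mult'[symmetric] ennreal_plus[symmetric] del: ennreal_plus ennreal_numeral)
    then show ?thesis by (simp add: m_def algebra_simps)
  qed
  finally show ?thesis .
qed

subsection \<open>Dyadic scales\<close>

lemma freqs_Suc: "card (freqs (Suc N) - freqs N) = 8 * N + 8"
proof -
  have c: "card (freqs N) = (2 * N + 1) * (2 * N + 1)" for N
  proof -
    have "nat (2 * int N + 1) = 2 * N + 1" by linarith
    then show ?thesis by (simp add: freqs_def card_cartesian_product)
  qed
  have "freqs N \<subseteq> freqs (Suc N)" by (auto simp: freqs_def)
  then have "card (freqs (Suc N) - freqs N) = card (freqs (Suc N)) - card (freqs N)" by (simp add: card_Diff_subset)
  then show ?thesis unfolding c by (simp add: algebra_simps)
qed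

lemma norm_lat_ge:
  assumes "k \<notin> freqs N"
  shows "real (Suc N) \<le> norm (lat k)"
proof -
  have "int (Suc N) \<le> \<bar>fst k\<bar> \<or> int (Suc N) \<le> \<bar>snd k\<bar>"
    using assms by (auto simp: freqs_def mem_Times_iff)
  then have "real (Suc N) \<le> \<bar>real_of_int (fst k)\<bar> \<or> real (Suc N) \<le> \<bar>real_of_int (snd k)\<bar>" by linarith
  moreover have "\<bar>real_of_int (fst k)\<bar> \<le> norm (lat k)" "\<bar>real_of_int (snd k)\<bar> \<le> norm (lat k)"
    using norm_fst_le[of "real_of_int (fst k)" "real_of_int (snd k)"] norm_snd_le[of "real_of_int (snd k)" "real_of_int (fst k)"] 
    by (auto simp: lat_def)
  ultimately show ?thesis by linarith
qed

text \<open>The square shell of radius \<open>j + 1\<close> has \<open>8 * (j + 1)\<close> points,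
  and on it \<open>h\<close> is at most \<open>f (j + 1)\<close>. With \<open>norm_lat_ge\<close>
  this reduces sums over frequencies to sums over radii.\<close>

lemma freqs_shell_sum:
  fixes f :: "nat \<Rightarrow> real" and h :: "int \<times> int \<Rightarrow> real"
  assumes "\<And>k j. k \<notin> freqs j \<Longrightarrow> h k \<le> f (Suc j)"
  shows "(\<Sum>k\<in>freqs N - {0}. h k) \<le> (\<Sum>j<N. 8 * real (Suc j) * f (Suc j))"
proof (induction N)
  case 0
  have "freqs 0 - {0} = {}" by (auto simp: freqs_def zero_prod_def)
  then show ?case by (simp only:) simp
next
  case (Suc N)
  have e: "freqs (Suc N) - {0} = (freqs N - {0}) \<union> (freqs (Suc N) - freqs N)"
  proof -
    have "freqs N \<subseteq> freqs (Suc N)" by (auto simp: freqs_def)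
    with zero_in_freqs[of N] show ?thesis by blast
  qed
  have "(\<Sum>k\<in>freqs (Suc N) - {0}. h k) = (\<Sum>k\<in>freqs N - {0}. h k) + (\<Sum>k\<in>freqs (Suc N) - freqs N. h k)"
    unfolding e by (rule sum.union_disjoint) auto
  also have "(\<Sum>k\<in>freqs (Suc N) - freqs N. h k) \<le> real (card (freqs (Suc N) - freqs N)) * f (Suc N)"
    using assms by (intro sum_bounded_above) auto
  also have "\<dots> = 8 * real (Suc N) * f (Suc N)" unfolding freqs_Suc by (simp add: algebra_simps)
  finally show ?case using Suc.IH by simp
qed

lemma sum_inverse_norm: "(\<Sum>k\<in>freqs N - {0}. 1 / norm (lat k)) \<le> 8 * real N"
proof -
  have "(\<Sum>k\<in>freqs N - {0}. 1 / norm (lat k)) \<le> (\<Sum>j<N. 8 * real (Suc j) * (1 / real (Suc j)))"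
    by (rule freqs_shell_sum) (intro frac_le norm_lat_ge, auto)
  also have "\<dots> = (\<Sum>j<N. 8)" by (intro sum.cong refl) (simp del: of_nat_Suc)
  finally show ?thesis by simp
qed

text \<open>Every dyadic block contributes at most 1. The factor \<open>m\<close> in the averages at
  scale \<open>m\<close> originates here.\<close>

lemma harmonic_pow2: "(\<Sum>j<2 ^ m. 1 / real (Suc j)) \<le> real m + 1"
proof (induction m)
  case (Suc m)
  have "(\<Sum>j<2 ^ Suc m. 1 / real (Suc j)) = (\<Sum>j<2 ^ m. 1 / real (Suc j)) + (\<Sum>j\<in>{2 ^ m..<2 ^ Suc m}. 1 / real (Suc j))"
    by (subst sum.union_disjoint[symmetric]) (auto intro!: sum.cong)
  also have "(\<Sum>j\<in>{2 ^ m..<2 ^ Suc m}. 1 / real (Suc j)) \<le> real (card {2 ^ m..<(2::nat) ^ Suc m}) * (1 / 2 ^ m)"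
  proof (intro sum_bounded_above frac_le)
    fix j :: nat assume "j \<in> {2 ^ m..<2 ^ Suc m}"
    then have "real (2 ^ m) \<le> real (Suc j)" by (intro of_nat_mono) auto
    then show "2 ^ m \<le> real (Suc j)" by simp
  qed auto
  also have "\<dots> = 1" by simp
  finally show ?case using Suc.IH by simp
qed simp

lemma sum_inverse_norm_sq: "(\<Sum>k\<in>freqs (2 ^ m) - {0}. 1 / (norm (lat k))\<^sup>2) \<le> 8 * (real m + 1)"
proof -
  have "(\<Sum>k\<in>freqs (2 ^ m) - {0}. 1 / (norm (lat k))\<^sup>2) \<le> (\<Sum>j<2 ^ m. 8 * real (Suc j) * (1 / (real (Suc j))\<^sup>2))"
    by (rule freqs_shell_sum) (intro frac_le power_mono norm_lat_ge, auto)
  also have "\<dots> = 8 * (\<Sum>j<2 ^ m. 1 / real (Suc j))"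
    unfolding sum_distrib_left by (intro sum.cong refl) (simp add: power2_eq_square del: of_nat_Suc)
  also have "\<dots> \<le> 8 * (real m + 1)" by (intro mult_left_mono harmonic_pow2) simp
  finally show ?thesis .
qed

lemma end_sum_nonneg: "0 \<le> end_sum L S d" by (simp add: end_sum_def sum_nonneg)

text \<open>Cauchy-Schwarz, splitting off the square root of the norm. The linear sum becomes the
  quadratic cap sum at depth 1, so the same rotation average handles the interiors and the
  ends.\<close>

lemma interior_sum_sq_le: "(interior_sum L S)\<^sup>2 \<le> 8 * real L * end_sum L S 1"
proof -
  define K where "K = freqs L - {0}"
  have n: "0 < norm (lat k)" if "k \<in> K" for k using lat_nonzero[of k] that by (simp add: K_def)
  have "interior_sum L S = (\<Sum>k\<in>K. (1 / sqrt (norm (lat k))) * (sqrt (norm (lat k)) * caps S k 1))"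
    unfolding interior_sum_def K_def[symmetric] using n by (intro sum.cong refl) force
  then have "(interior_sum L S)\<^sup>2 \<le> (\<Sum>k\<in>K. (1 / sqrt (norm (lat k)))\<^sup>2) * (\<Sum>k\<in>K. (sqrt (norm (lat k)) * caps S k 1)\<^sup>2)"
    using Cauchy_Schwarz_ineq_sum[of "\<lambda>k. 1 / sqrt (norm (lat k))" "\<lambda>k. sqrt (norm (lat k)) * caps S k 1" K] by simp
  also have "\<dots> = (\<Sum>k\<in>K. 1 / norm (lat k)) * end_sum L S 1"
    by (simp add: power_mult_distrib power_divide end_sum_def K_def)
  also have "\<dots> \<le> 8 * real L * end_sum L S 1"
    unfolding K_def by (intro mult_right_mono sum_inverse_norm end_sum_nonneg)
  finally show ?thesis .
qed

definition error_const :: "real \<Rightarrow> real \<Rightarrow> real" where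
  "error_const \<rho> r = 24 * shell_const \<rho> r / \<rho> + 44 * r\<^sup>2"

text \<open>With kernel degree \<open>2 ^ m\<close> and \<open>\<eta> = 1 / sqrt (2 ^ m)\<close> the
  two losses balance: the area between the dilates is of order \<open>t * \<eta>\<close>, the far
  shifts cost about \<open>t / (2 ^ m * \<eta>)\<close>, and both are of order
  \<open>sqrt (2 ^ m)\<close>. The range of \<open>t\<close> is what
  \<open>R \<le> 2 * 2 ^ m\<close>, \<open>h \<le> R\<close> and the overshoot of a last unit
  interval require.\<close>

lemma lattice_error_le:
  assumes S: "convex_body \<rho> r S" and \<rho>1: "\<rho> \<le> 1" and m: "1 \<le> m"
    and t: "2 ^ m \<le> t" "t \<le> 4 * 2 ^ m + 1"
  defines "\<eta> \<equiv> 1 / sqrt (2 ^ m)"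
  shows "\<bar>lattice_error S t\<bar> \<le> 64 * 4 ^ m * (\<bar>freq_sum (2 ^ m) S (t + \<eta>)\<bar> + \<bar>freq_sum (2 ^ m) S (t - \<eta>)\<bar>) + error_const \<rho> r * sqrt (2 ^ m)"
proof -
  note b = convex_bodyD[OF S]
  define N :: real where "N = 2 ^ m"
  have N2: "2 \<le> N" unfolding N_def using power_increasing[of 1 m "2::real"] m by simp
  define q where "q = sqrt N"
  have q: "0 < q" "q * q = N" "1 < q" using N2 by (auto simp: q_def)
  have \<eta>: "\<eta> = 1 / q" "0 < \<eta>" "\<eta> < 1" using q by (auto simp: \<eta>_def q_def N_def)
  have tN: "N \<le> t" "t \<le> 4 * N + 1" using t by (auto simp: N_def)
  define A where "A = measure lborel S"
  have A: "0 \<le> A" "A \<le> 4 * r\<^sup>2" unfolding A_def using area_ball_le(2)[OF b(5) _ b(10)] b(1) by auto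
  have L: "0 < (2::nat) ^ m" "real (2 ^ m) = N" by (auto simp: N_def)
  define e where "e = (\<lambda>t. shell_const \<rho> r * (t + 1) / (real (2 ^ m) * (\<rho> * \<eta> / 3)))"
  have sc: "0 \<le> shell_const \<rho> r" using b(3) by (simp add: shell_const_def)
  have eb: "e u \<le> 24 * shell_const \<rho> r / \<rho> * q" if "u \<le> t + 1" for u
  proof -
    have "u + 1 \<le> 8 * N" using that tN N2 by linarith
    then have "e u \<le> shell_const \<rho> r * (8 * N) / (N * (\<rho> * \<eta> / 3))"
      unfolding e_def L(2) using sc b(3) \<eta>(2) N2 by (intro divide_right_mono mult_left_mono) auto
    also have "\<dots> = 24 * shell_const \<rho> r / \<rho> * q" using N2 b(3) q(1) by (simp add: \<eta>(1) field_simps)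
    finally show ?thesis .
  qed
  let ?F = "freq_sum (2 ^ m) S"
  have fourier: "smooth_count (2 ^ m) S u = u\<^sup>2 * A + u\<^sup>2 * ?F u" if "0 < u" for u
    using smooth_count_fourier[OF S that L(1)] by (simp add: A_def freq_sum_def)
  have sq: "u\<^sup>2 * x \<le> 64 * 4 ^ m * \<bar>x\<bar>" "- (64 * 4 ^ m * \<bar>x\<bar>) \<le> u\<^sup>2 * x" if "0 < u" "u \<le> t + 1" for u x
  proof -
    have "u \<le> 8 * N" using that tN N2 by linarith
    then have "u\<^sup>2 \<le> (8 * N)\<^sup>2" using that by (intro power_mono) auto
    also have "\<dots> = 64 * N\<^sup>2" by (simp add: power_mult_distrib)
    also have "N\<^sup>2 = 4 ^ m" unfolding N_def power2_eq_square by (simp flip: power_mult_distrib)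
    finally have "u\<^sup>2 * \<bar>x\<bar> \<le> 64 * 4 ^ m * \<bar>x\<bar>" by (intro mult_right_mono) auto
    moreover have "\<bar>u\<^sup>2 * x\<bar> = u\<^sup>2 * \<bar>x\<bar>" by (simp add: abs_mult)
    ultimately show "u\<^sup>2 * x \<le> 64 * 4 ^ m * \<bar>x\<bar>" "- (64 * 4 ^ m * \<bar>x\<bar>) \<le> u\<^sup>2 * x" by linarith+
  qed
  have area: "((t + \<eta>)\<^sup>2 - t\<^sup>2) * A \<le> 44 * r\<^sup>2 * q" "(t\<^sup>2 - (t - \<eta>)\<^sup>2) * A \<le> 44 * r\<^sup>2 * q"
  proof -
    have "t * \<eta> \<le> 5 * q"
    proof -
      have "t \<le> 5 * (q * q)" unfolding q(2) using tN N2 by linarith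
      then show ?thesis using q(1) by (simp add: \<eta>(1) field_simps)
    qed
    moreover have "\<eta>\<^sup>2 \<le> q"
    proof -
      have "\<eta>\<^sup>2 \<le> 1" using \<eta> by (simp add: power_le_one)
      then show ?thesis using q(3) by linarith
    qed
    ultimately have "(t + \<eta>)\<^sup>2 - t\<^sup>2 \<le> 11 * q" "t\<^sup>2 - (t - \<eta>)\<^sup>2 \<le> 11 * q"
    proof -
      have "(t + \<eta>)\<^sup>2 - t\<^sup>2 = 2 * (t * \<eta>) + \<eta>\<^sup>2" "t\<^sup>2 - (t - \<eta>)\<^sup>2 = 2 * (t * \<eta>) - \<eta>\<^sup>2"
        by (simp_all add: power2_eq_square algebra_simps)
      moreover have "0 \<le> \<eta>\<^sup>2" by simp
      moreover assume "t * \<eta> \<le> 5 * q" "\<eta>\<^sup>2 \<le> q"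
      ultimately show "(t + \<eta>)\<^sup>2 - t\<^sup>2 \<le> 11 * q" "t\<^sup>2 - (t - \<eta>)\<^sup>2 \<le> 11 * q" using q(1) by linarith+
    qed
    moreover have "x * A \<le> 44 * r\<^sup>2 * q" if "x \<le> 11 * q" for x
    proof -
      have "x * A \<le> (11 * q) * A" using that A by (intro mult_right_mono)
      also have "\<dots> \<le> (11 * q) * (4 * r\<^sup>2)" using q A by (intro mult_left_mono) auto
      finally show ?thesis by (simp add: mult_ac)
    qed
    ultimately show "((t + \<eta>)\<^sup>2 - t\<^sup>2) * A \<le> 44 * r\<^sup>2 * q" "(t\<^sup>2 - (t - \<eta>)\<^sup>2) * A \<le> 44 * r\<^sup>2 * q" by blast+
  qed
  have up: "1 < t + \<eta>" and lo: "1 < t - \<eta>" and el: "\<eta> \<le> 1"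
    using tN N2 \<eta>(2,3) by linarith+
  \<comment> \<open>The upper bound for the count at \<open>t\<close> uses smoothing at
    \<open>t + \<eta>\<close>, where \<open>t\<close> is the inner dilation factor; the lower bound
    uses it at \<open>t - \<eta>\<close>, where \<open>t\<close> is the outer one.\<close>
  have 1: "real (lattice_count S t) \<le> smooth_count (2 ^ m) S (t + \<eta>) + e (t + \<eta>)"
    using smoothing(2)[OF S L(1) \<eta>(2) el up \<rho>1] by (simp add: e_def)
  have 2: "smooth_count (2 ^ m) S (t - \<eta>) \<le> real (lattice_count S t) + e (t - \<eta>)"
    using smoothing(1)[OF S L(1) \<eta>(2) el lo \<rho>1] by (simp add: e_def)
  have ec: "error_const \<rho> r * q = 24 * shell_const \<rho> r / \<rho> * q + 44 * r\<^sup>2 * q" by (simp add: error_const_def distrib_right)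
  have pos: "0 \<le> 64 * 4 ^ m * \<bar>?F (t - \<eta>)\<bar>" "0 \<le> 64 * 4 ^ m * \<bar>?F (t + \<eta>)\<bar>" by auto
  have U: "lattice_error S t \<le> 64 * 4 ^ m * \<bar>?F (t + \<eta>)\<bar> + error_const \<rho> r * q"
  proof -
    have "lattice_error S t \<le> (t + \<eta>)\<^sup>2 * A + (t + \<eta>)\<^sup>2 * ?F (t + \<eta>) + e (t + \<eta>) - t\<^sup>2 * A"
      using 1 fourier[of "t + \<eta>"] up by (simp add: lattice_error_def A_def)
    also have "\<dots> = ((t + \<eta>)\<^sup>2 - t\<^sup>2) * A + (t + \<eta>)\<^sup>2 * ?F (t + \<eta>) + e (t + \<eta>)" by (simp add: left_diff_distrib)
    also have "\<dots> \<le> 44 * r\<^sup>2 * q + 64 * 4 ^ m * \<bar>?F (t + \<eta>)\<bar> + 24 * shell_const \<rho> r / \<rho> * q"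
      using up el by (intro add_mono area sq eb) auto
    finally show ?thesis unfolding ec by linarith
  qed
  have D: "- lattice_error S t \<le> 64 * 4 ^ m * \<bar>?F (t - \<eta>)\<bar> + error_const \<rho> r * q"
  proof -
    have "- lattice_error S t \<le> t\<^sup>2 * A - ((t - \<eta>)\<^sup>2 * A + (t - \<eta>)\<^sup>2 * ?F (t - \<eta>)) + e (t - \<eta>)"
      using 2 fourier[of "t - \<eta>"] lo by (simp add: lattice_error_def A_def)
    also have "\<dots> = (t\<^sup>2 - (t - \<eta>)\<^sup>2) * A - (t - \<eta>)\<^sup>2 * ?F (t - \<eta>) + e (t - \<eta>)" by (simp add: left_diff_distrib)
    also have "\<dots> \<le> 44 * r\<^sup>2 * q - (- (64 * 4 ^ m * \<bar>?F (t - \<eta>)\<bar>)) + 24 * shell_const \<rho> r / \<rho> * q"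
      using lo \<eta>(2) by (intro add_mono diff_mono area sq eb) auto
    finally show ?thesis unfolding ec by linarith
  qed
  have "\<bar>lattice_error S t\<bar> \<le> 64 * 4 ^ m * \<bar>?F (t + \<eta>)\<bar> + 64 * 4 ^ m * \<bar>?F (t - \<eta>)\<bar> + error_const \<rho> r * q"
    using U D pos by linarith
  then show ?thesis by (simp add: q_def N_def distrib_left)
qed

text \<open>At the scale \<open>t \<approx> 2 ^ m\<close> the difference step is \<open>1 / (16 * 2 ^ m)\<close>; the first sum collects the ends of the densities
  and the second one their interiors. The factor \<open>16 ^ m\<close> is the fourth power of the dilation, coming from \<open>t\<^sup>2\<close> in
  \<open>smooth_count_fourier\<close>.\<close>

definition scale_energy :: "nat \<Rightarrow> (real \<times> real) set \<Rightarrow> real" where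
  "scale_energy m S = 2 ^ m + 16 ^ m * end_sum (2 ^ m) S (3 * (1 / (16 * 2 ^ m))) + 2 ^ m * end_sum (2 ^ m) S 1"

text \<open>\<open>24576 = 2 * 3 * 64^2\<close> collects the two shifts by \<eta>, the square of a
  sum of three terms, and the factor 64 bounding \<open>t^2\<close>. \<open>1536 = 192 * 8\<close>
  combines the interior term with \<open>interior_sum_sq_le\<close>.\<close>

definition energy_const :: "real \<Rightarrow> real \<Rightarrow> real" where
  "energy_const \<rho> r = 24576 * 12288 * (165888 * supp_sum_const \<rho> r + 1536) + 3 * (error_const \<rho> r)\<^sup>2"

lemma scale_energy_ge: "2 ^ m \<le> scale_energy m S"
  by (simp add: scale_energy_def end_sum_nonneg)

lemma body_trans_measurable: "S \<in> sets borel \<Longrightarrow> body_trans S v \<in> borel_measurable borel"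
proof -
  assume [measurable]: "S \<in> sets borel"
  have "(\<lambda>p :: real \<times> real \<times> real. cos (2 * pi * fst p * (v \<bullet> snd p))) \<in> borel_measurable borel"
    by (intro borel_measurable_continuous_onI continuous_intros)
  then have [measurable]: "(\<lambda>p :: real \<times> real \<times> real. cos (2 * pi * fst p * (v \<bullet> snd p))) \<in> borel_measurable (borel \<Otimes>\<^sub>M borel)"
    by (simp add: borel_prod)
  have "(\<lambda>p. indicator S (snd p) * cos (2 * pi * fst p * (v \<bullet> snd p))) \<in> borel_measurable (borel \<Otimes>\<^sub>M lborel)"
    by measurable
  then have "(\<lambda>t. \<integral>x. indicator S x * cos (2 * pi * t * (v \<bullet> x)) \<partial>lborel) \<in> borel_measurable borel"
    using lborel.borel_measurable_lebesgue_integral[of "\<lambda>t x. indicator S x * cos (2 * pi * t * (v \<bullet> x))" borel]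
    by (simp add: split_beta)
  then show ?thesis by (simp add: body_trans_def[abs_def])
qed

lemma freq_sum_measurable: "S \<in> sets borel \<Longrightarrow> freq_sum L S \<in> borel_measurable borel"
  unfolding freq_sum_def[abs_def] by (intro borel_measurable_sum borel_measurable_times borel_measurable_const body_trans_measurable)

lemma unit_window_bound:
  assumes S: "convex_body \<rho> r S" and \<rho>1: "\<rho> \<le> 1" and m: "1 \<le> m"
    and a: "2 ^ m \<le> a" "a \<le> 4 * 2 ^ m"
  shows "(\<integral>\<^sup>+t. ennreal (indicator {a..a + 1} t * (lattice_error S t)\<^sup>2) \<partial>lborel)
    \<le> ennreal (energy_const \<rho> r * scale_energy m S)"
proof -
  note b = convex_bodyD[OF S]
  define N :: real where "N = 2 ^ m"
  have N2: "2 \<le> N" unfolding N_def using power_increasing[of 1 m "2::real"] m by simp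
  define F where "F = freq_sum (2 ^ m) S"
  have [measurable]: "F \<in> borel_measurable borel" unfolding F_def using b(1) by (intro freq_sum_measurable) simp
  define \<eta> where "\<eta> = 1 / sqrt N"
  have \<eta>: "0 < \<eta>" "\<eta> \<le> 1" using N2 by (auto simp: \<eta>_def)
  define E where "E = error_const \<rho> r"
  define P :: real where "P = 12288 * 16 ^ m"
  have P: "0 \<le> P" by (simp add: P_def)
  have pw: "(lattice_error S t)\<^sup>2 \<le> P * (F (t + \<eta>))\<^sup>2 + P * (F (t - \<eta>))\<^sup>2 + 3 * E\<^sup>2 * N" if "t \<in> {a..a + 1}" for t
  proof -
    define x y z where "x = 64 * 4 ^ m * \<bar>F (t + \<eta>)\<bar>" and "y = 64 * 4 ^ m * \<bar>F (t - \<eta>)\<bar>" and "z = E * sqrt N"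
    have "\<bar>lattice_error S t\<bar> \<le> x + y + z"
      using lattice_error_le[OF S \<rho>1 m, of t] that a by (simp add: x_def y_def z_def F_def \<eta>_def N_def E_def distrib_left)
    then have "\<bar>lattice_error S t\<bar>\<^sup>2 \<le> (x + y + z)\<^sup>2" by (intro power_mono) auto
    also have "\<dots> \<le> 3 * (x\<^sup>2 + y\<^sup>2 + z\<^sup>2)"
    proof -
      have "0 \<le> (x - y)\<^sup>2 + (y - z)\<^sup>2 + (x - z)\<^sup>2" by simp
      then show ?thesis by (simp add: power2_eq_square algebra_simps)
    qed
    finally have "(lattice_error S t)\<^sup>2 \<le> 3 * x\<^sup>2 + 3 * y\<^sup>2 + 3 * z\<^sup>2" by simp
    moreover have "((4::real) ^ m)\<^sup>2 = 16 ^ m" unfolding power2_eq_square by (simp flip: power_mult_distrib)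
    then have "3 * x\<^sup>2 = P * (F (t + \<eta>))\<^sup>2" "3 * y\<^sup>2 = P * (F (t - \<eta>))\<^sup>2"
      by (auto simp: x_def y_def P_def power_mult_distrib)
    moreover have "3 * z\<^sup>2 = 3 * E\<^sup>2 * N" using N2 by (simp add: z_def power_mult_distrib)
    ultimately show ?thesis by simp
  qed
  \<comment> \<open>The midpoint of \<open>{a..a + 1}\<close>. The interval of half-length 3/2
    around it contains the translates of \<open>{a..a + 1}\<close> by \<eta> in both
    directions.\<close>
  define T where "T = a + 1 / 2"
  let ?J = "indicator {T - 3/2..T + 3/2} :: real \<Rightarrow> real"
  define B where "B = 12288 * (165888 * supp_sum_const \<rho> r * end_sum (2 ^ m) S (3 * (1 / (16 * 2 ^ m))) + 192 * (1 / (16 * 2 ^ m)) ^ 4 * (interior_sum (2 ^ m) S)\<^sup>2)"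
  have s0: "0 \<le> supp_sum_const \<rho> r" using b(10) by (simp add: supp_sum_const_def)
  have B0: "0 \<le> B" using s0 by (simp add: B_def end_sum_nonneg)
  have FB: "(\<integral>\<^sup>+t. ennreal (?J t * (F t)\<^sup>2) \<partial>lborel) \<le> ennreal B"
    unfolding F_def B_def
  proof (rule freq_sum_mean_square[OF S])
    \<comment> \<open>The step \<open>1 / (16 * 2 ^ m)\<close> is fitted to this: the interval runs
      at most from \<open>2 ^ m - 1\<close>, which is at least half of \<open>2 ^ m\<close>, to
      \<open>4 * 2 ^ m + 2\<close>.\<close>
    show "1 / 32 \<le> (T - 3 / 2) * (1 / (16 * 2 ^ m))" "(T + 3 / 2) * (1 / (16 * 2 ^ m)) \<le> 1 / 2"
      using a N2 by (auto simp: T_def N_def[symmetric] field_simps)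
    show "1 / (16 * 2 ^ m) \<le> (1::real) / 2" using N2 by (simp add: N_def[symmetric] field_simps)
  qed auto
  have shift: "(\<integral>\<^sup>+t. ennreal (indicator {a..a + 1} t * (F (t + c))\<^sup>2) \<partial>lborel) \<le> ennreal B" if "\<bar>c\<bar> \<le> 1" for c
  proof -
    have "(\<integral>\<^sup>+t. ennreal (?J t * (F t)\<^sup>2) \<partial>lborel) = (\<integral>\<^sup>+t. ennreal (?J (c + 1 * t) * (F (c + 1 * t))\<^sup>2) \<partial>lborel)"
      by (subst nn_integral_real_affine[where c=1 and t=c]) auto
    moreover have "(\<integral>\<^sup>+t. ennreal (indicator {a..a + 1} t * (F (t + c))\<^sup>2) \<partial>lborel) \<le> (\<integral>\<^sup>+t. ennreal (?J (c + 1 * t) * (F (c + 1 * t))\<^sup>2) \<partial>lborel)"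
    proof (intro nn_integral_mono ennreal_leI)
      fix t show "indicator {a..a + 1} t * (F (t + c))\<^sup>2 \<le> ?J (c + 1 * t) * (F (c + 1 * t))\<^sup>2"
        using that by (auto simp: indicator_def T_def add.commute abs_le_iff)
    qed
    ultimately show ?thesis using FB by simp
  qed
  have "(\<integral>\<^sup>+t. ennreal (indicator {a..a + 1} t * (lattice_error S t)\<^sup>2) \<partial>lborel)
    \<le> (\<integral>\<^sup>+t. ennreal P * ennreal (indicator {a..a + 1} t * (F (t + \<eta>))\<^sup>2) + ennreal P * ennreal (indicator {a..a + 1} t * (F (t + (- \<eta>)))\<^sup>2) + ennreal (3 * E\<^sup>2 * N) * indicator {a..a + 1} t \<partial>lborel)"
  proof (rule nn_integral_mono)
    fix t
    show "ennreal (indicator {a..a + 1} t * (lattice_error S t)\<^sup>2)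
      \<le> ennreal P * ennreal (indicator {a..a + 1} t * (F (t + \<eta>))\<^sup>2) + ennreal P * ennreal (indicator {a..a + 1} t * (F (t + (- \<eta>)))\<^sup>2) + ennreal (3 * E\<^sup>2 * N) * indicator {a..a + 1} t"
    proof (cases "t \<in> {a..a + 1}")
      case True
      have "ennreal ((lattice_error S t)\<^sup>2) \<le> ennreal (P * (F (t + \<eta>))\<^sup>2 + P * (F (t - \<eta>))\<^sup>2 + 3 * E\<^sup>2 * N)"
        by (rule ennreal_leI[OF pw[OF True]])
      also have "\<dots> = ennreal P * ennreal ((F (t + \<eta>))\<^sup>2) + ennreal P * ennreal ((F (t - \<eta>))\<^sup>2) + ennreal (3 * E\<^sup>2 * N)"
        using P N2 by (simp add: ennreal_mult'[symmetric] ennreal_plus[symmetric] del: ennreal_plus)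
      finally show ?thesis using True by simp
    qed simp
  qed
  also have "\<dots> = ennreal P * (\<integral>\<^sup>+t. ennreal (indicator {a..a + 1} t * (F (t + \<eta>))\<^sup>2) \<partial>lborel) + ennreal P * (\<integral>\<^sup>+t. ennreal (indicator {a..a + 1} t * (F (t + (- \<eta>)))\<^sup>2) \<partial>lborel) + ennreal (3 * E\<^sup>2 * N)"
    by (subst nn_integral_add, simp, simp, subst nn_integral_add, simp, simp) (simp add: nn_integral_cmult)
  also have "\<dots> \<le> ennreal P * ennreal B + ennreal P * ennreal B + ennreal (3 * E\<^sup>2 * N)"
    using \<eta> by (intro add_mono mult_left_mono shift) auto
  also have "\<dots> = ennreal (2 * P * B + 3 * E\<^sup>2 * N)"
    using P B0 N2 by (simp add: ennreal_mult'[symmetric] ennreal_plus[symmetric] del: ennreal_plus)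
  also have "\<dots> \<le> ennreal (energy_const \<rho> r * scale_energy m S)"
  proof (rule ennreal_leI)
    define e1 e2 where "e1 = end_sum (2 ^ m) S (3 * (1 / (16 * 2 ^ m)))" and "e2 = end_sum (2 ^ m) S 1"
    have e: "0 \<le> e1" "0 \<le> e2" by (simp_all add: e1_def e2_def end_sum_nonneg)
    define V where "V = N + 16 ^ m * e1 + N * e2"
    have V: "scale_energy m S = V" by (simp add: V_def scale_energy_def N_def e1_def e2_def)
    have Vp: "0 \<le> V" "N \<le> V" "16 ^ m * e1 \<le> V" "N * e2 \<le> V" using e N2 by (auto simp: V_def)
    have i: "(interior_sum (2 ^ m) S)\<^sup>2 \<le> 8 * N * e2" using interior_sum_sq_le[of "2 ^ m" S] by (simp add: N_def e2_def)
    have m4: "16 ^ m * (1 / (16 * 2 ^ m)) ^ 4 \<le> (1::real)"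
    proof -
      have "((2::real) ^ m) ^ 4 = (2 ^ 4) ^ m" by (simp only: power_mult[symmetric] mult.commute)
      then have "((2::real) ^ m) ^ 4 = 16 ^ m" by simp
      then show ?thesis by (simp add: power_mult_distrib power_divide)
    qed
    have "16 ^ m * B = 12288 * (165888 * supp_sum_const \<rho> r * (16 ^ m * e1) + 192 * (16 ^ m * (1 / (16 * 2 ^ m)) ^ 4) * (interior_sum (2 ^ m) S)\<^sup>2)"
      by (simp add: B_def e1_def algebra_simps)
    also have "\<dots> \<le> 12288 * (165888 * supp_sum_const \<rho> r * V + 192 * 1 * (8 * V))"
    proof (intro mult_left_mono add_mono mult_mono)
      show "(interior_sum (2 ^ m) S)\<^sup>2 \<le> 8 * V" using i Vp by linarith
    qed (use Vp s0 m4 in auto)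
    finally have "16 ^ m * B \<le> 12288 * (165888 * supp_sum_const \<rho> r + 1536) * V" by (simp add: algebra_simps)
    then have "24576 * (16 ^ m * B) \<le> 24576 * (12288 * (165888 * supp_sum_const \<rho> r + 1536) * V)" by (rule mult_left_mono) simp
    moreover have "3 * E\<^sup>2 * N \<le> 3 * E\<^sup>2 * V" using Vp by (intro mult_left_mono) auto
    ultimately show "2 * P * B + 3 * E\<^sup>2 * N \<le> energy_const \<rho> r * scale_energy m S"
      by (simp add: V P_def energy_const_def E_def algebra_simps)
  qed
  finally show ?thesis .
qed

text \<open>In the nonintegrable case the Bochner integral is 0 by convention, so no separate
  integrability argument for the squared error is called for.\<close>

lemma ennreal_integral_le_nn_integral:
  fixes f :: "'a \<Rightarrow> real"
  assumes "\<And>x. 0 \<le> f x"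
  shows "ennreal (\<integral>x. f x \<partial>M) \<le> (\<integral>\<^sup>+x. ennreal (f x) \<partial>M)"
proof (cases "integrable M f")
  case True
  then show ?thesis using assms by (simp add: nn_integral_eq_integral)
qed (simp add: not_integrable_integral_eq)

lemma lattice_count_mono:
  assumes S: "convex_body \<rho> r S" and "0 \<le> t" "t \<le> u"
  shows "lattice_count S t \<le> lattice_count S u"
  unfolding lattice_count_alt
proof (rule card_mono)
  show "finite {p. lat p \<in> (\<lambda>x. u *\<^sub>R x) ` S}" by (intro finite_lat_bounded bounded_scaled convex_bodyD[OF S])
  show "{p. lat p \<in> (\<lambda>x. t *\<^sub>R x) ` S} \<subseteq> {p. lat p \<in> (\<lambda>x. u *\<^sub>R x) ` S}" using scaled_mono[OF assms] by blast
qed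

text \<open>The lattice count grows with the dilation factor, and monotone functions are Borel.
  Writing \<open>max t 0\<close> extends the monotone function to the whole line.\<close>

lemma lattice_error_measurable:
  assumes S: "convex_body \<rho> r S" and "0 \<le> a"
  shows "(\<lambda>t. indicator {a..c} t * (lattice_error S t)\<^sup>2) \<in> borel_measurable borel"
proof -
  have "mono (\<lambda>t. real (lattice_count S (max t 0)))" by (intro monoI) (auto intro!: lattice_count_mono[OF S])
  then have [measurable]: "(\<lambda>t. real (lattice_count S (max t 0))) \<in> borel_measurable borel" by (rule borel_measurable_mono)
  have "(\<lambda>t. indicator {a..c} t * (lattice_error S t)\<^sup>2) = (\<lambda>t. indicator {a..c} t * (real (lattice_count S (max t 0)) - t\<^sup>2 * measure lborel S)\<^sup>2)"
  proof
    fix t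
    show "indicator {a..c} t * (lattice_error S t)\<^sup>2 = indicator {a..c} t * (real (lattice_count S (max t 0)) - t\<^sup>2 * measure lborel S)\<^sup>2"
    proof (cases "t \<in> {a..c}")
      case True
      then have "max t 0 = t" using assms(2) by simp
      then show ?thesis by (simp add: lattice_error_def)
    qed simp
  qed
  then show ?thesis by simp
qed

text \<open>Cover \<open>{R..R + h}\<close> by \<open>\<lceil>h\<rceil>\<close> unit intervals, all
  bounded by the same energy of the block. From \<open>1 \<le> h\<close> the number of intervals is
  at most \<open>2 * h\<close>, and \<open>h \<le> R\<close> keeps the starting points within
  \<open>4 * 2 ^ m\<close>.\<close>

lemma G_mean_sq_bound:
  assumes S: "convex_body \<rho> r S" and \<rho>1: "\<rho> \<le> 1" and m: "1 \<le> m"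
    and R: "2 ^ m \<le> R" "R \<le> 2 * 2 ^ m" and h: "1 \<le> h" "h \<le> R"
  shows "(G_mean S R h)\<^sup>2 \<le> 2 * energy_const \<rho> r * scale_energy m S"
proof -
  define X where "X = energy_const \<rho> r * scale_energy m S"
  have s0: "0 \<le> supp_sum_const \<rho> r" using convex_bodyD(10)[OF S] by (simp add: supp_sum_const_def)
  have X: "0 \<le> X" unfolding X_def energy_const_def
    using s0 scale_energy_ge[of m S] by (intro mult_nonneg_nonneg add_nonneg_nonneg) (auto intro: order_trans[rotated])
  define n where "n = nat \<lceil>h\<rceil>"
  have n: "h \<le> real n" "real n < h + 1" using h unfolding n_def by linarith+
  define f where "f = (\<lambda>t. indicator {R..R + h} t * (lattice_error S t)\<^sup>2)"
  have R0: "0 \<le> R" using R(1) by (rule order_trans[rotated]) simp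
  have "(\<integral>\<^sup>+t. ennreal (f t) \<partial>lborel) \<le> (\<integral>\<^sup>+t. (\<Sum>j<n. ennreal (indicator {R + real j..R + real j + 1} t * (lattice_error S t)\<^sup>2)) \<partial>lborel)"
  proof (rule nn_integral_mono)
    fix t
    show "ennreal (f t) \<le> (\<Sum>j<n. ennreal (indicator {R + real j..R + real j + 1} t * (lattice_error S t)\<^sup>2))"
    proof (cases "t \<in> {R..R + h}")
      case True
      \<comment> \<open>The right end point is assigned to the last interval by hand: for integral
        \<open>h\<close>, rounding down would give the index \<open>n\<close>.\<close>
      define j where "j = (if t = R + h then n - 1 else nat \<lfloor>t - R\<rfloor>)"
      have n0: "0 < n" using n h by linarith
      have j: "j < n" "t \<in> {R + real j..R + real j + 1}"
      proof -
        have "j < n \<and> R + real j \<le> t \<and> t \<le> R + real j + 1"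
        proof (cases "t = R + h")
          case True
          then have "real j = real n - 1" using n0 by (simp add: j_def of_nat_diff)
          moreover have "j < n" using True n0 by (simp add: j_def)
          ultimately show ?thesis using n True by auto
        next
          case False
          then have jj: "j = nat \<lfloor>t - R\<rfloor>" by (simp add: j_def)
          have "0 \<le> t - R" "t - R < h" using \<open>t \<in> {R..R + h}\<close> False by auto
          then have "real j \<le> t - R" "t - R < real j + 1" unfolding jj by linarith+
          moreover from this n \<open>t - R < h\<close> have "real j < real n" by linarith
          ultimately show ?thesis by auto
        qed
        then show "j < n" "t \<in> {R + real j..R + real j + 1}" by auto
      qed
      have "ennreal (f t) = ennreal (indicator {R + real j..R + real j + 1} t * (lattice_error S t)\<^sup>2)"
        using True j by (simp add: f_def)
      also have "\<dots> \<le> (\<Sum>j<n. ennreal (indicator {R + real j..R + real j + 1} t * (lattice_error S t)\<^sup>2))"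
        using j by (intro member_le_sum) auto
      finally show ?thesis .
    qed (simp add: f_def)
  qed
  also have "\<dots> = (\<Sum>j<n. \<integral>\<^sup>+t. ennreal (indicator {R + real j..R + real j + 1} t * (lattice_error S t)\<^sup>2) \<partial>lborel)"
  proof (rule nn_integral_sum)
    fix j
    show "(\<lambda>t. ennreal (indicator {R + real j..R + real j + 1} t * (lattice_error S t)\<^sup>2)) \<in> borel_measurable lborel"
      using lattice_error_measurable[OF S, of "R + real j" "R + real j + 1"] R0 by simp
  qed
  also have "\<dots> \<le> (\<Sum>j<n. ennreal X)"
  proof (rule sum_mono)
    fix j assume "j \<in> {..<n}"
    then have "real j + 1 \<le> real n" by simp
    then have "real j \<le> h" using n by linarith
    then show "(\<integral>\<^sup>+t. ennreal (indicator {R + real j..R + real j + 1} t * (lattice_error S t)\<^sup>2) \<partial>lborel) \<le> ennreal X"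
      unfolding X_def using R h by (intro unit_window_bound[OF S \<rho>1 m]) linarith+
  qed
  also have "\<dots> = ennreal (real n * X)" using X by (simp add: ennreal_mult' ennreal_of_nat_eq_real_of_nat)
  finally have nn: "(\<integral>\<^sup>+t. ennreal (f t) \<partial>lborel) \<le> ennreal (real n * X)" .
  have "(LBINT t=R..R+h. \<bar>lattice_error S t\<bar>\<^sup>2) = (\<integral>t. f t \<partial>lborel)"
    using h by (subst interval_integral_Icc) (auto simp: set_lebesgue_integral_def f_def)
  moreover have "ennreal (\<integral>t. f t \<partial>lborel) \<le> ennreal (real n * X)"
    by (rule order_trans[OF ennreal_integral_le_nn_integral nn]) (simp add: f_def)
  ultimately have I: "(LBINT t=R..R+h. \<bar>lattice_error S t\<bar>\<^sup>2) \<le> real n * X"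
    using X by (simp add: ennreal_le_iff)
  have I0: "0 \<le> (LBINT t=R..R+h. \<bar>lattice_error S t\<bar>\<^sup>2)"
    unfolding \<open>(LBINT t=R..R+h. \<bar>lattice_error S t\<bar>\<^sup>2) = (\<integral>t. f t \<partial>lborel)\<close> by (rule integral_nonneg_AE) (simp add: f_def)
  have "(G_mean S R h)\<^sup>2 = (1 / h) * (LBINT t=R..R+h. \<bar>lattice_error S t\<bar>\<^sup>2)"
    unfolding G_mean_def using I0 h by (intro real_sqrt_pow2 mult_nonneg_nonneg) auto
  also have "\<dots> \<le> (1 / h) * (real n * X)" using I h by (intro mult_left_mono) auto
  also have "\<dots> = (real n / h) * X" by simp
  also have "\<dots> \<le> 2 * X" using n h X by (intro mult_right_mono) (auto simp: divide_le_eq)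
  finally show ?thesis by (simp add: X_def mult.assoc)
qed

section \<open>Averages over rotations and summation over dyadic blocks\<close>

definition cap_const :: "real \<Rightarrow> real \<Rightarrow> real" where
  "cap_const \<rho> r = 524288 * r\<^sup>2 / \<rho>"

lemma caps_rot_sq_measurable:
  assumes "convex_body \<rho> r S"
  shows "(\<lambda>\<theta>. (caps (rot \<theta> ` S) k d)\<^sup>2) \<in> borel_measurable borel"
  unfolding caps_def using vcap_rot_measurable[OF assms] by measurable

lemma end_sum_measurable:
  assumes "convex_body \<rho> r S"
  shows "(\<lambda>\<theta>. end_sum L (rot \<theta> ` S) d) \<in> borel_measurable borel"
  unfolding end_sum_def using caps_rot_sq_measurable[OF assms] by measurable

lemma scale_energy_measurable:
  assumes "convex_body \<rho> r S"
  shows "(\<lambda>\<theta>. scale_energy m (rot \<theta> ` S)) \<in> borel_measurable borel"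
  unfolding scale_energy_def using end_sum_measurable[OF assms] by measurable

text \<open>The weight contributes one power of the norm and the cap average the power -3. The
  resulting power -2 is the logarithmically divergent case in the plane.\<close>

lemma nn_integral_caps:
  assumes S: "convex_body \<rho> r S" and d: "0 < d" and k: "k \<noteq> 0"
  shows "(\<integral>\<^sup>+\<theta>. ennreal (norm (lat k) * (caps (rot \<theta> ` S) k d)\<^sup>2) * indicator {-pi..pi} \<theta> \<partial>lborel)
    \<le> ennreal (65536 * r\<^sup>2 / \<rho> * d ^ 3 * (1 / (norm (lat k))\<^sup>2))"
proof -
  note b = convex_bodyD[OF S]
  note [measurable] = vcap_rot_measurable[OF S]
  define n where "n = norm (lat k)"
  have n: "0 < n" using lat_nonzero[OF k] by (simp add: n_def)
  define c where "c = 16384 * r\<^sup>2 / \<rho> * (d / n) ^ 3"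
  have c0: "0 \<le> c" using b(3) d n by (simp add: c_def)
  have I: "(\<integral>\<^sup>+\<theta>. ennreal ((vcap (rot \<theta> ` S) v d)\<^sup>2) * indicator {-pi..pi} \<theta> \<partial>lborel) \<le> ennreal c" if "norm v = n" for v
    using nn_integral_vcap_rot[OF S d, of v] that n by (force simp: c_def)
  have "(\<integral>\<^sup>+\<theta>. ennreal (n * (caps (rot \<theta> ` S) k d)\<^sup>2) * indicator {-pi..pi} \<theta> \<partial>lborel)
    \<le> (\<integral>\<^sup>+\<theta>. ennreal (2 * n) * (ennreal ((vcap (rot \<theta> ` S) (lat k) d)\<^sup>2) * indicator {-pi..pi} \<theta>) + ennreal (2 * n) * (ennreal ((vcap (rot \<theta> ` S) (- lat k) d)\<^sup>2) * indicator {-pi..pi} \<theta>) \<partial>lborel)"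
  proof (rule nn_integral_mono)
    fix \<theta> :: real
    define x y where "x = vcap (rot \<theta> ` S) (lat k) d" and "y = vcap (rot \<theta> ` S) (- lat k) d"
    have "(x + y)\<^sup>2 \<le> 2 * x\<^sup>2 + 2 * y\<^sup>2" using zero_le_power2[of "x - y"] by (simp add: power2_eq_square algebra_simps)
    then have "n * (x + y)\<^sup>2 \<le> n * (2 * x\<^sup>2 + 2 * y\<^sup>2)" using n by (intro mult_left_mono) auto
    also have "\<dots> = 2 * n * x\<^sup>2 + 2 * n * y\<^sup>2" by (simp add: algebra_simps)
    finally have "ennreal (n * (x + y)\<^sup>2) \<le> ennreal (2 * n * x\<^sup>2 + 2 * n * y\<^sup>2)" by (rule ennreal_leI)
    also have "\<dots> = ennreal (2 * n) * ennreal (x\<^sup>2) + ennreal (2 * n) * ennreal (y\<^sup>2)"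
      using n by (simp add: ennreal_mult'[symmetric] ennreal_plus[symmetric] del: ennreal_plus)
    finally show "ennreal (n * (caps (rot \<theta> ` S) k d)\<^sup>2) * indicator {-pi..pi} \<theta>
      \<le> ennreal (2 * n) * (ennreal (x\<^sup>2) * indicator {-pi..pi} \<theta>) + ennreal (2 * n) * (ennreal (y\<^sup>2) * indicator {-pi..pi} \<theta>)"
      by (simp add: caps_def x_def y_def indicator_def)
  qed
  also have "\<dots> = ennreal (2 * n) * (\<integral>\<^sup>+\<theta>. ennreal ((vcap (rot \<theta> ` S) (lat k) d)\<^sup>2) * indicator {-pi..pi} \<theta> \<partial>lborel) 
     + ennreal (2 * n) * (\<integral>\<^sup>+\<theta>. ennreal ((vcap (rot \<theta> ` S) (- lat k) d)\<^sup>2) * indicator {-pi..pi} \<theta> \<partial>lborel)"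
    by (subst nn_integral_add, simp, simp) (simp add: nn_integral_cmult)
  also have "\<dots> \<le> ennreal (2 * n) * ennreal c + ennreal (2 * n) * ennreal c"
    by (intro add_mono mult_left_mono I) (auto simp: n_def)
  also have "\<dots> = ennreal (4 * n * c)"
    using n c0 by (simp add: ennreal_mult'[symmetric] ennreal_plus[symmetric] del: ennreal_plus)
  also have "4 * n * c = 65536 * r\<^sup>2 / \<rho> * d ^ 3 * (1 / n\<^sup>2)"
    using n by (simp add: c_def power_divide power3_eq_cube power2_eq_square)
  finally show ?thesis by (simp add: n_def)
qed

lemma nn_integral_end_sum:
  assumes S: "convex_body \<rho> r S" and d: "0 < d"
  shows "(\<integral>\<^sup>+\<theta>. ennreal (end_sum (2 ^ m) (rot \<theta> ` S) d) * indicator {-pi..pi} \<theta> \<partial>lborel)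
    \<le> ennreal (cap_const \<rho> r * d ^ 3 * (real m + 1))"
proof -
  note b = convex_bodyD[OF S]
  define K where "K = freqs (2 ^ m) - {0}"
  have [measurable]: "(\<lambda>\<theta>. (caps (rot \<theta> ` S) k d)\<^sup>2) \<in> borel_measurable borel" for k by (rule caps_rot_sq_measurable[OF S])
  have "(\<integral>\<^sup>+\<theta>. ennreal (end_sum (2 ^ m) (rot \<theta> ` S) d) * indicator {-pi..pi} \<theta> \<partial>lborel)
     = (\<integral>\<^sup>+\<theta>. (\<Sum>k\<in>K. ennreal (norm (lat k) * (caps (rot \<theta> ` S) k d)\<^sup>2) * indicator {-pi..pi} \<theta>) \<partial>lborel)"
    by (intro nn_integral_cong) (simp add: end_sum_def K_def sum_distrib_right[symmetric] sum_ennreal)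
  also have "\<dots> = (\<Sum>k\<in>K. \<integral>\<^sup>+\<theta>. ennreal (norm (lat k) * (caps (rot \<theta> ` S) k d)\<^sup>2) * indicator {-pi..pi} \<theta> \<partial>lborel)"
    by (rule nn_integral_sum) measurable
  also have "\<dots> \<le> (\<Sum>k\<in>K. ennreal (65536 * r\<^sup>2 / \<rho> * d ^ 3 * (1 / (norm (lat k))\<^sup>2)))"
    by (intro sum_mono nn_integral_caps[OF S d]) (auto simp: K_def)
  also have "\<dots> = ennreal (65536 * r\<^sup>2 / \<rho> * d ^ 3 * (\<Sum>k\<in>K. 1 / (norm (lat k))\<^sup>2))"
    unfolding sum_distrib_left using b(3) d by (intro sum_ennreal) auto
  also have "\<dots> \<le> ennreal (65536 * r\<^sup>2 / \<rho> * d ^ 3 * (8 * (real m + 1)))"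
    unfolding K_def using b(3) d by (intro ennreal_leI mult_left_mono sum_inverse_norm_sq) auto
  also have "65536 * r\<^sup>2 / \<rho> * d ^ 3 * (8 * (real m + 1)) = cap_const \<rho> r * d ^ 3 * (real m + 1)"
    by (simp add: cap_const_def)
  finally show ?thesis .
qed

text \<open>The cube of the depth \<open>3 / (16 * 2 ^ m)\<close> cancels all but one factor
  \<open>2 ^ m\<close> of \<open>16 ^ m\<close>, while the sum at depth 1 carries
  \<open>2 ^ m\<close> from the start. Ends and interiors thus contribute at most the same
  order.\<close>

lemma nn_integral_scale_energy:
  assumes S: "convex_body \<rho> r S"
  shows "(\<integral>\<^sup>+\<theta>. ennreal (scale_energy m (rot \<theta> ` S)) * indicator {-pi..pi} \<theta> \<partial>lborel)
    \<le> ennreal ((8 + 2 * cap_const \<rho> r) * 2 ^ m * (real m + 1))"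
proof -
  note b = convex_bodyD[OF S]
  have c0: "0 \<le> cap_const \<rho> r" using b(3) by (simp add: cap_const_def)
  note [measurable] = end_sum_measurable[OF S]
  define d :: real where "d = 3 * (1 / (16 * 2 ^ m))"
  have d: "0 < d" by (simp add: d_def)
  have d3: "16 ^ m * d ^ 3 \<le> 2 ^ m"
  proof -
    have "((2::real) ^ m) ^ 3 = (2 ^ 3) ^ m" by (simp only: power_mult[symmetric] mult.commute)
    then have e: "((2::real) ^ m) ^ 3 = 8 ^ m" by simp
    have "(16::real) ^ m = 2 ^ m * 8 ^ m" by (simp flip: power_mult_distrib)
    then have "16 ^ m * d ^ 3 = 2 ^ m * (27 / 4096)" by (simp add: d_def power_mult_distrib power_divide e)
    also have "\<dots> \<le> 2 ^ m * 1" by (intro mult_left_mono) auto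
    finally show ?thesis by simp
  qed
  have "(\<integral>\<^sup>+\<theta>. ennreal (scale_energy m (rot \<theta> ` S)) * indicator {-pi..pi} \<theta> \<partial>lborel)
    = (\<integral>\<^sup>+\<theta>. ennreal (2 ^ m) * indicator {-pi..pi} \<theta> + ennreal (16 ^ m) * (ennreal (end_sum (2 ^ m) (rot \<theta> ` S) d) * indicator {-pi..pi} \<theta>)
       + ennreal (2 ^ m) * (ennreal (end_sum (2 ^ m) (rot \<theta> ` S) 1) * indicator {-pi..pi} \<theta>) \<partial>lborel)"
    by (intro nn_integral_cong)
      (auto simp: scale_energy_def d_def indicator_def end_sum_nonneg ennreal_mult ennreal_plus)
  also have "\<dots> = ennreal (2 ^ m) * ennreal (2 * pi) + ennreal (16 ^ m) * (\<integral>\<^sup>+\<theta>. ennreal (end_sum (2 ^ m) (rot \<theta> ` S) d) * indicator {-pi..pi} \<theta> \<partial>lborel)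
     + ennreal (2 ^ m) * (\<integral>\<^sup>+\<theta>. ennreal (end_sum (2 ^ m) (rot \<theta> ` S) 1) * indicator {-pi..pi} \<theta> \<partial>lborel)"
    by (subst nn_integral_add, simp, simp, subst nn_integral_add, simp, simp) (simp add: nn_integral_cmult)
  also have "\<dots> \<le> ennreal (2 ^ m) * ennreal 8 + ennreal (16 ^ m) * ennreal (cap_const \<rho> r * d ^ 3 * (real m + 1)) + ennreal (2 ^ m) * ennreal (cap_const \<rho> r * 1 ^ 3 * (real m + 1))"
    using pi_less_4 by (intro add_mono mult_left_mono nn_integral_end_sum[OF S] d ennreal_leI) auto
  also have "\<dots> = ennreal (2 ^ m * 8 + 16 ^ m * (cap_const \<rho> r * d ^ 3 * (real m + 1)) + 2 ^ m * (cap_const \<rho> r * (real m + 1)))"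
    using c0 d by (simp add: ennreal_mult'[symmetric] ennreal_plus[symmetric] del: ennreal_plus ennreal_numeral)
  also have "\<dots> \<le> ennreal ((8 + 2 * cap_const \<rho> r) * 2 ^ m * (real m + 1))"
  proof (rule ennreal_leI)
    have "(16 ^ m * d ^ 3) * (cap_const \<rho> r * (real m + 1)) \<le> 2 ^ m * (cap_const \<rho> r * (real m + 1))"
      using c0 by (intro mult_right_mono d3) auto
    moreover have "2 ^ m * 8 \<le> 8 * 2 ^ m * (real m + 1)" by simp
    moreover have "16 ^ m * (cap_const \<rho> r * d ^ 3 * (real m + 1)) = (16 ^ m * d ^ 3) * (cap_const \<rho> r * (real m + 1))"
      "(8 + 2 * cap_const \<rho> r) * 2 ^ m * (real m + 1) = 8 * 2 ^ m * (real m + 1) + 2 * (2 ^ m * (cap_const \<rho> r * (real m + 1)))"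
      by (simp_all add: algebra_simps)
    ultimately show "2 ^ m * 8 + 16 ^ m * (cap_const \<rho> r * d ^ 3 * (real m + 1)) + 2 ^ m * (cap_const \<rho> r * (real m + 1)) \<le> (8 + 2 * cap_const \<rho> r) * 2 ^ m * (real m + 1)"
      by linarith
  qed
  finally show ?thesis .
qed

definition scale_weight :: "real \<Rightarrow> nat \<Rightarrow> real" where
  "scale_weight \<epsilon> m = 1 / (2 ^ m * real m powr (2 + 2 * \<epsilon>))"

text \<open>The sum begins at scale 1, the smallest that \<open>R \<ge> 2\<close> can require. After
  averaging, the weight leaves the convergent series of
  \<open>m powr (- 1 - 2 * \<epsilon>)\<close>.\<close>

definition total_energy :: "real \<Rightarrow> (real \<times> real) set \<Rightarrow> ennreal" where
  "total_energy \<epsilon> S = (\<Sum>n. ennreal (scale_weight \<epsilon> (Suc n) * scale_energy (Suc n) S))"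

lemma total_energy_measurable:
  assumes "convex_body \<rho> r S"
  shows "(\<lambda>\<theta>. total_energy \<epsilon> (rot \<theta> ` S)) \<in> borel_measurable borel"
  unfolding total_energy_def using scale_energy_measurable[OF assms] by measurable

lemma nn_integral_total_energy:
  assumes S: "convex_body \<rho> r S" and \<epsilon>: "0 < \<epsilon>"
  shows "(\<integral>\<^sup>+\<theta>. total_energy \<epsilon> (rot \<theta> ` S) * indicator {-pi..pi} \<theta> \<partial>lborel) < \<infinity>"
proof -
  note [measurable] = scale_energy_measurable[OF S]
  define D where "D = 8 + 2 * cap_const \<rho> r"
  have D: "0 \<le> D" using convex_bodyD(3)[OF S] by (simp add: D_def cap_const_def)
  have w: "0 \<le> scale_weight \<epsilon> m" for m by (simp add: scale_weight_def)
  have bound: "scale_weight \<epsilon> (Suc n) * (D * 2 ^ Suc n * (real (Suc n) + 1)) \<le> 2 * D * (real (Suc n) powr (- 1 - 2 * \<epsilon>))" for n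
  proof -
    define x where "x = real (Suc n)"
    have x: "1 \<le> x" by (simp add: x_def)
    have "scale_weight \<epsilon> (Suc n) * (D * 2 ^ Suc n * (real (Suc n) + 1)) = D * (x + 1) / x powr (2 + 2 * \<epsilon>)"
      by (simp add: scale_weight_def x_def field_simps)
    also have "\<dots> \<le> D * (2 * x) / x powr (2 + 2 * \<epsilon>)" using D x by (intro divide_right_mono mult_left_mono) auto
    also have "\<dots> = 2 * D * (x powr 1 / x powr (2 + 2 * \<epsilon>))" using x by simp
    also have "x powr 1 / x powr (2 + 2 * \<epsilon>) = x powr (1 - (2 + 2 * \<epsilon>))" by (rule powr_diff[symmetric])
    also have "1 - (2 + 2 * \<epsilon>) = - 1 - 2 * \<epsilon>" by simp
    finally show ?thesis by (simp add: x_def)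
  qed
  have "summable (\<lambda>n. real n powr (- 1 - 2 * \<epsilon>))" using \<epsilon> by (simp add: summable_real_powr_iff)
  then have sm: "summable (\<lambda>n. 2 * D * (real (Suc n) powr (- 1 - 2 * \<epsilon>)))"
    by (intro summable_mult) (rule summable_Suc_iff[THEN iffD2])
  have "(\<integral>\<^sup>+\<theta>. total_energy \<epsilon> (rot \<theta> ` S) * indicator {-pi..pi} \<theta> \<partial>lborel)
    = (\<integral>\<^sup>+\<theta>. (\<Sum>n. ennreal (scale_weight \<epsilon> (Suc n)) * (ennreal (scale_energy (Suc n) (rot \<theta> ` S)) * indicator {-pi..pi} \<theta>)) \<partial>lborel)"
    unfolding total_energy_def ennreal_suminf_multc[symmetric]
    by (intro nn_integral_cong suminf_cong) (simp add: ennreal_mult' w mult.assoc)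
  also have "\<dots> = (\<Sum>n. \<integral>\<^sup>+\<theta>. ennreal (scale_weight \<epsilon> (Suc n)) * (ennreal (scale_energy (Suc n) (rot \<theta> ` S)) * indicator {-pi..pi} \<theta>) \<partial>lborel)"
    by (rule nn_integral_suminf) measurable
  also have "\<dots> \<le> (\<Sum>n. ennreal (2 * D * (real (Suc n) powr (- 1 - 2 * \<epsilon>))))"
  proof (intro suminf_le summableI)
    fix n
    have "(\<integral>\<^sup>+\<theta>. ennreal (scale_weight \<epsilon> (Suc n)) * (ennreal (scale_energy (Suc n) (rot \<theta> ` S)) * indicator {-pi..pi} \<theta>) \<partial>lborel)
      = ennreal (scale_weight \<epsilon> (Suc n)) * (\<integral>\<^sup>+\<theta>. ennreal (scale_energy (Suc n) (rot \<theta> ` S)) * indicator {-pi..pi} \<theta> \<partial>lborel)"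
      by (rule nn_integral_cmult) measurable
    also have "\<dots> \<le> ennreal (scale_weight \<epsilon> (Suc n)) * ennreal (D * 2 ^ Suc n * (real (Suc n) + 1))"
      unfolding D_def by (intro mult_left_mono nn_integral_scale_energy[OF S]) auto
    also have "\<dots> = ennreal (scale_weight \<epsilon> (Suc n) * (D * 2 ^ Suc n * (real (Suc n) + 1)))"
      using w D by (subst ennreal_mult) auto
    also have "\<dots> \<le> ennreal (2 * D * (real (Suc n) powr (- 1 - 2 * \<epsilon>)))" by (rule ennreal_leI[OF bound])
    finally show "(\<integral>\<^sup>+\<theta>. ennreal (scale_weight \<epsilon> (Suc n)) * (ennreal (scale_energy (Suc n) (rot \<theta> ` S)) * indicator {-pi..pi} \<theta>) \<partial>lborel)
      \<le> ennreal (2 * D * (real (Suc n) powr (- 1 - 2 * \<epsilon>)))" .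
  qed
  also have "\<dots> = ennreal (\<Sum>n. 2 * D * (real (Suc n) powr (- 1 - 2 * \<epsilon>)))"
    using D sm by (intro suminf_ennreal2) auto
  also have "\<dots> < \<infinity>" by simp
  finally show ?thesis .
qed

lemma dyadic_scale:
  assumes "(2::real) \<le> R"
  obtains m :: nat where "1 \<le> m" "2 ^ m \<le> R" "R \<le> 2 * 2 ^ m" "real m \<le> ln R / ln 2"
proof -
  define m where "m = nat \<lfloor>log 2 R\<rfloor>"
  have "1 \<le> log 2 R" using assms by (subst le_log_iff) auto
  then have m: "1 \<le> m" "real m \<le> log 2 R" "log 2 R < real m + 1" unfolding m_def by linarith+
  have "2 powr real m \<le> R" using m(2) assms by (simp add: le_log_iff)
  moreover have "R < 2 powr (real m + 1)" using m(3) assms by (simp add: log_less_iff)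
  ultimately show ?thesis using m by (intro that[of m]) (auto simp: powr_realpow powr_add log_def)
qed

text \<open>The energy of the block containing \<open>R\<close> is one term of a series of
  nonnegative terms, so a single function of the body dominates all \<open>R\<close> and
  \<open>h\<close>. Undoing the weight costs \<open>2 ^ m * m powr (2 + 2 * \<epsilon>)\<close>,
  where \<open>2 ^ m \<le> R\<close> and \<open>m \<le> ln R / ln 2\<close>.\<close>

lemma G_mean_le_total_energy:
  assumes S: "convex_body \<rho> r S" and \<rho>1: "\<rho> \<le> 1" and \<epsilon>: "0 < \<epsilon>" and R: "2 \<le> R" and h: "1 \<le> h" "h \<le> R"
  shows "ennreal ((G_mean S R h)\<^sup>2) \<le> ennreal (2 * energy_const \<rho> r / ln 2 powr (2 + 2 * \<epsilon>)) * total_energy \<epsilon> S * ennreal (R * ln R powr (2 + 2 * \<epsilon>))"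
proof -
  obtain m where m: "1 \<le> m" "2 ^ m \<le> R" "R \<le> 2 * 2 ^ m" "real m \<le> ln R / ln 2" by (rule dyadic_scale[OF R])
  define p where "p = 2 + 2 * \<epsilon>"
  have p: "0 < p" using \<epsilon> by (simp add: p_def)
  define Z where "Z = scale_energy m S"
  have Z: "0 \<le> Z" unfolding Z_def by (rule order_trans[OF _ scale_energy_ge]) simp
  have s0: "0 \<le> supp_sum_const \<rho> r" using convex_bodyD(10)[OF S] by (simp add: supp_sum_const_def)
  have C: "0 \<le> energy_const \<rho> r" using s0 by (simp add: energy_const_def)
  have w: "0 \<le> scale_weight \<epsilon> m" by (simp add: scale_weight_def)
  have mp: "real m powr p \<le> ln R powr p / ln 2 powr p"
  proof -
    have "real m powr p \<le> (ln R / ln 2) powr p" using m p by (intro powr_mono2) auto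
    also have "\<dots> = ln R powr p / ln 2 powr p" by (rule powr_divide)
    finally show ?thesis .
  qed
  have "(G_mean S R h)\<^sup>2 \<le> 2 * energy_const \<rho> r * Z"
    unfolding Z_def by (rule G_mean_sq_bound[OF S \<rho>1 m(1-3) h])
  also have "Z = scale_weight \<epsilon> m * Z * (2 ^ m * real m powr p)"
    using m(1) by (simp add: scale_weight_def p_def)
  also have "2 * energy_const \<rho> r * (scale_weight \<epsilon> m * Z * (2 ^ m * real m powr p)) \<le> 2 * energy_const \<rho> r * (scale_weight \<epsilon> m * Z * (R * (ln R powr p / ln 2 powr p)))"
    using C w Z m(2) mp R by (intro mult_left_mono mult_mono) auto
  also have "\<dots> = (2 * energy_const \<rho> r / ln 2 powr p) * (scale_weight \<epsilon> m * Z) * (R * ln R powr p)" by simp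
  finally have "ennreal ((G_mean S R h)\<^sup>2) \<le> ennreal ((2 * energy_const \<rho> r / ln 2 powr p) * (scale_weight \<epsilon> m * Z) * (R * ln R powr p))"
    by (rule ennreal_leI)
  also have "\<dots> = ennreal (2 * energy_const \<rho> r / ln 2 powr p) * ennreal (scale_weight \<epsilon> m * Z) * ennreal (R * ln R powr p)"
    using C w Z R by (simp add: ennreal_mult'[symmetric])
  also have "\<dots> \<le> ennreal (2 * energy_const \<rho> r / ln 2 powr p) * total_energy \<epsilon> S * ennreal (R * ln R powr p)"
  proof (intro mult_right_mono mult_left_mono)
    obtain n where n: "m = Suc n" using m(1) by (cases m) auto
    have "(\<Sum>i\<in>{n}. ennreal (scale_weight \<epsilon> (Suc i) * scale_energy (Suc i) S)) \<le> total_energy \<epsilon> S"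
      unfolding total_energy_def by (rule sum_le_suminf) auto
    then show "ennreal (scale_weight \<epsilon> m * Z) \<le> total_energy \<epsilon> S" by (simp add: n Z_def)
  qed auto
  finally show ?thesis by (simp add: p_def)
qed

section \<open>From the total energy to the weak-type constant\<close>

lemma weak_L2_sqrt:
  assumes W: "W \<in> borel_measurable borel" and fin: "(\<integral>\<^sup>+\<theta>. W \<theta> * indicator {-pi..pi} \<theta> \<partial>lborel) < \<infinity>"
  obtains C where "weak_L2_on_circle C" "\<And>\<theta>. (C \<theta>)\<^sup>2 = W \<theta>"
proof -
  \<comment> \<open>\<open>enn2real\<close> sends infinity to 0, so infinite values are preserved by
    a case distinction.\<close>
  define C where "C = (\<lambda>\<theta>. if W \<theta> = \<infinity> then \<infinity> else ennreal (sqrt (enn2real (W \<theta>))))"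
  note W[measurable]
  have sq: "(C \<theta>)\<^sup>2 = W \<theta>" for \<theta>
  proof (cases "W \<theta> = \<infinity>")
    case False
    have "C \<theta> = ennreal (sqrt (enn2real (W \<theta>)))" unfolding C_def by (rule if_not_P[OF False])
    then have "(C \<theta>)\<^sup>2 = (ennreal (sqrt (enn2real (W \<theta>))))\<^sup>2" by (rule arg_cong)
    also have "\<dots> = ennreal ((sqrt (enn2real (W \<theta>)))\<^sup>2)" by (rule ennreal_power) simp
    also have "\<dots> = ennreal (enn2real (W \<theta>))" by (simp only: real_sqrt_pow2 enn2real_nonneg)
    also have "\<dots> = W \<theta>" using False by (intro ennreal_enn2real) (simp add: less_top)
    finally show ?thesis .
  next
    case True
    have "C \<theta> = \<infinity>" unfolding C_def by (rule if_P[OF True])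
    then show ?thesis unfolding True by (simp add: power2_eq_square)
  qed
  have "C \<in> borel_measurable borel" unfolding C_def by measurable
  then have m: "C \<in> borel_measurable (restrict_space lborel {-pi..pi})" by (intro measurable_restrict_space1) simp
  \<comment> \<open>Chebyshev's inequality for \<open>W\<close>, the square of
    \<open>C\<close>.\<close>
  have "(SUP s\<in>{0<..}. ennreal s * emeasure lborel {\<theta> \<in> {-pi..pi}. (C \<theta>)\<^sup>2 > ennreal s}) \<le> (\<integral>\<^sup>+\<theta>. W \<theta> * indicator {-pi..pi} \<theta> \<partial>lborel)"
  proof (rule SUP_least)
    fix s :: real assume "s \<in> {0<..}"
    have "ennreal s * emeasure lborel {\<theta> \<in> {-pi..pi}. (C \<theta>)\<^sup>2 > ennreal s} = (\<integral>\<^sup>+\<theta>. ennreal s * indicator {\<theta> \<in> {-pi..pi}. W \<theta> > ennreal s} \<theta> \<partial>lborel)"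
      unfolding sq by (rule nn_integral_cmult_indicator[symmetric]) measurable
    also have "\<dots> \<le> (\<integral>\<^sup>+\<theta>. W \<theta> * indicator {-pi..pi} \<theta> \<partial>lborel)"
      by (intro nn_integral_mono) (auto simp: indicator_def intro: less_imp_le)
    finally show "ennreal s * emeasure lborel {\<theta> \<in> {-pi..pi}. (C \<theta>)\<^sup>2 > ennreal s} \<le> (\<integral>\<^sup>+\<theta>. W \<theta> * indicator {-pi..pi} \<theta> \<partial>lborel)" .
  qed
  then have "weak_L2_on_circle C" using m fin unfolding weak_L2_on_circle_def by (auto intro: le_less_trans)
  then show ?thesis using sq by (rule that)
qed

lemma ennreal_le_of_square_le:
  assumes "0 \<le> x" "ennreal (x\<^sup>2) \<le> C\<^sup>2 * ennreal (y\<^sup>2)" "0 < y"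
  shows "ennreal x \<le> C * ennreal y"
proof (cases "C = \<infinity>")
  case True
  \<comment> \<open>Positivity of \<open>y\<close> enters here, since infinity times 0 is 0.\<close>
  then show ?thesis using assms(3) by (simp add: ennreal_top_mult)
next
  case False
  then obtain c where c: "C = ennreal c" "0 \<le> c" by (cases C) auto
  have "ennreal (x\<^sup>2) \<le> ennreal ((c * y)\<^sup>2)"
    using assms c by (simp add: ennreal_power ennreal_mult power_mult_distrib)
  then have "x\<^sup>2 \<le> (c * y)\<^sup>2" by (subst (asm) ennreal_le_iff) auto
  then have "x \<le> c * y" by (rule power2_le_imp_le) (use c(2) assms(3) in simp)
  then have "ennreal x \<le> ennreal (c * y)" by (rule ennreal_leI)
  then show ?thesis using c(2) assms(3) by (simp add: c(1) ennreal_mult)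
qed

theorem theorem1p4:
  fixes \<Omega> :: "(real \<times> real) set" and \<epsilon> :: real
  assumes "bounded \<Omega>" "open \<Omega>" "convex \<Omega>" "(0, 0) \<in> \<Omega>" "\<epsilon> > 0"
  shows "\<exists>C :: real \<Rightarrow> ennreal. weak_L2_on_circle C \<and>
    (\<forall>\<theta>\<in>{-pi..pi}. \<forall>R h. R \<ge> 2 \<longrightarrow> 1 \<le> h \<longrightarrow> h \<le> R \<longrightarrow>
       ennreal (G_mean (rot \<theta> ` \<Omega>) R h) \<le> C \<theta> * ennreal (sqrt R * ln R powr (1 + \<epsilon>)))"
proof -
  obtain \<rho>' where \<rho>': "0 < \<rho>'" "ball 0 \<rho>' \<subseteq> \<Omega>" using assms(2,4) openE[of \<Omega> 0] by (auto simp: zero_prod_def)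
  \<comment> \<open>The inner radius is cut down to 1 because \<open>smoothing\<close> needs its
    near shifts to stay inside one cell.\<close>
  define \<rho> where "\<rho> = min \<rho>' 1"
  have \<rho>: "0 < \<rho>" "\<rho> \<le> 1" "ball 0 \<rho> \<subseteq> \<Omega>" using \<rho>' by (auto simp: \<rho>_def)
  obtain r where r: "\<Omega> \<subseteq> ball 0 r" using assms(1) bounded_subset_ballD by blast
  have S: "convex_body \<rho> r \<Omega>" using assms \<rho> r by (simp add: convex_body_def)
  define \<kappa> where "\<kappa> = ennreal (2 * energy_const \<rho> r / ln 2 powr (2 + 2 * \<epsilon>))"
  define W where "W = (\<lambda>\<theta>. \<kappa> * total_energy \<epsilon> (rot \<theta> ` \<Omega>))"
  note [measurable] = total_energy_measurable[OF S]
  have Wm: "W \<in> borel_measurable borel" unfolding W_def by measurable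
  have "(\<integral>\<^sup>+\<theta>. W \<theta> * indicator {-pi..pi} \<theta> \<partial>lborel) = \<kappa> * (\<integral>\<^sup>+\<theta>. total_energy \<epsilon> (rot \<theta> ` \<Omega>) * indicator {-pi..pi} \<theta> \<partial>lborel)"
    unfolding W_def mult.assoc by (rule nn_integral_cmult) measurable
  also have "\<dots> < \<infinity>"
    using nn_integral_total_energy[OF S assms(5)] by (simp add: \<kappa>_def ennreal_mult_less_top)
  finally have Wf: "(\<integral>\<^sup>+\<theta>. W \<theta> * indicator {-pi..pi} \<theta> \<partial>lborel) < \<infinity>" .
  obtain C where C: "weak_L2_on_circle C" "\<And>\<theta>. (C \<theta>)\<^sup>2 = W \<theta>" by (rule weak_L2_sqrt[OF Wm Wf]) blast
  show ?thesis
  proof (intro exI[of _ C] conjI C(1) ballI allI impI)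
    fix \<theta> R h :: real assume R: "2 \<le> R" and h: "1 \<le> h" "h \<le> R"
    have lnR: "0 < ln R" using R by simp
    have "(sqrt R * ln R powr (1 + \<epsilon>))\<^sup>2 = R * ln R powr (2 + 2 * \<epsilon>)"
    proof -
      have "(ln R powr (1 + \<epsilon>))\<^sup>2 = ln R powr (2 + 2 * \<epsilon>)" by (simp add: power2_eq_square powr_add[symmetric])
      then show ?thesis using R by (simp add: power_mult_distrib)
    qed
    \<comment> \<open>Rotated bodies share the radii \<rho> and \<open>r\<close>, so one \<kappa>
      serves every angle. The bound therefore holds for each \<theta>, with
      \<open>C \<theta>\<close> possibly infinite.\<close>
    then have F1: "ennreal ((G_mean (rot \<theta> ` \<Omega>) R h)\<^sup>2) \<le> (C \<theta>)\<^sup>2 * ennreal ((sqrt R * ln R powr (1 + \<epsilon>))\<^sup>2)"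
      using G_mean_le_total_energy[OF convex_body_rot[OF S] \<rho>(2) assms(5) R h, of \<theta>] by (simp add: C(2) W_def \<kappa>_def)
    have "0 \<le> (LBINT t=R..R+h. \<bar>lattice_error (rot \<theta> ` \<Omega>) t\<bar>\<^sup>2)"
      using h by (subst interval_integral_Icc) (auto simp: set_lebesgue_integral_def intro!: integral_nonneg_AE)
    then have F2: "0 \<le> G_mean (rot \<theta> ` \<Omega>) R h" unfolding G_mean_def using h by simp
    have F3: "0 < sqrt R * ln R powr (1 + \<epsilon>)" using R lnR by simp
    show "ennreal (G_mean (rot \<theta> ` \<Omega>) R h) \<le> C \<theta> * ennreal (sqrt R * ln R powr (1 + \<epsilon>))"
      by (rule ennreal_le_of_square_le[OF F2 F1 F3])
  qed
qed

end
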